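(* Let $F:\mathbb{R}^n\times\mathbb{R}^m\rightrightarrows\mathbb{R}^n$ have nonempty, compact and convex values, be locally bounded, be such that $F(\cdot,u)$ is upper semicontinuous for every $u\in\mathbb{R}^m$ and $F(x,\cdot)$ is continuous for every $x\in\mathbb{R}^n$, and satisfy $F(0,0)=\{0\}$. Let $V:\mathbb{R}^n\to\mathbb{R}$ be a locally Lipschitz and nonpathological function such that there exist $\underline\alpha,\overline\alpha\in\mathcal{K}_\infty$, $\rho\in\mathcal{PD}$ and $\gamma\in\mathcal{K}$ with $$\underline\alpha(|x|)\le V(x)\le\overline\alpha(|x|)\quad\forall x\in\mathbb{R}^n,$$ $$V(x)>\gamma(|u|)\ \Longrightarrow\ \max\dot{\overline V}_F(x,u)\le-\rho(|x|)\quad\forall (x,u)\in\mathbb{R}^n\times\mathbb{R}^m.$$ Then the system $\dot x\in F(x,u)$ is input-to-state stable (ISS) with respect to $u$.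
   Context: $\mathcal{U}$ is the set of measurable, locally essentially bounded inputs $u:\mathbb{R}_+\to\mathbb{R}^m$. A (Carathéodory) solution of $\dot x\in F(x,u)$ from $x_0$ is a locally absolutely continuous $x:[0,T)\to\mathbb{R}^n$ with $x(0)=x_0$ and $\dot x(t)\in F(x(t),u(t))$ for a.e. $t$. The system is ISS with respect to $u$ if there exist $\beta\in\mathcal{KL}$ and $\chi\in\mathcal{K}$ such that for every $x_0\in\mathbb{R}^n$ and every $u\in\mathcal{U}$, all solutions starting at $x_0$ satisfy $|x(t)|\le\beta(|x_0|,t)+\chi(\operatorname{ess\,sup}_{0\le\tau\le t}|u(\tau)|)$ for all $t\ge0$ (in particular they are defined on $[0,\infty)$). Class functions: $\mathcal{PD}$ = continuous $\alpha:\mathbb{R}_{\ge0}\to\mathbb{R}$ with $\alpha(0)=0$, $\alpha(s)>0$ for $s\neq0$; $\mathcal{K}$ = continuous, strictly increasing, zero at zero; $\mathcal{K}_\infty$ = unbounded class $\mathcal{K}$; $\mathcal{KL}$ as usual. For locally Lipschitz $V$, the Clarke generalized gradient is $\partial V(x)=\operatorname{co}\{\lim_k\nabla V(x_k): x_k\to x,\ x_k\notin\mathcal{N}_V\}$, where $\mathcal{N}_V$ is the (measure zero) set where $\nabla V$ is undefined. The Lie generalized derivative is $\dot{\overline V}_F(x,u):=\{a\in\mathbb{R}\mid\exists f\in F(x,u):\ \langle p,f\rangle=a\ \forall p\in\partial V(x)\}$, which may be empty; the convention $\max\emptyset=-\infty$ is used. A locally Lipschitz $V$ is nonpathological if for every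 absolutely continuous $\varphi:\mathbb{R}_+\to\mathbb{R}^n$, for almost every $t$ there exists $a_t\in\mathbb{R}$ with $\langle v,\dot\varphi(t)\rangle=a_t$ for all $v\in\partial V(\varphi(t))$. *)

theory Defs
  imports "HOL-Analysis.Analysis"
begin

definition class_K :: "(real \<Rightarrow> real) \<Rightarrow> bool" where
  "class_K \<alpha> \<longleftrightarrow> continuous_on {0..} \<alpha> \<and> strict_mono_on {0..} \<alpha> \<and> \<alpha> 0 = 0"

definition class_K_inf :: "(real \<Rightarrow> real) \<Rightarrow> bool" where
  "class_K_inf \<alpha> \<longleftrightarrow> class_K \<alpha> \<and> filterlim \<alpha> at_top at_top"

definition class_PD :: "(real \<Rightarrow> real) \<Rightarrow> bool" where
  "class_PD \<rho> \<longleftrightarrow> continuous_on {0..} \<rho> \<and> \<rho> 0 = 0 \<and> (\<forall>s>0. \<rho> s > 0)"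

definition class_KL :: "(real \<Rightarrow> real \<Rightarrow> real) \<Rightarrow> bool" where
  "class_KL \<beta> \<longleftrightarrow> continuous_on ({0..} \<times> {0..}) (\<lambda>(s,t). \<beta> s t) \<and>
     (\<forall>t\<ge>0. class_K (\<lambda>s. \<beta> s t)) \<and>
     (\<forall>s\<ge>0. (\<forall>t1 t2. 0 \<le> t1 \<longrightarrow> t1 \<le> t2 \<longrightarrow> \<beta> s t2 \<le> \<beta> s t1) \<and>
              ((\<lambda>t. \<beta> s t) \<longlongrightarrow> 0) at_top)"

definition abs_cont_on :: "real \<Rightarrow> real \<Rightarrow> (real \<Rightarrow> 'a::real_normed_vector) \<Rightarrow> bool" where
  "abs_cont_on a b f \<longleftrightarrow> (\<forall>\<epsilon>>0. \<exists>\<delta>>0. \<forall>(n::nat) (l::nat \<Rightarrow> real) r.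
      (\<forall>i<n. a \<le> l i \<and> l i \<le> r i \<and> r i \<le> b) \<longrightarrow>
      (\<forall>i<n. \<forall>j<n. i \<noteq> j \<longrightarrow> r i \<le> l j \<or> r j \<le> l i) \<longrightarrow>
      (\<Sum>i<n. r i - l i) < \<delta> \<longrightarrow> (\<Sum>i<n. norm (f (r i) - f (l i))) < \<epsilon>)"

definition loc_abs_cont :: "ereal \<Rightarrow> (real \<Rightarrow> 'a::real_normed_vector) \<Rightarrow> bool" where
  "loc_abs_cont T f \<longleftrightarrow> (\<forall>S. 0 \<le> S \<and> ereal S < T \<longrightarrow> abs_cont_on 0 S f)"

definition usc_at :: "('a::metric_space \<Rightarrow> 'b::topological_space set) \<Rightarrow> 'a \<Rightarrow> bool" where
  "usc_at G x \<longleftrightarrow> (\<forall>W. open W \<and> G x \<subseteq> W \<longrightarrow> (\<exists>\<delta>>0. \<forall>y. dist y x < \<delta> \<longrightarrow> G y \<subseteq> W))"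

definition lsc_at :: "('a::metric_space \<Rightarrow> 'b::topological_space set) \<Rightarrow> 'a \<Rightarrow> bool" where
  "lsc_at G x \<longleftrightarrow> (\<forall>W. open W \<and> G x \<inter> W \<noteq> {} \<longrightarrow> (\<exists>\<delta>>0. \<forall>y. dist y x < \<delta> \<longrightarrow> G y \<inter> W \<noteq> {}))"

definition usc_map :: "('a::metric_space \<Rightarrow> 'b::topological_space set) \<Rightarrow> bool" where
  "usc_map G \<longleftrightarrow> (\<forall>x. usc_at G x)"

definition cont_map :: "('a::metric_space \<Rightarrow> 'b::topological_space set) \<Rightarrow> bool" where
  "cont_map G \<longleftrightarrow> (\<forall>x. usc_at G x \<and> lsc_at G x)"

definition locally_bounded_map ::
    "('a::euclidean_space \<Rightarrow> 'b::euclidean_space \<Rightarrow> 'c::real_normed_vector set) \<Rightarrow> bool" where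
  "locally_bounded_map F \<longleftrightarrow> (\<forall>x u. \<exists>r>0. \<exists>M. \<forall>y v. dist y x < r \<longrightarrow> dist v u < r \<longrightarrow>
      (\<forall>f\<in>F y v. norm f \<le> M))"

definition locally_lipschitz :: "('a::euclidean_space \<Rightarrow> real) \<Rightarrow> bool" where
  "locally_lipschitz V \<longleftrightarrow> (\<forall>x. \<exists>r>0. \<exists>L. L-lipschitz_on (ball x r) V)"

definition clarke_grad :: "('a::euclidean_space \<Rightarrow> real) \<Rightarrow> 'a \<Rightarrow> 'a set" where
  "clarke_grad V x = convex hull {p. \<exists>(s::nat \<Rightarrow> 'a) (g::nat \<Rightarrow> 'a).
       s \<longlonglongrightarrow> x \<and> (\<forall>k. (V has_derivative (\<lambda>h. g k \<bullet> h)) (at (s k))) \<and> g \<longlonglongrightarrow> p}"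

definition lie_gen_deriv ::
    "('a::euclidean_space \<Rightarrow> 'b \<Rightarrow> 'a set) \<Rightarrow> ('a \<Rightarrow> real) \<Rightarrow> 'a \<Rightarrow> 'b \<Rightarrow> real set" where
  "lie_gen_deriv F V x u = {a. \<exists>f\<in>F x u. \<forall>p\<in>clarke_grad V x. p \<bullet> f = a}"

definition nonpathological :: "('a::euclidean_space \<Rightarrow> real) \<Rightarrow> bool" where
  "nonpathological V \<longleftrightarrow> locally_lipschitz V \<and>
     (\<forall>\<phi>::real \<Rightarrow> 'a. loc_abs_cont \<infinity> \<phi> \<longrightarrow>
        (AE t in lebesgue_on {0..}. \<exists>d a. (\<phi> has_vector_derivative d) (at t) \<and>
             (\<forall>v\<in>clarke_grad V (\<phi> t). v \<bullet> d = a)))"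

definition admissible_input :: "(real \<Rightarrow> 'b::euclidean_space) \<Rightarrow> bool" where
  "admissible_input u \<longleftrightarrow> u \<in> borel_measurable (lebesgue_on {0..}) \<and>
     (\<forall>T\<ge>0. \<exists>M. AE t in lebesgue_on {0..T}. norm (u t) \<le> M)"

text \<open>Essential supremum of |u| over [0,t] (taken to be 0 when [0,t] is null, i.e. t = 0).\<close>
definition ess_sup_norm :: "(real \<Rightarrow> 'b::euclidean_space) \<Rightarrow> real \<Rightarrow> real" where
  "ess_sup_norm u t = Inf {M. 0 \<le> M \<and> (AE \<tau> in lebesgue_on {0..t}. norm (u \<tau>) \<le> M)}"

definition is_solution ::
    "('a::euclidean_space \<Rightarrow> 'b \<Rightarrow> 'a set) \<Rightarrow> (real \<Rightarrow> 'b) \<Rightarrow> 'a \<Rightarrow> ereal \<Rightarrow> (real \<Rightarrow> 'a) \<Rightarrow> bool" where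
  "is_solution F u x0 T x \<longleftrightarrow> 0 < T \<and> x 0 = x0 \<and> loc_abs_cont T x \<and>
     (AE t in lebesgue_on {t. 0 \<le> t \<and> ereal t < T}.
        \<exists>d. (x has_vector_derivative d) (at t) \<and> d \<in> F (x t) (u t))"

text \<open>ISS: the estimate holds along every solution, and every solution is defined on
  [0,\<infinity>) (every solution on a bounded interval is the restriction of one on [0,\<infinity>)).\<close>
definition ISS :: "('a::euclidean_space \<Rightarrow> 'b::euclidean_space \<Rightarrow> 'a set) \<Rightarrow> bool" where
  "ISS F \<longleftrightarrow> (\<exists>\<beta> \<kappa>. class_KL \<beta> \<and> class_K \<kappa> \<and>
     (\<forall>x0 u. admissible_input u \<longrightarrow>
        (\<forall>T x. is_solution F u x0 T x \<longrightarrow>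
           (\<exists>y. is_solution F u x0 \<infinity> y \<and> (\<forall>t. 0 \<le> t \<and> ereal t < T \<longrightarrow> y t = x t))) \<and>
        (\<forall>x. is_solution F u x0 \<infinity> x \<longrightarrow>
           (\<forall>t\<ge>0. norm (x t) \<le> \<beta> (norm x0) t + \<kappa> (ess_sup_norm u t)))))"

end

theory Submission
  imports Defs "HOL-Complex_Analysis.Great_Picard"
begin

text \<open>
  Along a solution \<open>x\<close> the nonpathological property provides, for almost every \<open>t\<close>, a number \<open>a\<close>
  with \<open>p \<bullet> x'(t) = a\<close> for all \<open>p \<in> \<partial>V(x(t))\<close>; by Rademacher's theorem and Fubini the Clarke gradient
  controls all directional increments of \<open>V\<close>, so \<open>V \<circ> x\<close> has derivative \<open>a\<close> at \<open>t\<close>, and \<open>a\<close> lies in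
  the Lie generalized derivative. Hence \<open>W = V \<circ> x\<close> satisfies \<open>W' \<le> - r(W)\<close> almost everywhere on
  \<open>{W > \<gamma>(ess sup |u|)}\<close> for a positive decay rate \<open>r\<close>. With \<open>G' = 1/r\<close> this gives
  \<open>G(W(t)) \<le> G(W(0)) - t\<close> as long as \<open>W\<close> is above the threshold, which is the ISS estimate. The estimate
  confines solutions to a ball, where the inclusion has bounded right-hand side; solutions therefore
  have a limit at a finite end time and can be continued by the existence theorem for
  Caratheodory differential inclusions.
\<close>

section \<open>Lipschitz and absolutely continuous functions of one variable\<close>

text \<open>The curve may stay inside the null set where \<open>V\<close> has no gradient, so
  differentiability almost everywhere cannot be evaluated along it. Gradients at nearby points bound
  the increments over almost every parallel segment, and continuity of \<open>V\<close> extends the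
  bound to all of them. For \<open>d\<close> and \<open>- d\<close> the pairing with the Clarke
  gradient has the single value \<open>a\<close>, respectively \<open>- a\<close>, so the two upper
  bounds close up to a derivative.

  The rate \<open>\<rho>\<close> depends on the norm instead of the value of \<open>V\<close> and
  need not be monotone, hence the passage to a rate \<open>r\<close> in the value. The extra
  property \<open>r v \<le> v\<close> makes the integral of \<open>1 / r\<close> diverge both at 0
  and at infinity, so that \<open>G\<close> maps the positive axis onto the line and the comparison
  decay never ends in finite time.

  Estimates are proved for arcs on compact intervals, before global existence is known, because they
  also serve as the a priori bound for continuation. Since \<open>F\<close> is only upper
  semicontinuous in the state, measurability is secured by freezing the state over each Euler step
  and selecting continuously in the input; state regularity enters only in the limit.\<close>

lemma has_integral_indicator_mult:
  fixes f :: "'a::euclidean_space \<Rightarrow> real"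
  shows "((\<lambda>x. indicator S x * f x) has_integral I) UNIV \<longleftrightarrow> (f has_integral I) S"
proof -
  have "(\<lambda>x. indicator S x * f x) = (\<lambda>x. if x \<in> S then f x else 0)" by (auto simp: indicator_def)
  then show ?thesis by (simp add: has_integral_restrict_UNIV)
qed

text \<open>One-sided Lebesgue differentiation: the cubes of the differentiation theorem have
  \<open>x\<close> as their lower corner, so on the line they produce right averages only.\<close>

lemma AE_right_average:
  fixes f :: "real \<Rightarrow> real"
  assumes "\<And>a b. f integrable_on {a..b}"
  shows "AE x in lborel. ((\<lambda>h. integral {x..x+h} f / h) \<longlongrightarrow> f x) (at_right 0)"
proof -
  obtain N where N: "negligible N"
    "\<And>x e. \<lbrakk>x \<notin> N; 0 < e\<rbrakk> \<Longrightarrow> \<exists>d>0. \<forall>h. 0 < h \<and> h < d \<longrightarrow>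
       norm (integral (cbox x (x + h *\<^sub>R One)) f /\<^sub>R h ^ DIM(real) - f x) < e"
    using integrable_ccontinuous_explicit[of f] assms by auto
  have "((\<lambda>h. integral {x..x+h} f / h) \<longlongrightarrow> f x) (at_right 0)" if xN: "x \<notin> N" for x
  proof (rule tendstoI)
    fix e :: real assume "0 < e"
    then obtain d where "d > 0" "\<forall>h. 0 < h \<and> h < d \<longrightarrow> norm (integral {x..x+h} f / h - f x) < e"
      using N(2)[OF xN \<open>0 < e\<close>] by (auto simp: divide_inverse mult.commute)
    then show "\<forall>\<^sub>F h in at_right 0. dist (integral {x..x+h} f / h) (f x) < e"
      unfolding eventually_at_right_field dist_norm by auto
  qed
  moreover have "AE x in lborel. x \<notin> N"
    using N(1) by (metis AE_completion_iff AE_not_in negligible_iff_null_sets)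
  ultimately show ?thesis by auto
qed

text \<open>Turns statements about right averages of a reflected function into statements about left
  averages.\<close>

lemma AE_lborel_reflect:
  fixes P :: "real \<Rightarrow> bool"
  assumes "AE x in lborel. P x"
  shows "AE x in lborel. P (- x)"
proof -
  obtain N where N: "N \<in> null_sets lborel" "{x. \<not> P x} \<subseteq> N"
    using assms by (auto simp: eventually_ae_filter)
  then have "AE x in lborel. x \<notin> N" by (intro AE_not_in)
  \<comment> \<open>The reflection is written as an affine map of slope -1 to fit
    \<open>AE_borel_affine\<close>.\<close>
  then have "AE x in lborel. 0 + (- 1) * x \<notin> N"
    using N(1) by (intro AE_borel_affine) (auto simp: null_sets_def)
  then show ?thesis
    by eventually_elim (use N(2) in auto)
qed

text \<open>Left difference quotients of \<open>G\<close> are right averages of the reflected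
  integrand, so the one-sided result, used for \<open>f\<close> and for its reflection, gives the
  two-sided derivative.\<close>

lemma indefinite_integral_AE_derivative:
  fixes f G :: "real \<Rightarrow> real"
  assumes G: "\<And>a b. a \<le> b \<Longrightarrow> (f has_integral (G b - G a)) {a..b}"
  shows "AE x in lborel. (G has_real_derivative f x) (at x)"
proof -
  have int: "f integrable_on {a..b}" for a b
    using G[of a b] by (cases "a \<le> b") auto
  have intr: "((\<lambda>x. f (- x)) has_integral (G (-a) - G (-b))) {a..b}" if "a \<le> b" for a b
    using has_integral_reflect_real[of f "G (-a) - G (-b)" "-a" "-b"] G[of "-b" "-a"] that by auto
  then have intr': "(\<lambda>x. f (- x)) integrable_on {a..b}" for a b
    by (cases "a \<le> b") auto
  have l: "AE x in lborel. ((\<lambda>h. integral {-x..-x+h} (\<lambda>x. f (-x)) / h) \<longlongrightarrow> f (- (- x))) (at_right 0)"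
    by (rule AE_lborel_reflect[OF AE_right_average[OF intr']])
  show ?thesis
    using AE_right_average[OF int] l
  proof (rule AE_mp[OF AE_conjI], intro AE_I2 impI, elim conjE)
    fix x
    assume r: "((\<lambda>h. integral {x..x + h} f / h) \<longlongrightarrow> f x) (at_right 0)"
      and l: "((\<lambda>h. integral {- x..- x + h} (\<lambda>x. f (- x)) / h) \<longlongrightarrow> f (- (- x))) (at_right 0)"
    have "((\<lambda>h. (G (x + h) - G x) / h) \<longlongrightarrow> f x) (at_right 0)"
    proof (rule Lim_transform_eventually[OF r])
      show "\<forall>\<^sub>F h in at_right 0. integral {x..x + h} f / h = (G (x + h) - G x) / h"
        unfolding eventually_at_right_field
        by (rule exI[of _ 1]) (auto simp: integral_unique[OF G])
    qed
    moreover have "((\<lambda>h. (G (x + h) - G x) / h) \<longlongrightarrow> f x) (at_left 0)"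
    proof -
      have "((\<lambda>h. (G (x + - h) - G x) / - h) \<longlongrightarrow> f x) (at_right 0)"
      proof (rule Lim_transform_eventually)
        show "((\<lambda>h. integral {- x..- x + h} (\<lambda>x. f (- x)) / h) \<longlongrightarrow> f x) (at_right 0)"
          using l by (simp only: minus_minus)
        show "\<forall>\<^sub>F h in at_right 0. integral {- x..- x + h} (\<lambda>x. f (- x)) / h = (G (x + - h) - G x) / - h"
          unfolding eventually_at_right_field
          by (rule exI[of _ 1]) (auto simp: integral_unique[OF intr] field_simps)
      qed
      then show ?thesis
        by (subst filterlim_at_left_to_right) simp
    qed
    ultimately show "(G has_real_derivative f x) (at x)"
      unfolding DERIV_def by (simp add: filterlim_split_at)
  qed
qed

text \<open>Adding a multiple of the identity makes the function bi-Lipschitz; the image measure of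
  Lebesgue measure under its inverse is then absolutely continuous, so Radon--Nikodym
  provides the derivative.\<close>

lemma lipschitz_AE_differentiable:
  fixes f :: "real \<Rightarrow> real"
  assumes L: "L-lipschitz_on UNIV f"
  shows "AE x in lborel. f differentiable (at x)"
proof -
  \<comment> \<open>Slope \<open>L + 1\<close> rather than \<open>L\<close> leaves a growth rate of
    at least 1, so \<open>F\<close> is a bijection of the line with a monotone, hence Borel,
    inverse.\<close>
  define F where "F x = f x + (L + 1) * x" for x
  have L0: "0 \<le> L" using L by (rule lipschitz_on_nonneg)
  have fl: "\<bar>f y - f x\<bar> \<le> L * \<bar>y - x\<bar>" for x y
    using lipschitz_onD[OF L, of y x] by (simp add: dist_real_def)
  have Flo: "F y - F x \<ge> y - x" if "x \<le> y" for x y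
    using fl[of y x] that by (simp add: F_def algebra_simps)
  have Flip: "(2*L+1)-lipschitz_on UNIV F"
  proof (rule lipschitz_onI)
    show "dist (F x) (F y) \<le> (2*L+1) * dist x y" for x y
    proof -
      have "\<bar>F x - F y\<bar> \<le> \<bar>f x - f y\<bar> + \<bar>(L+1) * (x - y)\<bar>"
        by (simp add: F_def algebra_simps)
      also have "\<dots> \<le> L * \<bar>x - y\<bar> + (L+1) * \<bar>x - y\<bar>"
        using fl[of x y] L0 by (simp add: abs_mult)
      finally show ?thesis by (simp add: dist_real_def algebra_simps)
    qed
  qed (use L0 in auto)
  have Fc: "continuous_on UNIV F" by (rule lipschitz_on_continuous_on[OF Flip])
  have sm: "strict_mono F"
    using Flo by (intro strict_monoI) (smt (verit))
  have inj: "inj F" using sm by (rule strict_mono_imp_inj_on)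
  have surj: "surj F"
    unfolding surj_def
  proof
    fix y
    define a where "a = - \<bar>y\<bar> - \<bar>F 0\<bar>" define b where "b = \<bar>y\<bar> + \<bar>F 0\<bar>"
    have "F a \<le> y" "y \<le> F b"
      using Flo[of a 0] Flo[of 0 b] unfolding a_def b_def by linarith+
    then show "\<exists>x. y = F x"
      using IVT'[of F a y b] continuous_on_subset[OF Fc] by (force simp: a_def b_def)
  qed
  define g where "g = inv F"
  have gF[simp]: "g (F x) = x" and Fg[simp]: "F (g x) = x" for x
    by (auto simp: g_def inj surj_f_inv_f[OF surj])
  have gm: "mono g"
    by (rule monoI) (metis Fg sm strict_mono_less_eq)
  have gmeas[measurable]: "g \<in> borel_measurable borel"
    by (rule borel_measurable_mono[OF gm])
  \<comment> \<open>This measures a set by the length of its image under \<open>F\<close>. An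
    interval \<open>{a..b}\<close> gets mass \<open>F b - F a\<close>, so the density of
    \<open>\<nu>\<close> is the candidate for the derivative of \<open>F\<close>.\<close>
  define \<nu> where "\<nu> = distr lborel borel g"
  have \<nu>: "emeasure \<nu> S = emeasure lborel (F ` S)" if "S \<in> sets borel" for S
  proof -
    have "g -` S = F ` S"
      by (auto simp: image_iff) (metis Fg)
    then show ?thesis unfolding \<nu>_def using that by (subst emeasure_distr) auto
  qed
  have "absolutely_continuous lborel \<nu>"
    unfolding absolutely_continuous_def
  proof
    fix S :: "real set" assume S: "S \<in> null_sets lborel"
    then have "negligible S" by (simp add: negligible_iff_null_sets null_sets_completionI)
    then have "negligible (F ` S)"
    proof (rule negligible_locally_Lipschitz_image[rotated])
      show "\<exists>T B. open T \<and> x \<in> T \<and> (\<forall>y\<in>S \<inter> T. norm (F y - F x) \<le> B * norm (y - x))" for x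
        using lipschitz_onD[OF Flip] by (intro exI[of _ UNIV] exI[of _ "2*L+1"]) (auto simp: dist_norm)
    qed simp
    moreover have "F ` S \<in> sets borel"
    proof -
      have "F ` S = g -` S \<inter> space borel"
        by (auto simp: image_iff) (metis Fg)
      then show ?thesis using S measurable_sets[OF gmeas, of S] by (simp add: null_sets_def)
    qed
    ultimately have "emeasure lborel (F ` S) = 0"
      by (simp add: negligible_iff_null_sets null_sets_completion_iff null_setsD1)
    then show "S \<in> null_sets \<nu>"
      using S \<nu>[of S] by (auto simp: null_sets_def \<nu>_def)
  qed
  then obtain h where h[measurable]: "h \<in> borel_measurable borel" and dens: "density lborel h = \<nu>"
    using sigma_finite_measure.Radon_Nikodym[OF sigma_finite_lborel, of \<nu>] by (auto simp: \<nu>_def)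
  have nn: "(\<integral>\<^sup>+x. h x * indicator {a..b} x \<partial>lborel) = ennreal (F b - F a)" if "a \<le> b" for a b
  proof -
    have "F ` {a..b} = {F a..F b}"
    proof (intro equalityI subsetI)
      fix y assume "y \<in> {F a..F b}"
      then have "F a \<le> F (g y)" "F (g y) \<le> F b" by auto
      then have "a \<le> g y" "g y \<le> b"
        by (simp_all only: strict_mono_less_eq[OF sm])
      then have "g y \<in> {a..b}" "F (g y) = y" by auto
      then show "y \<in> F ` {a..b}" by (metis imageI)
    qed (auto simp: strict_mono_less_eq[OF sm])
    then have "emeasure \<nu> {a..b} = ennreal (F b - F a)"
      using that by (subst \<nu>) (auto simp: strict_mono_less_eq[OF sm])
    then show ?thesis unfolding dens[symmetric] by (subst (asm) emeasure_density) auto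
  qed
  \<comment> \<open>The density takes values in \<open>ennreal\<close>; finite mass on each
    \<open>{- n..n}\<close> excludes infinity almost everywhere and permits the passage to the real
    function \<open>k\<close>.\<close>
  have fin: "AE x in lborel. h x \<noteq> \<infinity>"
  proof -
    have "AE x in lborel. \<forall>n::nat. h x * indicator {- real n..real n} x \<noteq> \<infinity>"
      unfolding AE_all_countable
      by (intro allI nn_integral_PInf_AE) (auto simp: nn)
    then show ?thesis
    proof eventually_elim
      fix x assume a: "\<forall>n::nat. h x * indicator {- real n..real n} x \<noteq> \<infinity>"
      obtain n :: nat where "\<bar>x\<bar> \<le> real n" using real_arch_simple by blast
      then show "h x \<noteq> \<infinity>" using a[rule_format, of n] by (auto simp: abs_le_iff)
    qed
  qed
  define k where "k x = enn2real (h x)" for x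
  have k[measurable]: "k \<in> borel_measurable borel" unfolding k_def by measurable
  have "(k has_integral (F b - F a)) {a..b}" if ab: "a \<le> b" for a b
  proof -
    have "(\<integral>\<^sup>+x. ennreal (indicator {a..b} x * k x) \<partial>lborel) = (\<integral>\<^sup>+x. h x * indicator {a..b} x \<partial>lborel)"
      by (rule nn_integral_cong_AE, use fin in eventually_elim)
        (auto simp: k_def indicator_def less_top)
    also have "\<dots> = ennreal (F b - F a)" by (rule nn[OF ab])
    finally have n: "(\<integral>\<^sup>+x. ennreal (indicator {a..b} x * k x) \<partial>lborel) = ennreal (F b - F a)" .
    have k0: "0 \<le> indicator {a..b} x * k x" for x by (auto simp: k_def)
    have F0: "0 \<le> F b - F a" using Flo[OF ab] ab by simp
    have "has_bochner_integral lborel (\<lambda>x. indicator {a..b} x * k x) (F b - F a)"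
      by (rule has_bochner_integral_nn_integral[OF _ _ F0 n]) (auto simp: k0)
    then have "((\<lambda>x. indicator {a..b} x * k x) has_integral (F b - F a)) UNIV"
      using has_integral_integral_lborel has_bochner_integral_iff by metis
    then show ?thesis by (simp add: has_integral_indicator_mult)
  qed
  then have "AE x in lborel. (F has_real_derivative k x) (at x)"
    by (rule indefinite_integral_AE_derivative)
  then show ?thesis
  proof eventually_elim
    fix x assume "(F has_real_derivative k x) (at x)"
    then have "((\<lambda>x. F x - (L + 1) * x) has_real_derivative (k x - (L + 1))) (at x)"
      by (auto intro!: derivative_eq_intros)
    then show "f differentiable (at x)"
      by (auto simp: F_def real_differentiable_def)
  qed
qed

section \<open>Absolute continuity by families of nonoverlapping intervals\<close>

definition nonoverlapping :: "real \<Rightarrow> real \<Rightarrow> 'i set \<Rightarrow> ('i \<Rightarrow> real) \<Rightarrow> ('i \<Rightarrow> real) \<Rightarrow> bool" where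
  "nonoverlapping a b I l r \<longleftrightarrow> (\<forall>i\<in>I. a \<le> l i \<and> l i \<le> r i \<and> r i \<le> b) \<and>
     (\<forall>i\<in>I. \<forall>j\<in>I. i \<noteq> j \<longrightarrow> r i \<le> l j \<or> r j \<le> l i)"

lemma abs_cont_on_iff_nonoverlapping:
  "abs_cont_on a b f \<longleftrightarrow> (\<forall>\<epsilon>>0. \<exists>\<delta>>0. \<forall>(n::nat) l r. nonoverlapping a b {..<n} l r \<longrightarrow>
     (\<Sum>i<n. r i - l i) < \<delta> \<longrightarrow> (\<Sum>i<n. norm (f (r i) - f (l i))) < \<epsilon>)"
  unfolding abs_cont_on_def nonoverlapping_def Ball_def lessThan_iff imp_conjL ..

lemma abs_cont_onE:
  assumes "abs_cont_on a b f" "0 < e"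
  obtains \<delta> where "\<delta> > 0" "\<And>(n::nat) l r. nonoverlapping a b {..<n} l r \<Longrightarrow>
     (\<Sum>i<n. r i - l i) < \<delta> \<Longrightarrow> (\<Sum>i<n. norm (f (r i) - f (l i))) < e"
  using assms unfolding abs_cont_on_iff_nonoverlapping by blast

lemma abs_cont_onI:
  assumes "\<And>e. 0 < e \<Longrightarrow> \<exists>\<delta>>0. \<forall>(n::nat) l r. nonoverlapping a b {..<n} l r \<longrightarrow>
     (\<Sum>i<n. r i - l i) < \<delta> \<longrightarrow> (\<Sum>i<n. norm (f (r i) - f (l i))) < e"
  shows "abs_cont_on a b f"
  unfolding abs_cont_on_iff_nonoverlapping using assms by blast

lemma abs_cont_on_lipschitz_compose:
  assumes f: "abs_cont_on a b f" and g: "L-lipschitz_on S g" and "f ` {a..b} \<subseteq> S"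
  shows "abs_cont_on a b (\<lambda>t. g (f t))"
proof (rule abs_cont_onI)
  fix e :: real assume e: "0 < e"
  have L: "0 \<le> L" using g by (rule lipschitz_on_nonneg)
  then have "e / (L + 1) > 0" using e by simp
  then obtain \<delta> where \<delta>: "\<delta> > 0" "\<And>(n::nat) l r. nonoverlapping a b {..<n} l r \<Longrightarrow>
      (\<Sum>i<n. r i - l i) < \<delta> \<Longrightarrow> (\<Sum>i<n. norm (f (r i) - f (l i))) < e / (L + 1)"
    using abs_cont_onE[OF f] by blast
  have "(\<Sum>i<n. norm (g (f (r i)) - g (f (l i)))) < e"
    if no: "nonoverlapping a b {..<n} l r" and s: "(\<Sum>i<n. r i - l i) < \<delta>" for n :: nat and l r
  proof -
    have "(\<Sum>i<n. norm (g (f (r i)) - g (f (l i)))) \<le> (\<Sum>i<n. L * norm (f (r i) - f (l i)))"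
    proof (intro sum_mono)
      fix i assume "i \<in> {..<n}"
      then have "l i \<in> {a..b}" "r i \<in> {a..b}" using no by (force simp: nonoverlapping_def)+
      then have "f (r i) \<in> S" "f (l i) \<in> S" using assms(3) by auto
      then show "norm (g (f (r i)) - g (f (l i))) \<le> L * norm (f (r i) - f (l i))"
        using lipschitz_onD[OF g] by (simp add: dist_norm)
    qed
    also have "\<dots> = L * (\<Sum>i<n. norm (f (r i) - f (l i)))" by (simp add: sum_distrib_left)
    also have "\<dots> \<le> L * (e / (L + 1))" using L \<delta>(2)[OF no s] by (intro mult_left_mono) auto
    also have "\<dots> < e" using e L by (simp add: field_simps)
    finally show ?thesis .
  qed
  with \<delta>(1) show "\<exists>\<delta>>0. \<forall>(n::nat) l r. nonoverlapping a b {..<n} l r \<longrightarrow>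
      (\<Sum>i<n. r i - l i) < \<delta> \<longrightarrow> (\<Sum>i<n. norm (g (f (r i)) - g (f (l i)))) < e"
    by blast
qed

lemma abs_cont_on_ident: "abs_cont_on a b (\<lambda>t. t)"
proof (rule abs_cont_onI, intro exI conjI allI impI)
  fix e :: real and n :: nat and l r :: "nat \<Rightarrow> real"
  assume no: "nonoverlapping a b {..<n} l r" and s: "(\<Sum>i<n. r i - l i) < e"
  have "(\<Sum>i<n. norm (r i - l i)) = (\<Sum>i<n. r i - l i)"
    using no by (intro sum.cong) (auto simp: nonoverlapping_def)
  with s show "(\<Sum>i<n. norm (r i - l i)) < e" by simp
qed

lemma lipschitz_imp_abs_cont_on: "L-lipschitz_on {a..b} f \<Longrightarrow> abs_cont_on a b f"
  using abs_cont_on_lipschitz_compose[OF abs_cont_on_ident, of L "{a..b}" f a b] by auto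

lemma abs_cont_on_subinterval:
  assumes f: "abs_cont_on a b f" and cd: "a \<le> c" "d \<le> b"
  shows "abs_cont_on c d f"
proof (rule abs_cont_onI)
  fix e :: real assume "0 < e"
  then obtain \<delta> where \<delta>: "\<delta> > 0" "\<And>(n::nat) l r. nonoverlapping a b {..<n} l r \<Longrightarrow>
      (\<Sum>i<n. r i - l i) < \<delta> \<Longrightarrow> (\<Sum>i<n. norm (f (r i) - f (l i))) < e"
    using abs_cont_onE[OF f] by blast
  moreover have "nonoverlapping a b {..<n} l r" if "nonoverlapping c d {..<n} l r" for n :: nat and l r
    using that cd by (force simp: nonoverlapping_def)
  ultimately show "\<exists>\<delta>>0. \<forall>(n::nat) l r. nonoverlapping c d {..<n} l r \<longrightarrow>
      (\<Sum>i<n. r i - l i) < \<delta> \<longrightarrow> (\<Sum>i<n. norm (f (r i) - f (l i))) < e"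
    by blast
qed

lemma abs_cont_on_cong:
  assumes f: "abs_cont_on a b f" and "\<And>t. a \<le> t \<Longrightarrow> t \<le> b \<Longrightarrow> f t = g t"
  shows "abs_cont_on a b g"
proof (rule abs_cont_onI)
  fix e :: real assume "0 < e"
  then obtain \<delta> where \<delta>: "\<delta> > 0" "\<And>(n::nat) l r. nonoverlapping a b {..<n} l r \<Longrightarrow>
      (\<Sum>i<n. r i - l i) < \<delta> \<Longrightarrow> (\<Sum>i<n. norm (f (r i) - f (l i))) < e"
    using abs_cont_onE[OF f] by blast
  moreover have "(\<Sum>i<n. norm (g (r i) - g (l i))) = (\<Sum>i<n. norm (f (r i) - f (l i)))"
    if "nonoverlapping a b {..<n} l r" for n :: nat and l r
  proof (rule sum.cong[OF refl])
    fix i assume "i \<in> {..<n}"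
    then have "a \<le> l i" "l i \<le> r i" "r i \<le> b" using that by (auto simp: nonoverlapping_def)
    then show "norm (g (r i) - g (l i)) = norm (f (r i) - f (l i))" by (simp add: assms(2))
  qed
  ultimately show "\<exists>\<delta>>0. \<forall>(n::nat) l r. nonoverlapping a b {..<n} l r \<longrightarrow>
      (\<Sum>i<n. r i - l i) < \<delta> \<longrightarrow> (\<Sum>i<n. norm (g (r i) - g (l i))) < e"
    by metis
qed

lemma abs_cont_on_add:
  assumes f: "abs_cont_on a b f" and g: "abs_cont_on a b g"
  shows "abs_cont_on a b (\<lambda>t. f t + g t)"
proof (rule abs_cont_onI)
  fix e :: real assume "0 < e"
  then have e2: "e / 2 > 0" by simp
  obtain d1 where d1: "d1 > 0" "\<And>(n::nat) l r. nonoverlapping a b {..<n} l r \<Longrightarrow>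
      (\<Sum>i<n. r i - l i) < d1 \<Longrightarrow> (\<Sum>i<n. norm (f (r i) - f (l i))) < e/2"
    using abs_cont_onE[OF f e2] by blast
  obtain d2 where d2: "d2 > 0" "\<And>(n::nat) l r. nonoverlapping a b {..<n} l r \<Longrightarrow>
      (\<Sum>i<n. r i - l i) < d2 \<Longrightarrow> (\<Sum>i<n. norm (g (r i) - g (l i))) < e/2"
    using abs_cont_onE[OF g e2] by blast
  have "(\<Sum>i<n. norm (f (r i) + g (r i) - (f (l i) + g (l i)))) < e"
    if no: "nonoverlapping a b {..<n} l r" and s: "(\<Sum>i<n. r i - l i) < min d1 d2" for n :: nat and l r
  proof -
    have "(\<Sum>i<n. norm (f (r i) + g (r i) - (f (l i) + g (l i))))
      \<le> (\<Sum>i<n. norm (f (r i) - f (l i)) + norm (g (r i) - g (l i)))"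
      by (intro sum_mono) (metis add_diff_add norm_triangle_ineq)
    also have "\<dots> < e / 2 + e / 2"
      unfolding sum.distrib using no s by (intro add_strict_mono d1(2) d2(2)) auto
    finally show ?thesis by simp
  qed
  with d1(1) d2(1) show "\<exists>\<delta>>0. \<forall>(n::nat) l r. nonoverlapping a b {..<n} l r \<longrightarrow>
      (\<Sum>i<n. r i - l i) < \<delta> \<longrightarrow> (\<Sum>i<n. norm (f (r i) + g (r i) - (f (l i) + g (l i)))) < e"
    by (intro exI[of _ "min d1 d2"]) auto
qed

text \<open>Continues an arc by constants, so that \<open>nonpathological\<close>, which speaks of
  curves on the whole half line, applies to arcs on compact intervals. Clamping is monotone and
  1-Lipschitz: it keeps intervals nonoverlapping, possibly degenerate, and does not lengthen
  them.\<close>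

lemma abs_cont_on_clamp:
  assumes f: "abs_cont_on a b f" and ab: "a \<le> b"
  shows "abs_cont_on c d (\<lambda>t. f (max a (min b t)))"
proof (rule abs_cont_onI)
  fix e :: real assume "0 < e"
  then obtain \<delta> where \<delta>: "\<delta> > 0" "\<And>(n::nat) l r. nonoverlapping a b {..<n} l r \<Longrightarrow>
      (\<Sum>i<n. r i - l i) < \<delta> \<Longrightarrow> (\<Sum>i<n. norm (f (r i) - f (l i))) < e"
    using abs_cont_onE[OF f] by blast
  define cl where "cl t = max a (min b t)" for t
  have mono: "cl s \<le> cl t" if "s \<le> t" for s t using that by (auto simp: cl_def)
  have cl: "a \<le> cl t" "cl t \<le> b" for t using ab by (auto simp: cl_def)
  have sub: "cl t - cl s \<le> t - s" if "s \<le> t" for s t using that by (auto simp: cl_def max_def min_def)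
  have "(\<Sum>i<n. norm (f (cl (r i)) - f (cl (l i)))) < e"
    if no: "nonoverlapping c d {..<n} l r" and s: "(\<Sum>i<n. r i - l i) < \<delta>" for n :: nat and l r
  proof (rule \<delta>(2))
    show "nonoverlapping a b {..<n} (\<lambda>i. cl (l i)) (\<lambda>i. cl (r i))"
      using no cl mono unfolding nonoverlapping_def by meson
    have "(\<Sum>i<n. cl (r i) - cl (l i)) \<le> (\<Sum>i<n. r i - l i)"
      using no by (intro sum_mono sub) (auto simp: nonoverlapping_def)
    with s show "(\<Sum>i<n. cl (r i) - cl (l i)) < \<delta>" by simp
  qed
  with \<delta>(1) show "\<exists>\<delta>>0. \<forall>(n::nat) l r. nonoverlapping c d {..<n} l r \<longrightarrow> (\<Sum>i<n. r i - l i) < \<delta> \<longrightarrow>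
      (\<Sum>i<n. norm (f (max a (min b (r i))) - f (max a (min b (l i))))) < e"
    unfolding cl_def by blast
qed

lemma abs_cont_on_imp_continuous_on:
  assumes f: "abs_cont_on a b f"
  shows "continuous_on {a..b} f"
  unfolding continuous_on_iff
proof (intro ballI allI impI)
  fix x and e :: real assume x: "x \<in> {a..b}" and "0 < e"
  then obtain \<delta> where \<delta>: "\<delta> > 0" "\<And>(n::nat) l r. nonoverlapping a b {..<n} l r \<Longrightarrow>
      (\<Sum>i<n. r i - l i) < \<delta> \<Longrightarrow> (\<Sum>i<n. norm (f (r i) - f (l i))) < e"
    using abs_cont_onE[OF f] by blast
  show "\<exists>d>0. \<forall>x'\<in>{a..b}. dist x' x < d \<longrightarrow> dist (f x') (f x) < e"
  proof (intro exI[of _ \<delta>] conjI ballI impI)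
    fix y assume "y \<in> {a..b}" "dist y x < \<delta>"
    then show "dist (f y) (f x) < e"
      using \<delta>(2)[of 1 "\<lambda>_. min x y" "\<lambda>_. max x y"] x
      by (cases "x \<le> y") (auto simp: nonoverlapping_def dist_norm min_def max_def norm_minus_commute)
  qed (rule \<delta>)
qed

text \<open>Reindexing by a bijection frees the definition from initial segments of the naturals;
  the tagged cells of a division can then serve as indices themselves.\<close>

lemma abs_cont_on_finite_sumE:
  fixes f :: "real \<Rightarrow> 'a::real_normed_vector"
  assumes f: "abs_cont_on a b f" and e: "0 < e"
  obtains \<delta> where "\<delta> > 0" "\<And>I (l :: 'i \<Rightarrow> real) r. finite I \<Longrightarrow> nonoverlapping a b I l r \<Longrightarrow>
      (\<Sum>i\<in>I. r i - l i) < \<delta> \<Longrightarrow> (\<Sum>i\<in>I. norm (f (r i) - f (l i))) < e"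
proof -
  obtain \<delta> where \<delta>: "\<delta> > 0" "\<And>(n::nat) l r. nonoverlapping a b {..<n} l r \<Longrightarrow>
      (\<Sum>i<n. r i - l i) < \<delta> \<Longrightarrow> (\<Sum>i<n. norm (f (r i) - f (l i))) < e"
    using abs_cont_onE[OF f e] by blast
  have "(\<Sum>i\<in>I. norm (f (r i) - f (l i))) < e"
    if I: "finite I" "nonoverlapping a b I l r" "(\<Sum>i\<in>I. r i - l i) < \<delta>"
    for I and l r :: "'i \<Rightarrow> real"
  proof -
    obtain h where h: "bij_betw h {..<card I} I"
      using ex_bij_betw_nat_finite[OF I(1)] by (auto simp: atLeast0LessThan)
    have mem: "h i \<in> I" if "i < card I" for i using h that by (auto simp: bij_betw_def)
    have inj: "h i \<noteq> h j" if "i < card I" "j < card I" "i \<noteq> j" for i j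
      using h that by (auto simp: bij_betw_def inj_on_def)
    have "nonoverlapping a b {..<card I} (l \<circ> h) (r \<circ> h)"
      using I(2) mem inj by (auto simp: nonoverlapping_def)
    then have "(\<Sum>i<card I. norm (f (r (h i)) - f (l (h i)))) < e"
      using I(3) sum.reindex_bij_betw[OF h, of "\<lambda>i. r i - l i"] \<delta>(2)[of "card I" "l \<circ> h" "r \<circ> h"] by simp
    then show ?thesis
      using sum.reindex_bij_betw[OF h, of "\<lambda>i. norm (f (r i) - f (l i))"] by simp
  qed
  with \<delta>(1) show thesis by (rule that)
qed

text \<open>Cousin's lemma: tags outside the exceptional null set see a difference quotient at most
  \<open>\<epsilon>\<close>, and the cells tagged in the null set have small total length.\<close>

lemma abs_cont_on_nonincreasing:
  fixes f :: "real \<Rightarrow> real"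
  assumes f: "abs_cont_on a b f" and ab: "a \<le> b"
    and der: "AE t in lborel. a < t \<and> t < b \<longrightarrow> (\<exists>d\<le>0. (f has_real_derivative d) (at t))"
  shows "f b \<le> f a"
proof (rule field_le_epsilon)
  fix e0 :: real assume "0 < e0"
  \<comment> \<open>The budget is \<open>e\<close> for all cells tagged in the null set and
    \<open>e * (b - a)\<close> for the others.\<close>
  define e where "e = e0 / (b - a + 1)"
  have e: "e > 0" using \<open>0 < e0\<close> ab by (simp add: e_def)
  obtain \<delta> where \<delta>: "\<delta> > 0" "\<And>I (l :: real \<times> real set \<Rightarrow> real) r. finite I \<Longrightarrow>
      nonoverlapping a b I l r \<Longrightarrow>
      (\<Sum>i\<in>I. r i - l i) < \<delta> \<Longrightarrow> (\<Sum>i\<in>I. norm (f (r i) - f (l i))) < e"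
    using abs_cont_on_finite_sumE[OF f e] by blast
  \<comment> \<open>The end points may belong to \<open>N\<close>, since the hypothesis concerns the
    open interval only.\<close>
  define N where "N = {t. \<not> (\<exists>d\<le>0. (f has_real_derivative d) (at t))} \<inter> {a..b}"
  have "AE t in lebesgue. t \<notin> N"
    unfolding AE_completion_iff
    using der AE_lborel_singleton[of a] AE_lborel_singleton[of b]
    by eventually_elim (auto simp: N_def)
  then obtain N' where "N' \<in> null_sets lebesgue" "N \<subseteq> N'"
    by (auto simp: eventually_ae_filter)
  then have nullN: "N \<in> null_sets lebesgue" by (meson null_sets_completion_subset)
  then obtain U where U: "open U" "N \<subseteq> U" "U - N \<in> lmeasurable" "emeasure lebesgue (U - N) < ennreal \<delta>"
    using sets_lebesgue_outer_open[of N \<delta>] \<delta>(1) by (auto simp: null_sets_def)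
  have "U \<in> lmeasurable"
    using U(1,3) nullN by (metis borel_open measurable_Diff_null_set sets_completionI_sets sets_lborel)
  have "emeasure lebesgue U < ennreal \<delta>"
    using U nullN by (metis borel_open emeasure_Diff_null_set sets_completionI_sets sets_lborel)
  then have mU: "measure lebesgue U < \<delta>"
    using \<open>U \<in> lmeasurable\<close> \<delta>(1) by (simp add: emeasure_eq_measure2 ennreal_less_iff)
  have "\<exists>r>0. \<forall>y. \<bar>y - t\<bar> < r \<longrightarrow> (t \<le> y \<longrightarrow> f y - f t \<le> e * (y - t)) \<and> (y \<le> t \<longrightarrow> f t - f y \<le> e * (t - y))"
    if t: "t \<in> {a..b}" "t \<notin> N" for t
  proof -
    obtain d where d: "d \<le> 0" "(f has_real_derivative d) (at t)" using t by (auto simp: N_def)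
    from d(2) obtain r where r: "r > 0" "\<And>y. y \<noteq> t \<Longrightarrow> \<bar>y - t\<bar> < r \<Longrightarrow> \<bar>(f y - f t) / (y - t) - d\<bar> < e"
      unfolding has_field_derivative_iff LIM_def dist_real_def using e by (metis diff_0_right norm_minus_cancel real_norm_def zero_less_abs_iff eq_iff_diff_eq_0)
    show ?thesis
    proof (intro exI[of _ r] conjI allI impI r)
      fix y assume y: "\<bar>y - t\<bar> < r"
      have q: "(f y - f t) / (y - t) \<le> e" if "y \<noteq> t" using r(2)[OF that y] d(1) by linarith
      show "f y - f t \<le> e * (y - t)" if "t \<le> y"
        using q that by (cases "y = t") (auto simp: field_simps)
      show "f t - f y \<le> e * (t - y)" if "y \<le> t"
        using q that by (cases "y = t") (auto simp: field_simps)
    qed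
  qed
  then have "\<forall>t\<in>{a..b} - N. \<exists>r>0. \<forall>y. \<bar>y - t\<bar> < r \<longrightarrow>
      (t \<le> y \<longrightarrow> f y - f t \<le> e * (y - t)) \<and> (y \<le> t \<longrightarrow> f t - f y \<le> e * (t - y))"
    by blast
  from bchoice[OF this] obtain r where r0: "\<forall>t\<in>{a..b} - N. r t > 0 \<and> (\<forall>y. \<bar>y - t\<bar> < r t \<longrightarrow>
      (t \<le> y \<longrightarrow> f y - f t \<le> e * (y - t)) \<and> (y \<le> t \<longrightarrow> f t - f y \<le> e * (t - y)))"
    by blast
  have r: "\<And>t. t \<in> {a..b} \<Longrightarrow> t \<notin> N \<Longrightarrow> r t > 0"
    "\<And>t y. t \<in> {a..b} \<Longrightarrow> t \<notin> N \<Longrightarrow> \<bar>y - t\<bar> < r t \<Longrightarrow> t \<le> y \<Longrightarrow> f y - f t \<le> e * (y - t)"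
    "\<And>t y. t \<in> {a..b} \<Longrightarrow> t \<notin> N \<Longrightarrow> \<bar>y - t\<bar> < r t \<Longrightarrow> y \<le> t \<Longrightarrow> f t - f y \<le> e * (t - y)"
    using r0 by blast+
  \<comment> \<open>Cells tagged in \<open>N\<close> are forced into the small open set
    \<open>U\<close>; the other cells are kept so short that the difference quotients at their tag
    are at most \<open>e\<close>.\<close>
  define \<Gamma> where "\<Gamma> t = (if t \<in> N then U else if t \<in> {a..b} then ball t (r t) else UNIV)" for t
  have "gauge \<Gamma>" using U r(1) by (auto simp: gauge_def \<Gamma>_def)
  then obtain p where p: "p tagged_division_of {a..b}" "\<Gamma> fine p"
    by (rule fine_division_exists_real)
  note pD = tagged_division_ofD[OF p(1)]
  have finp: "finite p" by (rule pD(1))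
  have pK: "\<exists>c d. K = {c..d} \<and> c \<le> d \<and> a \<le> c \<and> d \<le> b \<and> Inf K = c \<and> Sup K = d \<and> x \<in> {c..d} \<and> x \<in> {a..b}"
    if xK: "(x, K) \<in> p" for x K
  proof -
    obtain c d where "K = {c..d}" using pD(4)[OF xK] by auto
    moreover from this have "c \<le> d" using pD(2)[OF xK] by auto
    ultimately show ?thesis using pD(2,3)[OF xK] by (intro exI[of _ c] exI[of _ d]) auto
  qed
  \<comment> \<open>Degenerate cells are discarded: they contribute 0 to the sum, and since their
    interior is empty they could lie inside another cell, which would spoil
    \<open>nonoverlapping\<close>.\<close>
  define B where "B = {(x, K) \<in> p. x \<in> N \<and> Inf K < Sup K}"
  have Bp: "B \<subseteq> p" "finite B" using finp by (auto simp: B_def intro: finite_subset)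
  have "f b - f a = (\<Sum>(x,K)\<in>p. f (Sup K) - f (Inf K))"
    by (rule additive_tagged_division_1[OF ab p(1), symmetric])
  also have "\<dots> \<le> (\<Sum>(x,K)\<in>p. (if (x,K) \<in> B then \<bar>f (Sup K) - f (Inf K)\<bar> else 0) + e * (Sup K - Inf K))"
  proof (intro sum_mono, clarify)
    fix x K assume xK: "(x, K) \<in> p"
    obtain c d where cd: "K = {c..d}" "c \<le> d" "Inf K = c" "Sup K = d" "x \<in> {c..d}" "x \<in> {a..b}"
      using pK[OF xK] by blast
    show "f (Sup K) - f (Inf K) \<le> (if (x, K) \<in> B then \<bar>f (Sup K) - f (Inf K)\<bar> else 0) + e * (Sup K - Inf K)"
    proof (cases "x \<in> N")
      case True
      have "0 \<le> e * (d - c)" using e cd(2) by simp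
      then show ?thesis using True cd xK by (cases "c < d") (auto simp: B_def)
    next
      case False
      then have "K \<subseteq> ball x (r x)" using fineD[OF p(2) xK] cd(6) by (simp add: \<Gamma>_def)
      moreover have "c \<in> K" "d \<in> K" using cd by auto
      ultimately have "c \<in> ball x (r x)" "d \<in> ball x (r x)" by blast+
      \<comment> \<open>The tag lies between the end points of its cell, so the two one-sided
        estimates add up to \<open>e * (d - c)\<close>.\<close>
      then have "f d - f x \<le> e * (d - x)" "f x - f c \<le> e * (x - c)"
        using cd False by (intro r(2,3); auto simp: dist_real_def)+
      then show ?thesis using cd False by (simp add: B_def algebra_simps)
    qed
  qed
  also have "\<dots> = (\<Sum>(x,K)\<in>B. \<bar>f (Sup K) - f (Inf K)\<bar>) + e * (\<Sum>(x,K)\<in>p. Sup K - Inf K)"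
  proof -
    have "(\<Sum>z\<in>p. (case z of (x,K) \<Rightarrow> if (x,K) \<in> B then \<bar>f (Sup K) - f (Inf K)\<bar> else 0))
        = (\<Sum>(x,K)\<in>B. \<bar>f (Sup K) - f (Inf K)\<bar>)"
      using Bp finp by (intro sum.mono_neutral_cong_right) auto
    then show ?thesis
      by (simp add: case_prod_unfold sum.distrib sum_distrib_left)
  qed
  also have "(\<Sum>(x,K)\<in>p. Sup K - Inf K) = b - a"
    by (rule additive_tagged_division_1[OF ab p(1), of "\<lambda>x. x"])
  also have "(\<Sum>(x,K)\<in>B. \<bar>f (Sup K) - f (Inf K)\<bar>) < e"
  proof -
    have "(\<Sum>i\<in>B. norm (f (Sup (snd i)) - f (Inf (snd i)))) < e"
    proof (rule \<delta>(2))
      have "\<forall>i\<in>B. a \<le> Inf (snd i) \<and> Inf (snd i) \<le> Sup (snd i) \<and> Sup (snd i) \<le> b"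
        using pK Bp(1) by fastforce
      moreover have "\<forall>i\<in>B. \<forall>j\<in>B. i \<noteq> j \<longrightarrow> Sup (snd i) \<le> Inf (snd j) \<or> Sup (snd j) \<le> Inf (snd i)"
      proof (intro ballI impI)
        fix i j assume ij: "i \<in> B" "j \<in> B" "i \<noteq> j"
        obtain x K y J where xy: "i = (x,K)" "j = (y,J)" by (cases i, cases j) auto
        have "(x,K) \<in> p" "(y,J) \<in> p" using ij xy Bp by auto
        then obtain c d c' d' where cd: "K = {c..d}" "Inf K = c" "Sup K = d" "J = {c'..d'}" "Inf J = c'" "Sup J = d'"
          using pK by metis
        have lt: "c < d" "c' < d'" using ij xy cd by (auto simp: B_def)
        have "interior K \<inter> interior J = {}" using pD(5) ij xy Bp(1) by blast
        then have dis: "{c<..<d} \<inter> {c'<..<d'} = {}" using cd by (simp add: interior_atLeastAtMost_real)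
        show "Sup (snd i) \<le> Inf (snd j) \<or> Sup (snd j) \<le> Inf (snd i)"
        proof (rule ccontr)
          assume "\<not> ?thesis"
          then have "max c c' < min d d'" using lt cd xy by auto
          then have "(max c c' + min d d') / 2 \<in> {c<..<d} \<inter> {c'<..<d'}" by auto
          then show False using dis by blast
        qed
      qed
      ultimately show no: "nonoverlapping a b B (\<lambda>i. Inf (snd i)) (\<lambda>i. Sup (snd i))"
        by (simp add: nonoverlapping_def)
      \<comment> \<open>The open cells are pairwise disjoint subsets of \<open>U\<close>; their
        total length is therefore at most the measure of \<open>U\<close>.\<close>
      define J where "J i = {Inf (snd i)<..<Sup (snd i)}" for i :: "real \<times> real set"
      have J: "J i \<subseteq> U" "Inf (snd i) \<le> Sup (snd i)" if i: "i \<in> B" for i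
      proof -
        have mem: "(fst i, snd i) \<in> p" and iN: "fst i \<in> N" using i by (auto simp: B_def)
        obtain c d where cd: "snd i = {c..d}" "Inf (snd i) = c" "Sup (snd i) = d" "c \<le> d"
          using pK[OF mem] by blast
        have "snd i \<subseteq> U" using fineD[OF p(2) mem] iN by (simp add: \<Gamma>_def)
        then show "J i \<subseteq> U" unfolding J_def cd(2,3) using cd(1) by auto
        show "Inf (snd i) \<le> Sup (snd i)" using cd by simp
      qed
      have "(\<Sum>i\<in>B. Sup (snd i) - Inf (snd i)) = (\<Sum>i\<in>B. measure lebesgue (J i))"
        using J(2) by (intro sum.cong refl) (simp add: J_def)
      also have "\<dots> = measure lebesgue (\<Union>i\<in>B. J i)"
      proof (rule measure_finite_Union[symmetric])
        show "disjoint_family_on J B"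
          unfolding disjoint_family_on_def
        proof (intro ballI impI)
          fix i j assume "i \<in> B" "j \<in> B" "i \<noteq> j"
          then have "Sup (snd i) \<le> Inf (snd j) \<or> Sup (snd j) \<le> Inf (snd i)"
            using no by (auto simp: nonoverlapping_def)
          then show "J i \<inter> J j = {}" by (auto simp: J_def)
        qed
        show "emeasure lebesgue (J i) \<noteq> \<infinity>" if "i \<in> B" for i
          using J(2)[OF that] by (simp add: J_def)
      qed (auto simp: J_def Bp)
      also have "\<dots> \<le> measure lebesgue U"
      proof (rule measure_mono_fmeasurable)
        show "(\<Union>i\<in>B. J i) \<subseteq> U" using J(1) by auto
        have "(\<Union>i\<in>B. J i) \<in> sets borel" by (intro borel_open open_UN) (auto simp: J_def)
        then show "(\<Union>i\<in>B. J i) \<in> sets lebesgue" by simp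
      qed fact
      finally show "(\<Sum>i\<in>B. Sup (snd i) - Inf (snd i)) < \<delta>" using mU by simp
    qed (rule Bp)
    then show ?thesis by (simp add: case_prod_unfold)
  qed
  finally have "f b - f a \<le> e + e * (b - a)" by simp
  also have "\<dots> = e * (b - a + 1)" by (simp add: algebra_simps)
  also have "\<dots> = e0" using ab by (simp add: e_def)
  finally show "f b \<le> f a + e0" by simp
qed

section \<open>Rademacher's theorem\<close>

lemma nn_integral_lborel_translate:
  fixes f :: "'a::euclidean_space \<Rightarrow> ennreal"
  assumes [measurable]: "f \<in> borel_measurable borel"
  shows "(\<integral>\<^sup>+x. f (x + c) \<partial>lborel) = (\<integral>\<^sup>+x. f x \<partial>lborel)"
  by (subst (2) lborel_distr_plus[symmetric, of c], subst nn_integral_distr) (auto simp: add.commute)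

lemma integral_lborel_translate:
  fixes f :: "'a::euclidean_space \<Rightarrow> real"
  assumes [measurable]: "f \<in> borel_measurable borel"
  shows "(\<integral>x. f (x + c) \<partial>lborel) = (\<integral>x. f x \<partial>lborel)"
  by (subst (2) lborel_distr_plus[symmetric, of c], subst integral_distr) (auto simp: add.commute)

text \<open>After exchanging the integrals, each inner one is the measure of a translate of
  \<open>E\<close>, and a constant integrated over the line is multiplied by infinity. Averaging
  over all base points, instead of over a complement of \<open>v\<close>, spares a change of
  coordinates.\<close>

lemma nn_integral_lines:
  fixes v :: "'a::euclidean_space"
  assumes E[measurable]: "E \<in> sets borel"
  shows "(\<integral>\<^sup>+y. \<integral>\<^sup>+s. indicator E (y + s *\<^sub>R v) \<partial>lborel \<partial>lborel) = emeasure lborel E * \<infinity>"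
proof -
  have "(\<integral>\<^sup>+y. \<integral>\<^sup>+s. indicator E (y + s *\<^sub>R v) \<partial>lborel \<partial>lborel)
      = (\<integral>\<^sup>+(s::real). \<integral>\<^sup>+y. indicator E (y + s *\<^sub>R v) \<partial>lborel \<partial>lborel)"
    by (rule lborel_pair.Fubini') measurable
  also have "\<dots> = (\<integral>\<^sup>+(s::real). emeasure lborel E \<partial>lborel)"
    by (intro nn_integral_cong, subst nn_integral_lborel_translate) auto
  also have "\<dots> = emeasure lborel E * \<infinity>" by simp
  finally show ?thesis .
qed

text \<open>A measure whose product with infinity vanishes is 0. Borel measurability of
  \<open>P\<close> makes the exceptional set accessible to \<open>nn_integral_lines\<close>.\<close>

lemma AE_if_AE_on_lines:
  fixes v :: "'a::euclidean_space"
  assumes P[measurable]: "Measurable.pred borel P"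
    and l: "\<And>y. AE s in lborel. P (y + s *\<^sub>R v)"
  shows "AE x in lborel. P x"
proof -
  define E where "E = {x. \<not> P x}"
  have E[measurable]: "E \<in> sets borel" unfolding E_def by measurable
  have "(\<integral>\<^sup>+s. indicator E (y + s *\<^sub>R v) \<partial>lborel) = 0" for y
    by (subst nn_integral_0_iff_AE) (use l[of y] in \<open>auto simp: E_def indicator_def elim!: eventually_mono\<close>)
  then have "emeasure lborel E * \<infinity> = 0" using nn_integral_lines[OF E, of v] by simp
  then have "emeasure lborel E = 0" by (simp add: ennreal_mult_top split: if_splits) 
  then have "E \<in> null_sets lborel" by (simp add: null_sets_def)
  then show ?thesis by (rule AE_I') (auto simp: E_def)
qed

text \<open>The exceptional set is first enlarged to a Borel null set; by
  \<open>nn_integral_lines\<close> almost every line meets that set in length 0.\<close>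

lemma AE_on_lines_if_AE:
  fixes v :: "'a::euclidean_space"
  assumes "AE x in lborel. P x"
  shows "AE y in lborel. AE s in lborel. P (y + s *\<^sub>R v)"
proof -
  obtain E where E: "E \<in> null_sets lborel" "{x. \<not> P x} \<subseteq> E"
    using assms by (auto simp: eventually_ae_filter)
  then have [measurable]: "E \<in> sets borel" and "emeasure lborel E = 0" by (auto simp: null_sets_def)
  then have "(\<integral>\<^sup>+y. \<integral>\<^sup>+s. indicator E (y + s *\<^sub>R v) \<partial>lborel \<partial>lborel) = 0"
    by (subst nn_integral_lines) auto
  then have "AE y in lborel. (\<integral>\<^sup>+s. indicator E (y + s *\<^sub>R v) \<partial>lborel) = 0"
    by (subst (asm) nn_integral_0_iff_AE) auto
  then show ?thesis
  proof eventually_elim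
    case (elim y)
    then have "AE s in lborel. (indicator E (y + s *\<^sub>R v) :: ennreal) = 0"
      by (subst (asm) nn_integral_0_iff_AE) auto
    then show ?case
      by eventually_elim (use E(2) in \<open>auto simp: indicator_def split: if_splits\<close>)
  qed
qed

text \<open>By Lebesgue differentiation \<open>f x\<close> is, for almost every \<open>x\<close>,
  the limit of averages over shrinking cubes at \<open>x\<close>, and these all vanish.\<close>

lemma AE_zero_if_box_integrals_zero:
  fixes f :: "'a::euclidean_space \<Rightarrow> real"
  assumes f: "\<And>a b. (f has_integral 0) (cbox a b)"
  shows "AE x in lborel. f x = 0"
proof -
  obtain N where N: "negligible N"
    "\<And>x e. \<lbrakk>x \<notin> N; 0 < e\<rbrakk> \<Longrightarrow> \<exists>d>0. \<forall>h. 0 < h \<and> h < d \<longrightarrow>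
       norm (integral (cbox x (x + h *\<^sub>R One)) f /\<^sub>R h ^ DIM('a) - f x) < e"
    using integrable_ccontinuous_explicit[of f] f by blast
  have "f x = 0" if x: "x \<notin> N" for x
  proof (rule ccontr)
    assume "f x \<noteq> 0"
    then obtain d where "d > 0" "\<forall>h. 0 < h \<and> h < d \<longrightarrow>
       norm (integral (cbox x (x + h *\<^sub>R One)) f /\<^sub>R h ^ DIM('a) - f x) < \<bar>f x\<bar>"
      using N(2)[OF x, of "\<bar>f x\<bar>"] by auto
    from this(2)[rule_format, of "d/2"] this(1) show False
      by (simp add: integral_unique[OF f])
  qed
  moreover have "AE x in lborel. x \<notin> N"
    using N(1) by (metis AE_completion_iff AE_not_in negligible_iff_null_sets)
  ultimately show ?thesis by auto
qed

section \<open>Directional difference quotients of a Lipschitz function\<close>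

definition dquot :: "('a::euclidean_space \<Rightarrow> real) \<Rightarrow> 'a \<Rightarrow> nat \<Rightarrow> 'a \<Rightarrow> real" where
  "dquot V v n x = real (Suc n) * (V (x + v /\<^sub>R real (Suc n)) - V x)"

text \<open>The candidate for the directional derivative. Steps \<open>1 / Suc n\<close> instead of
  a real parameter make it a limit of a sequence of Borel functions, hence Borel. Where the
  quotients diverge, \<open>lim\<close> is an unspecified value; \<open>AE_dquot_tendsto\<close>
  confines this to a null set.\<close>

definition dlim :: "('a::euclidean_space \<Rightarrow> real) \<Rightarrow> 'a \<Rightarrow> 'a \<Rightarrow> real" where
  "dlim V v x = lim (\<lambda>n. dquot V v n x)"

lemma dquot_add: "dquot V (v + w) n x = dquot V v n x + dquot V w n (x + v /\<^sub>R real (Suc n))"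
  by (simp add: dquot_def algebra_simps)

lemma dquot_tendsto:
  assumes "((\<lambda>s. V (y + s *\<^sub>R v)) has_real_derivative d) (at s)"
  shows "(\<lambda>n. dquot V (c *\<^sub>R v) n (y + s *\<^sub>R v)) \<longlonglongrightarrow> c * d"
proof -
  have "((\<lambda>t. V (y + (s + c * t) *\<^sub>R v)) has_real_derivative c * d) (at 0)"
  proof -
    have "((\<lambda>t. V (y + (s + c * t) *\<^sub>R v)) has_real_derivative d * c) (at 0)"
      by (rule DERIV_chain'[where g="\<lambda>s. V (y + s *\<^sub>R v)" and f="\<lambda>t. s + c * t"])
        (use assms in \<open>auto intro!: derivative_eq_intros\<close>)
    then show ?thesis by (simp add: mult.commute)
  qed
  then have "((\<lambda>t. (V (y + (s + c * t) *\<^sub>R v) - V (y + s *\<^sub>R v)) / t) \<longlongrightarrow> c * d) (at 0)"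
    by (simp add: DERIV_def)
  moreover have "filterlim (\<lambda>n. inverse (real (Suc n))) (at 0) sequentially"
    using LIMSEQ_inverse_real_of_nat by (auto simp: filterlim_at)
  ultimately have "(\<lambda>n. (V (y + (s + c * inverse (real (Suc n))) *\<^sub>R v) - V (y + s *\<^sub>R v))
      / inverse (real (Suc n))) \<longlonglongrightarrow> c * d"
    by (rule filterlim_compose)
  then show ?thesis
    by (simp add: dquot_def algebra_simps divide_inverse)
qed

context
  fixes V :: "'a::euclidean_space \<Rightarrow> real" and L :: real
  assumes lip: "L-lipschitz_on UNIV V"
begin

lemma lipschitz_borel_measurable: "V \<in> borel_measurable borel"
  using lipschitz_on_continuous_on[OF lip] by (rule borel_measurable_continuous_onI)

lemma dquot_measurable[measurable]: "dquot V v n \<in> borel_measurable borel"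
  using lipschitz_borel_measurable unfolding dquot_def[abs_def] by measurable

lemma dlim_measurable[measurable]: "dlim V v \<in> borel_measurable borel"
  unfolding dlim_def[abs_def] by measurable

lemma dquot_bound: "\<bar>dquot V v n x\<bar> \<le> L * norm v"
proof -
  have "\<bar>V (x + v /\<^sub>R real (Suc n)) - V x\<bar> \<le> L * norm (v /\<^sub>R real (Suc n))"
    using lipschitz_onD[OF lip, of "x + v /\<^sub>R real (Suc n)" x] by (simp add: dist_norm)
  then have "real (Suc n) * \<bar>V (x + v /\<^sub>R real (Suc n)) - V x\<bar> \<le> real (Suc n) * (L * norm (v /\<^sub>R real (Suc n)))"
    by (intro mult_left_mono) auto
  also have "\<dots> = L * norm v" by simp
  finally show ?thesis by (simp add: dquot_def abs_mult)
qed

lemma AE_line_differentiable: "AE s in lborel. \<exists>d. ((\<lambda>s. V (y + s *\<^sub>R v)) has_real_derivative d) (at s)"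
proof -
  have "(L * norm v)-lipschitz_on UNIV (\<lambda>s. V (y + s *\<^sub>R v))"
  proof (rule lipschitz_onI)
    show "dist (V (y + s *\<^sub>R v)) (V (y + t *\<^sub>R v)) \<le> L * norm v * dist s t" for s t
      using lipschitz_onD[OF lip, of "y + s *\<^sub>R v" "y + t *\<^sub>R v"]
      by (simp add: dist_norm scaleR_diff_left[symmetric] mult_ac)
  qed (use lipschitz_on_nonneg[OF lip] in simp)
  from lipschitz_AE_differentiable[OF this] show ?thesis
    by (simp add: real_differentiable_def)
qed

text \<open>Being Cauchy is a Borel condition on the base point, so the one-dimensional
  differentiability theorem transfers from lines parallel to \<open>v\<close> to the whole
  space.\<close>

lemma AE_dquot_tendsto: "AE x in lborel. (\<lambda>n. dquot V v n x) \<longlonglongrightarrow> dlim V v x"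
proof -
  have "AE x in lborel. Cauchy (\<lambda>n. dquot V v n x)"
  proof (rule AE_if_AE_on_lines[where v=v])
    show "Measurable.pred borel (\<lambda>x. Cauchy (\<lambda>n. dquot V v n x))" by measurable
    show "AE s in lborel. Cauchy (\<lambda>n. dquot V v n (y + s *\<^sub>R v))" for y
      using AE_line_differentiable[of y v]
      by eventually_elim (use dquot_tendsto[where c=1] in \<open>fastforce intro: LIMSEQ_imp_Cauchy\<close>)
  qed
  then show ?thesis
    by eventually_elim (simp add: dlim_def convergent_LIMSEQ_iff[symmetric] Cauchy_convergent)
qed

lemma AE_dlim_scaleR: "AE x in lborel. dlim V (c *\<^sub>R v) x = c * dlim V v x"
proof (rule AE_if_AE_on_lines[where v=v])
  show "Measurable.pred borel (\<lambda>x. dlim V (c *\<^sub>R v) x = c * dlim V v x)" by measurable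
  show "AE s in lborel. dlim V (c *\<^sub>R v) (y + s *\<^sub>R v) = c * dlim V v (y + s *\<^sub>R v)" for y
    using AE_line_differentiable[of y v]
    by eventually_elim (use dquot_tendsto[where c=1] dquot_tendsto[where c=c] in \<open>force simp: dlim_def dest: limI\<close>)
qed

text \<open>In \<open>dquot_add\<close> the quotient in direction \<open>w\<close> is taken at a
  moving base point, where pointwise limits give no information. Under an integral over a box the
  shift can be moved from the quotient to the indicator of the box and disappears in the limit;
  equality of all box integrals gives equality almost everywhere.\<close>

lemma AE_dlim_add: "AE x in lborel. dlim V (v + w) x = dlim V v x + dlim V w x"
proof -
  have "((\<lambda>x. dlim V (v + w) x - dlim V v x - dlim V w x) has_integral 0) (cbox a b)" for a b
  proof -
    let ?B = "cbox a b" let ?I = "indicator (cbox a b) :: 'a \<Rightarrow> real"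
    have L0: "0 \<le> L" using lip by (rule lipschitz_on_nonneg)
    have fin: "emeasure lborel ?B < \<infinity>"
      by (intro emeasure_bounded_finite) auto
    have conv: "integrable lborel (\<lambda>x. ?I x * dlim V u x) \<and>
        (\<lambda>n. \<integral>x. ?I x * dquot V u n x \<partial>lborel) \<longlonglongrightarrow> (\<integral>x. ?I x * dlim V u x \<partial>lborel)" for u
    proof (intro conjI)
      have b: "integrable lborel (\<lambda>x. (L * norm u) * ?I x)" using fin by auto
      have ae: "AE x in lborel. (\<lambda>n. ?I x * dquot V u n x) \<longlonglongrightarrow> ?I x * dlim V u x"
        using AE_dquot_tendsto[of u] by eventually_elim (intro tendsto_intros)
      have bd: "AE x in lborel. norm (?I x * dquot V u n x) \<le> (L * norm u) * ?I x" for n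
        using dquot_bound by (auto simp: indicator_def)
      show "integrable lborel (\<lambda>x. ?I x * dlim V u x)"
        by (rule integrable_dominated_convergence[OF _ _ b ae bd]) auto
      show "(\<lambda>n. \<integral>x. ?I x * dquot V u n x \<partial>lborel) \<longlonglongrightarrow> (\<integral>x. ?I x * dlim V u x \<partial>lborel)"
        by (rule integral_dominated_convergence[OF _ _ b ae bd]) auto
    qed
    have shift: "(\<lambda>n. \<integral>x. ?I x * dquot V w n (x + v /\<^sub>R real (Suc n)) \<partial>lborel) \<longlonglongrightarrow> (\<integral>x. ?I x * dlim V w x \<partial>lborel)"
    proof -
      have eq: "(\<integral>x. ?I x * dquot V w n (x + v /\<^sub>R real (Suc n)) \<partial>lborel)
          = (\<integral>x. ?I (x - v /\<^sub>R real (Suc n)) * dquot V w n x \<partial>lborel)" for n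
        by (subst integral_lborel_translate[symmetric, where c="v /\<^sub>R real (Suc n)"]) auto
      \<comment> \<open>All shifts have norm at most \<open>norm v\<close>, so one ball contains
        every translated box and yields the dominating function.\<close>
      obtain r where r: "?B \<subseteq> cball 0 r" using bounded_cbox[of a b] by (auto simp: bounded_iff subset_iff)
      have b: "integrable lborel (\<lambda>x::'a. (L * norm w) * indicator (cball 0 (r + norm v)) x)"
        using emeasure_bounded_finite[of "cball 0 (r + norm v) :: 'a set"]
        by (intro integrable_mult_right integrable_real_indicator) auto
      have vn: "norm (v /\<^sub>R real (Suc n)) \<le> norm v" for n
        by (simp add: field_simps mult_left_le)
      have bd: "AE x in lborel. norm (?I (x - v /\<^sub>R real (Suc n)) * dquot V w n x)
          \<le> (L * norm w) * indicator (cball 0 (r + norm v)) x" for n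
      proof (intro AE_I2)
        fix x
        have "norm x \<le> r + norm v" if "x - v /\<^sub>R real (Suc n) \<in> ?B"
          using r that vn[of n] norm_triangle_ineq[of "x - v /\<^sub>R real (Suc n)" "v /\<^sub>R real (Suc n)"] by auto
        then show "norm (?I (x - v /\<^sub>R real (Suc n)) * dquot V w n x)
          \<le> (L * norm w) * indicator (cball 0 (r + norm v)) x"
          using dquot_bound[of w n x] L0 by (auto simp: indicator_def)
      qed
      \<comment> \<open>The indicator of the box is continuous off the frontier, so the translated
        indicators converge almost everywhere.\<close>
      have "negligible (frontier ?B)" by (intro negligible_convex_frontier convex_box)
      then have fr: "AE x in lborel. x \<notin> frontier ?B"
        by (metis AE_completion_iff AE_not_in negligible_iff_null_sets)
      have ae: "AE x in lborel. (\<lambda>n. ?I (x - v /\<^sub>R real (Suc n)) * dquot V w n x) \<longlonglongrightarrow> ?I x * dlim V w x"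
        using AE_dquot_tendsto[of w] fr
      proof eventually_elim
        case (elim x)
        have "(\<lambda>n. inverse (real (Suc n)) *\<^sub>R v) \<longlonglongrightarrow> 0 *\<^sub>R v"
          by (intro tendsto_scaleR tendsto_const LIMSEQ_inverse_real_of_nat)
        then have "(\<lambda>n. x - v /\<^sub>R real (Suc n)) \<longlonglongrightarrow> x - 0" by (intro tendsto_diff tendsto_const) simp
        moreover have "isCont ?I x" using elim by (simp add: isCont_indicator)
        ultimately have "(\<lambda>n. ?I (x - v /\<^sub>R real (Suc n))) \<longlonglongrightarrow> ?I x"
          using isCont_tendsto_compose[of x ?I] by simp
        then show ?case using elim by (intro tendsto_mult)
      qed
      show ?thesis unfolding eq
        by (rule integral_dominated_convergence[OF _ _ b ae bd]) auto
    qed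
    have int: "integrable lborel (\<lambda>x. ?I x * dquot V u n (x + c))" for u n c
    proof (rule Bochner_Integration.integrable_bound)
      show "integrable lborel (\<lambda>x. (L * norm u) * ?I x)" using fin by auto
      show "AE x in lborel. norm (?I x * dquot V u n (x + c)) \<le> norm ((L * norm u) * ?I x)"
        using dquot_bound L0 by (auto simp: indicator_def abs_mult)
    qed auto
    have "(\<integral>x. ?I x * dquot V (v + w) n x \<partial>lborel) = (\<integral>x. ?I x * dquot V v n x \<partial>lborel)
       + (\<integral>x. ?I x * dquot V w n (x + v /\<^sub>R real (Suc n)) \<partial>lborel)" for n
      using int[of v n 0] int[of w n "v /\<^sub>R real (Suc n)"]
      by (subst Bochner_Integration.integral_add[symmetric]) (simp_all add: dquot_add ring_distribs)
    then have "(\<lambda>n. \<integral>x. ?I x * dquot V (v + w) n x \<partial>lborel) \<longlonglongrightarrow>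
        (\<integral>x. ?I x * dlim V v x \<partial>lborel) + (\<integral>x. ?I x * dlim V w x \<partial>lborel)"
      using tendsto_add[OF conjunct2[OF conv[of v]] shift] by simp
    then have eq: "(\<integral>x. ?I x * dlim V (v + w) x \<partial>lborel) =
        (\<integral>x. ?I x * dlim V v x \<partial>lborel) + (\<integral>x. ?I x * dlim V w x \<partial>lborel)"
      using conv[of "v + w"] LIMSEQ_unique by blast
    have "((\<lambda>x. ?I x * dlim V (v + w) x - ?I x * dlim V v x - ?I x * dlim V w x) has_integral
       (\<integral>x. ?I x * dlim V (v + w) x \<partial>lborel) - (\<integral>x. ?I x * dlim V v x \<partial>lborel) - (\<integral>x. ?I x * dlim V w x \<partial>lborel)) UNIV"
      using conv by (intro has_integral_diff has_integral_integral_lborel) auto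
    then have "((\<lambda>x. ?I x * (dlim V (v + w) x - dlim V v x - dlim V w x)) has_integral 0) UNIV"
      by (simp add: eq algebra_simps)
    then show ?thesis
      by (simp add: has_integral_indicator_mult)
  qed
  from AE_zero_if_box_integrals_zero[OF this] show ?thesis
    by eventually_elim simp
qed

text \<open>Expand \<open>v\<close> in the basis and use additivity and homogeneity finitely often.
  The exceptional null set depends on \<open>v\<close>, which is why
  \<open>rademacher_lipschitz\<close> uses only countably many directions.\<close>

lemma AE_dlim_linear: "AE x in lborel. dlim V v x = (\<Sum>b\<in>Basis. dlim V b x *\<^sub>R b) \<bullet> v"
proof -
  have "AE x in lborel. dlim V (\<Sum>b\<in>S. (v \<bullet> b) *\<^sub>R b) x = (\<Sum>b\<in>S. (v \<bullet> b) * dlim V b x)"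
    if "finite S" for S
    using that
  proof (induction S rule: finite_induct)
    case empty
    then show ?case using AE_dlim_scaleR[of 0 0] by simp
  next
    case (insert b S)
    show ?case
      using insert.IH AE_dlim_add[of "(v \<bullet> b) *\<^sub>R b" "\<Sum>b\<in>S. (v \<bullet> b) *\<^sub>R b"] AE_dlim_scaleR[of "v \<bullet> b" b]
      by eventually_elim (use insert.hyps in simp)
  qed
  from this[OF finite_Basis]
  have "AE x in lborel. dlim V v x = (\<Sum>b\<in>Basis. (v \<bullet> b) * dlim V b x)"
    by (simp add: euclidean_representation)
  moreover have "(\<Sum>b\<in>Basis. dlim V b x *\<^sub>R b) \<bullet> v = (\<Sum>b\<in>Basis. (v \<bullet> b) * dlim V b x)" for x
    by (subst inner_sum_left) (simp add: inner_commute[of v] mult.commute)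
  ultimately show ?thesis by simp
qed

text \<open>The Lipschitz bound makes the quotients equicontinuous in the direction, so a finite net
  of the unit ball taken from \<open>Q\<close> controls all directions at once. The discrete steps
  suffice because every small increment is comparable to some \<open>1 / Suc n\<close>.\<close>

lemma has_derivative_if_dquot_tendsto_dense:
  assumes dense: "\<And>w e. 0 < e \<Longrightarrow> \<exists>q\<in>Q. dist w q < e"
    and lim: "\<And>q. q \<in> Q \<Longrightarrow> (\<lambda>n. dquot V q n x) \<longlonglongrightarrow> g \<bullet> q"
  shows "(V has_derivative (\<lambda>h. g \<bullet> h)) (at x)"
  unfolding has_derivative_at_alt
proof (intro conjI allI impI)
  show "bounded_linear ((\<bullet>) g)" by (rule bounded_linear_inner_right)
  fix e :: real assume e: "0 < e"
  have L0: "0 \<le> L" using lip by (rule lipschitz_on_nonneg)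
  \<comment> \<open>Replacing a direction by a net point costs at most
    \<open>(L + norm g) * \<eta>\<close>, which is at most \<open>e / 4\<close>. With
    \<open>e / 4\<close> from the net this gives \<open>e / 2\<close>, and the comparison of
    \<open>1 / m\<close> with \<open>2 * norm h\<close> uses up the remaining factor 2.\<close>
  define \<eta> where "\<eta> = e / (4 * (L + norm g + 1))"
  have \<eta>: "\<eta> > 0" using e L0 by (simp add: \<eta>_def add_nonneg_pos)
  have "cball (0::'a) 1 \<subseteq> (\<Union>q\<in>Q. ball q \<eta>)" using dense[OF \<eta>] by (auto simp: dist_commute)
  then obtain K where K: "K \<subseteq> Q" "finite K" "cball (0::'a) 1 \<subseteq> (\<Union>q\<in>K. ball q \<eta>)"
    using compactE_image[OF compact_cball, of Q "\<lambda>q. ball q \<eta>"] by blast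
  have "\<forall>q\<in>K. \<forall>\<^sub>F n in sequentially. dist (dquot V q n x) (g \<bullet> q) < e / 4"
    using K(1) e by (intro ballI tendstoD lim) auto
  then have "\<forall>\<^sub>F n in sequentially. \<forall>q\<in>K. dist (dquot V q n x) (g \<bullet> q) < e / 4"
    using K(2) by (simp add: eventually_ball_finite)
  then obtain N where N: "\<And>n q. n \<ge> N \<Longrightarrow> q \<in> K \<Longrightarrow> \<bar>dquot V q n x - g \<bullet> q\<bar> < e / 4"
    by (auto simp: eventually_sequentially dist_real_def)
  show "\<exists>d>0. \<forall>y. norm (y - x) < d \<longrightarrow> norm (V y - V x - g \<bullet> (y - x)) \<le> e * norm (y - x)"
  proof (intro exI[of _ "1 / (real N + 2)"] conjI allI impI)
    fix y assume y: "norm (y - x) < 1 / (real N + 2)"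
    show "norm (V y - V x - g \<bullet> (y - x)) \<le> e * norm (y - x)"
    proof (cases "y = x")
      case False
      define h where "h = y - x"
      have h: "norm h > 0" "norm h < 1 / (real N + 2)" using False y by (auto simp: h_def)
      have big: "1 / norm h > real N + 2" using h by (simp add: field_simps)
      \<comment> \<open>Makes \<open>Suc n\<close> the integer part of \<open>1 / norm h\<close>, so
        that the rescaled increment has norm between 1/2 and 1.\<close>
      define n where "n = nat \<lfloor>1 / norm h\<rfloor> - 1"
      have n: "real (Suc n) \<le> 1 / norm h" "1 / norm h < real (Suc n) + 1" "n \<ge> N"
        unfolding n_def using big by linarith+
      define m where "m = real (Suc n)"
      have m: "m \<ge> 1" "m * norm h \<le> 1" "1 / m \<le> 2 * norm h"
      proof -
        show m1: "m \<ge> 1" by (simp add: m_def)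
        show "m * norm h \<le> 1" using n(1) h by (simp add: m_def field_simps)
        have "1 < (m + 1) * norm h" using n(2) h by (simp add: m_def field_simps)
        also have "\<dots> \<le> (2 * m) * norm h" using m1 by (intro mult_right_mono) auto
        finally show "1 / m \<le> 2 * norm h" using m1 by (simp add: field_simps)
      qed
      have "m *\<^sub>R h \<in> cball 0 1" using m by simp
      then obtain q where q: "q \<in> K" "norm (m *\<^sub>R h - q) < \<eta>"
        using K(3) unfolding UN_iff subset_iff mem_ball dist_norm by (metis norm_minus_commute)
      have 1: "\<bar>V (x + h) - V (x + q /\<^sub>R m)\<bar> \<le> (1 / m) * (L * \<eta>)"
      proof -
        have "h - q /\<^sub>R m = (1 / m) *\<^sub>R (m *\<^sub>R h - q)" using m by (simp add: algebra_simps divide_inverse)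
        then have "norm (h - q /\<^sub>R m) = (1 / m) * norm (m *\<^sub>R h - q)" using m by simp
        then have "norm (h - q /\<^sub>R m) \<le> (1 / m) * \<eta>" using q m by (auto intro!: divide_right_mono)
        moreover have "\<bar>V (x + h) - V (x + q /\<^sub>R m)\<bar> \<le> L * norm (h - q /\<^sub>R m)"
          using lipschitz_onD[OF lip, of "x + h" "x + q /\<^sub>R m"] by (simp add: dist_norm)
        ultimately show ?thesis using L0 mult_left_mono[of "norm (h - q /\<^sub>R m)" "(1/m) * \<eta>" L] by (simp add: mult_ac)
      qed
      have 2: "\<bar>V (x + q /\<^sub>R m) - V x - (1 / m) * (g \<bullet> q)\<bar> \<le> (1 / m) * (e / 4)"
      proof -
        have "dquot V q n x = m * (V (x + q /\<^sub>R m) - V x)" by (simp only: dquot_def m_def)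
        then have eq: "V (x + q /\<^sub>R m) - V x - (1 / m) * (g \<bullet> q) = (1 / m) * (dquot V q n x - g \<bullet> q)"
          using m by (simp add: field_simps)
        have "\<bar>(1 / m) * (dquot V q n x - g \<bullet> q)\<bar> = (1 / m) * \<bar>dquot V q n x - g \<bullet> q\<bar>" using m by (simp add: abs_mult)
        also have "\<dots> \<le> (1 / m) * (e / 4)"
          using N[OF n(3) q(1)] m by (intro mult_left_mono) auto
        finally show ?thesis unfolding eq .
      qed
      have 3: "\<bar>(1 / m) * (g \<bullet> q) - g \<bullet> h\<bar> \<le> (1 / m) * (norm g * \<eta>)"
      proof -
        have "(1 / m) * (g \<bullet> q) - g \<bullet> h = (1 / m) * (g \<bullet> (q - m *\<^sub>R h))"
          using m by (simp add: inner_diff_right field_simps)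
        moreover have "\<bar>g \<bullet> (q - m *\<^sub>R h)\<bar> \<le> norm g * \<eta>"
          using Cauchy_Schwarz_ineq2[of g "q - m *\<^sub>R h"] q(2)
          by (smt (verit) mult_left_mono norm_ge_zero norm_minus_commute)
        ultimately show ?thesis using m by (simp add: abs_mult divide_right_mono)
      qed
      have "\<bar>V (x + h) - V x - g \<bullet> h\<bar> \<le> (1 / m) * (L * \<eta>) + (1 / m) * (e / 4) + (1 / m) * (norm g * \<eta>)"
        using 1 2 3 by linarith
      also have "\<dots> = (1 / m) * ((L + norm g) * \<eta> + e / 4)" by (simp add: algebra_simps)
      also have "\<dots> \<le> (1 / m) * (e / 2)"
      proof -
        have "(L + norm g) * \<eta> \<le> (L + norm g + 1) * \<eta>" using \<eta> by simp
        also have "\<dots> = e / 4" using L0 by (simp add: \<eta>_def add_nonneg_pos field_simps add_nonneg_eq_0_iff)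
        finally show ?thesis using m by (intro mult_left_mono) auto
      qed
      also have "\<dots> \<le> (2 * norm h) * (e / 2)" using m e by (intro mult_right_mono) auto
      finally show ?thesis by (simp add: h_def algebra_simps)
    qed simp
  qed simp
qed

text \<open>One gradient vector works for a countable dense set of directions off a single null set;
  equicontinuity in the direction then yields the full derivative.\<close>

theorem rademacher_lipschitz: "AE x in lborel. \<exists>g. (V has_derivative (\<lambda>h. g \<bullet> h)) (at x)"
proof -
  obtain Q :: "'a set" where Q: "countable Q" "\<And>U. open U \<Longrightarrow> U \<noteq> {} \<Longrightarrow> \<exists>d\<in>Q. d \<in> U"
    using countable_dense_setE by blast
  have "AE x in lborel. \<forall>q\<in>Q. (\<lambda>n. dquot V q n x) \<longlonglongrightarrow> (\<Sum>b\<in>Basis. dlim V b x *\<^sub>R b) \<bullet> q"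
  proof (subst AE_ball_countable[OF Q(1)], intro ballI)
    fix q
    show "AE x in lborel. (\<lambda>n. dquot V q n x) \<longlonglongrightarrow> (\<Sum>b\<in>Basis. dlim V b x *\<^sub>R b) \<bullet> q"
      using AE_dquot_tendsto[of q] AE_dlim_linear[of q] by eventually_elim simp
  qed
  moreover have "\<exists>q\<in>Q. dist w q < e" if "0 < e" for w e
    using Q(2)[of "ball w e"] that by auto
  ultimately show ?thesis
    by (auto elim!: eventually_mono intro!: exI has_derivative_if_dquot_tendsto_dense)
qed

end

section \<open>The Clarke gradient along curves\<close>

lemma locally_lipschitzE:
  assumes "locally_lipschitz V"
  obtains r L where "r > 0" "L-lipschitz_on (ball x r) V"
  using assms unfolding locally_lipschitz_def by blast

text \<open>Compactness, through \<open>local_lipschitz\<close> with the singleton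
  \<open>{0}\<close> as a dummy time domain.\<close>

lemma locally_lipschitz_on_cball:
  fixes V :: "'a::euclidean_space \<Rightarrow> real"
  assumes "locally_lipschitz V"
  obtains L where "L-lipschitz_on (cball 0 R) V"
proof -
  have "local_lipschitz {0::real} (cball 0 R) (\<lambda>_. V)"
  proof (rule local_lipschitzI)
    fix t and x :: 'a assume "x \<in> cball 0 R"
    obtain r L where r: "r > 0" "L-lipschitz_on (ball x r) V"
      using locally_lipschitzE[OF assms] by blast
    then have "L-lipschitz_on (cball x (r/2) \<inter> cball 0 R) V"
      by (auto intro: lipschitz_on_subset)
    then show "\<exists>u>0. \<exists>L. \<forall>t\<in>cball t u \<inter> {0}. L-lipschitz_on (cball x u \<inter> cball 0 R) V"
      using r(1) by (intro exI[of _ "r/2"]) auto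
  qed
  then obtain L where "\<And>t. t \<in> {0::real} \<Longrightarrow> L-lipschitz_on (cball 0 R) V"
    by (rule local_lipschitz_compact_implies_lipschitz) auto
  then show thesis using that by auto
qed

text \<open>Composing \<open>V\<close> with the nearest-point projection onto a ball gives a
  globally Lipschitz function equal to \<open>V\<close> in the ball; countably many balls exhaust
  the space.\<close>

theorem rademacher:
  fixes V :: "'a::euclidean_space \<Rightarrow> real"
  assumes V: "locally_lipschitz V"
  shows "AE x in lborel. \<exists>g. (V has_derivative (\<lambda>h. g \<bullet> h)) (at x)"
proof -
  define W where "W n = (\<lambda>x. V (closest_point (cball 0 (real n)) x))" for n
  have "AE x in lborel. \<exists>g. (W n has_derivative (\<lambda>h. g \<bullet> h)) (at x)" for n
  proof -
    obtain L where L: "L-lipschitz_on (cball 0 (real n)) V"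
      by (rule locally_lipschitz_on_cball[OF V])
    have "L-lipschitz_on UNIV (W n)"
    proof (rule lipschitz_onI)
      fix x y :: 'a
      have "dist (W n x) (W n y) \<le> L * dist (closest_point (cball 0 (real n)) x) (closest_point (cball 0 (real n)) y)"
        unfolding W_def by (intro lipschitz_onD[OF L] closest_point_in_set) auto
      also have "\<dots> \<le> L * dist x y"
        using lipschitz_on_nonneg[OF L] by (intro mult_left_mono closest_point_lipschitz) auto
      finally show "dist (W n x) (W n y) \<le> L * dist x y" .
    qed (rule lipschitz_on_nonneg[OF L])
    then show ?thesis by (rule rademacher_lipschitz)
  qed
  then have "AE x in lborel. \<forall>n. \<exists>g. (W n has_derivative (\<lambda>h. g \<bullet> h)) (at x)"
    by (simp add: AE_all_countable)
  then show ?thesis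
  proof eventually_elim
    case (elim x)
    obtain n :: nat where n: "norm x < real n" using reals_Archimedean2 by blast
    obtain g where "(W n has_derivative (\<lambda>h. g \<bullet> h)) (at x)" using elim by blast
    then have "(V has_derivative (\<lambda>h. g \<bullet> h)) (at x)"
      by (rule has_derivative_transform_within_open[OF _ open_ball[of 0 "real n"]])
        (use n in \<open>auto simp: W_def closest_point_self\<close>)
    then show ?case by blast
  qed
qed

text \<open>Along the direction \<open>g\<close> itself the linear increment is
  \<open>t * (g \<bullet> g)\<close>, while the Lipschitz bound allows only
  \<open>L * (t * norm g)\<close>.\<close>

lemma gradient_norm_le_lipschitz:
  fixes V :: "'a::euclidean_space \<Rightarrow> real"
  assumes L: "L-lipschitz_on S V" and S: "open S" "z \<in> S"
    and g: "(V has_derivative (\<lambda>h. g \<bullet> h)) (at z)"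
  shows "norm g \<le> L"
proof (rule field_le_epsilon)
  fix e :: real assume e: "0 < e"
  show "norm g \<le> L + e"
  proof (cases "g = 0")
    case True then show ?thesis using lipschitz_on_nonneg[OF L] e by simp
  next
    case False
    then have g0: "norm g > 0" by simp
    obtain d where d: "d > 0" "\<And>y. norm (y - z) < d \<Longrightarrow> \<bar>V y - V z - g \<bullet> (y - z)\<bar> \<le> e * norm (y - z)"
      using g e unfolding has_derivative_at_alt by (metis real_norm_def)
    obtain r where r: "r > 0" "ball z r \<subseteq> S" using S openE by blast
    define t where "t = min d r / (2 * norm g)"
    have t: "t > 0" "t * norm g < d" "t * norm g < r"
      using d r g0 by (auto simp: t_def)
    let ?y = "z + t *\<^sub>R g"
    have n: "norm (?y - z) = t * norm g" using t by simp
    have "?y \<in> S" using r t n by (intro subsetD[OF r(2)]) (simp add: dist_norm)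
    then have "\<bar>V ?y - V z\<bar> \<le> L * (t * norm g)"
      using lipschitz_onD[OF L, of ?y z] S(2) t(1) by (simp add: dist_norm)
    moreover have "\<bar>V ?y - V z - t * (g \<bullet> g)\<bar> \<le> e * (t * norm g)" using d(2)[of ?y] t n by simp
    ultimately have "t * (g \<bullet> g) \<le> (L + e) * (t * norm g)" by (simp add: algebra_simps)
    then have "(t * norm g) * norm g \<le> (t * norm g) * (L + e)"
      by (simp add: dot_square_norm power2_eq_square algebra_simps)
    then show ?thesis using t(1) g0 by (simp add: mult_le_cancel_left)
  qed
qed

text \<open>Compactness: gradients violating the bound at points approaching \<open>x\<close> are
  bounded by a local Lipschitz constant, and a limit point of them is one of the generators of the
  Clarke gradient, yet pairs with \<open>d\<close> to at least \<open>a + e\<close>.\<close>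

lemma gradients_near_clarke_grad:
  fixes V :: "'a::euclidean_space \<Rightarrow> real"
  assumes V: "locally_lipschitz V" and a: "\<And>p. p \<in> clarke_grad V x \<Longrightarrow> p \<bullet> d \<le> a" and e: "0 < e"
  obtains \<delta> where "\<delta> > 0"
    "\<And>z g. z \<in> ball x \<delta> \<Longrightarrow> (V has_derivative (\<lambda>h. g \<bullet> h)) (at z) \<Longrightarrow> g \<bullet> d \<le> a + e"
proof (rule ccontr)
  assume "\<not> thesis"
  with that have neg: "\<exists>z g. z \<in> ball x \<delta> \<and> (V has_derivative (\<lambda>h. g \<bullet> h)) (at z) \<and> a + e < g \<bullet> d"
    if "\<delta> > 0" for \<delta>
    using that by (metis not_le_imp_less)
  obtain r L where r: "r > 0" "L-lipschitz_on (ball x r) V"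
    using locally_lipschitzE[OF V] by blast
  have "\<exists>z g. z \<in> ball x (min r (inverse (real (Suc n)))) \<and> (V has_derivative (\<lambda>h. g \<bullet> h)) (at z) \<and> a + e < g \<bullet> d" for n
    using neg[of "min r (inverse (real (Suc n)))"] r by simp
  then obtain z g where zg: "\<And>n. z n \<in> ball x (min r (inverse (real (Suc n))))"
    "\<And>n. (V has_derivative (\<lambda>h. g n \<bullet> h)) (at (z n))" "\<And>n. a + e < g n \<bullet> d"
    by metis
  have zx: "z \<longlonglongrightarrow> x"
  proof (rule metric_tendsto_imp_tendsto[OF LIMSEQ_inverse_real_of_nat])
    show "\<forall>\<^sub>F n in sequentially. dist (z n) x \<le> dist (inverse (real (Suc n))) 0"
      using zg(1) by (auto simp: dist_commute less_imp_le)
  qed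
  have "g n \<in> cball 0 L" for n
    using gradient_norm_le_lipschitz[OF r(2) open_ball _ zg(2)[of n]] zg(1)[of n] by simp
  then obtain p k where p: "strict_mono k" "(g \<circ> k) \<longlonglongrightarrow> p"
    using compact_cball[of 0 L] unfolding compact_def by metis
  have "p \<in> clarke_grad V x"
    unfolding clarke_grad_def
  proof (rule hull_inc, rule CollectI, intro exI conjI allI)
    show "(z \<circ> k) \<longlonglongrightarrow> x" by (rule LIMSEQ_subseq_LIMSEQ[OF zx p(1)])
    show "(V has_derivative (\<lambda>h. (g \<circ> k) n \<bullet> h)) (at ((z \<circ> k) n))" for n using zg(2) by simp
  qed (rule p(2))
  then have "p \<bullet> d \<le> a" by (rule a)
  moreover have "a + e \<le> p \<bullet> d"
  proof (rule LIMSEQ_le_const)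
    show "(\<lambda>n. (g \<circ> k) n \<bullet> d) \<longlonglongrightarrow> p \<bullet> d" by (intro tendsto_intros p)
    show "\<exists>N. \<forall>n\<ge>N. a + e \<le> (g \<circ> k) n \<bullet> d" using zg(3) by (auto intro: less_imp_le)
  qed
  ultimately show False using e by simp
qed

text \<open>By Fubini, almost every line parallel to \<open>d\<close> meets the null set of non-differentiability
  points in a null set, and the increment along such a line is governed by nearby gradients.\<close>

lemma clarke_directional_increment:
  fixes V :: "'a::euclidean_space \<Rightarrow> real"
  assumes V: "locally_lipschitz V" and a: "\<And>p. p \<in> clarke_grad V x \<Longrightarrow> p \<bullet> d \<le> a" and e: "0 < e"
  obtains \<delta> where "\<delta> > 0"
    "\<And>y h. y \<in> ball x \<delta> \<Longrightarrow> 0 < h \<Longrightarrow> h < \<delta> \<Longrightarrow> V (y + h *\<^sub>R d) - V y \<le> h * (a + e)"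
proof -
  obtain \<delta>1 where \<delta>1: "\<delta>1 > 0"
    "\<And>z g. z \<in> ball x \<delta>1 \<Longrightarrow> (V has_derivative (\<lambda>h. g \<bullet> h)) (at z) \<Longrightarrow> g \<bullet> d \<le> a + e"
    using gradients_near_clarke_grad[OF V a e] by blast
  obtain r L where r: "r > 0" "L-lipschitz_on (ball x r) V"
    using locally_lipschitzE[OF V] by blast
  \<comment> \<open>The divisor pays for the displacement of the base point and for the length of
    the segment together.\<close>
  define \<delta> where "\<delta> = min \<delta>1 r / (1 + norm d)"
  have pos: "1 + norm d > 0" using norm_ge_zero[of d] by linarith
  have \<delta>: "\<delta> > 0" "\<delta> * (1 + norm d) = min \<delta>1 r" using \<delta>1(1) r(1) pos by (auto simp: \<delta>_def)
  have seg: "y + s *\<^sub>R d \<in> ball x (min \<delta>1 r)" if "y \<in> ball x \<delta>" "0 \<le> s" "s < \<delta>" for y s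
  proof -
    have "dist x (y + s *\<^sub>R d) \<le> dist x y + s * norm d"
      using dist_triangle[of x "y + s *\<^sub>R d" y] that(2) by (simp add: dist_norm)
    also have "\<dots> < \<delta> + \<delta> * norm d"
      using that by (intro add_less_le_mono mult_right_mono) auto
    finally show ?thesis using \<delta>(2) by (simp add: algebra_simps)
  qed
  have good: "V (y + h *\<^sub>R d) - V y \<le> h * (a + e)"
    if y: "y \<in> ball x \<delta>" "AE s in lborel. \<exists>g. (V has_derivative (\<lambda>h. g \<bullet> h)) (at (y + s *\<^sub>R d))"
      and h: "0 < h" "h < \<delta>" for y h
  proof -
    have "(L * norm d)-lipschitz_on {0..h} (\<lambda>s. V (y + s *\<^sub>R d))"
    proof (rule lipschitz_onI)
      show "dist (V (y + s *\<^sub>R d)) (V (y + t *\<^sub>R d)) \<le> L * norm d * dist s t" if "s \<in> {0..h}" "t \<in> {0..h}" for s t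
        using lipschitz_onD[OF r(2), of "y + s *\<^sub>R d" "y + t *\<^sub>R d"] seg[OF y(1), of s] seg[OF y(1), of t] that h
        by (simp add: dist_norm scaleR_diff_left[symmetric] mult_ac)
    qed (use lipschitz_on_nonneg[OF r(2)] in simp)
    then have "abs_cont_on 0 h (\<lambda>s. V (y + s *\<^sub>R d))" by (rule lipschitz_imp_abs_cont_on)
    moreover have "abs_cont_on 0 h (\<lambda>s. - (a + e) * s)"
      by (rule lipschitz_imp_abs_cont_on[of "\<bar>a + e\<bar>"], rule lipschitz_onI)
         (auto simp: dist_real_def abs_mult[symmetric] algebra_simps)
    ultimately have ac: "abs_cont_on 0 h (\<lambda>s. V (y + s *\<^sub>R d) + - (a + e) * s)"
      by (rule abs_cont_on_add)
    have "V (y + h *\<^sub>R d) + - (a + e) * h \<le> V (y + 0 *\<^sub>R d) + - (a + e) * 0"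
    proof (rule abs_cont_on_nonincreasing[OF ac])
      show "AE s in lborel. 0 < s \<and> s < h \<longrightarrow>
        (\<exists>D\<le>0. ((\<lambda>s. V (y + s *\<^sub>R d) + - (a + e) * s) has_real_derivative D) (at s))"
        using y(2)
      proof (eventually_elim, intro impI)
        fix s assume g: "\<exists>g. (V has_derivative (\<lambda>h. g \<bullet> h)) (at (y + s *\<^sub>R d))" and s: "0 < s \<and> s < h"
        then obtain g where g: "(V has_derivative (\<lambda>h. g \<bullet> h)) (at (y + s *\<^sub>R d))" by blast
        have "((\<lambda>s. y + s *\<^sub>R d) has_vector_derivative d) (at s)"
          by (auto intro!: derivative_eq_intros)
        then have "((\<lambda>s. V (y + s *\<^sub>R d)) has_vector_derivative g \<bullet> d) (at s)"
          using vector_derivative_diff_chain_within[of "\<lambda>s. y + s *\<^sub>R d" d s UNIV V "\<lambda>h. g \<bullet> h"] g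
          by (auto simp: o_def intro: has_derivative_at_withinI)
        then have "((\<lambda>s. V (y + s *\<^sub>R d) + - (a + e) * s) has_real_derivative g \<bullet> d + - (a + e)) (at s)"
          unfolding has_real_derivative_iff_has_vector_derivative[symmetric]
          by (auto intro!: derivative_eq_intros)
        moreover have "g \<bullet> d \<le> a + e"
          using seg[OF y(1), of s] s h by (intro \<delta>1(2)[OF _ g]) auto
        ultimately show "\<exists>D\<le>0. ((\<lambda>s. V (y + s *\<^sub>R d) + - (a + e) * s) has_real_derivative D) (at s)"
          by (intro exI[of _ "g \<bullet> d + - (a + e)"]) auto
      qed
    qed (use h in simp)
    then show ?thesis by (simp add: algebra_simps)
  qed
  have ae: "AE y in lborel. AE s in lborel. \<exists>g. (V has_derivative (\<lambda>h. g \<bullet> h)) (at (y + s *\<^sub>R d))"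
    by (rule AE_on_lines_if_AE[OF rademacher[OF V]])
  have "V (y + h *\<^sub>R d) - V y \<le> h * (a + e)" if y: "y \<in> ball x \<delta>" and h: "0 < h" "h < \<delta>" for y h
  proof (rule ccontr)
    \<comment> \<open>Violation is an open condition on the base point by continuity of
      \<open>V\<close>, whereas the estimate already holds for almost every base point; a nonempty
      open set is not null.\<close>
    assume bad: "\<not> V (y + h *\<^sub>R d) - V y \<le> h * (a + e)"
    have cV: "continuous_on (ball x r) V" by (rule lipschitz_on_continuous_on[OF r(2)])
    have sub: "ball x \<delta> \<subseteq> ball x r" "(\<lambda>y. y + h *\<^sub>R d) ` ball x \<delta> \<subseteq> ball x r"
      using seg[of _ 0] seg[of _ h] h \<delta>(1) by auto
    have "continuous_on (ball x \<delta>) (\<lambda>y. V (y + h *\<^sub>R d) - V y)"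
      by (intro continuous_intros continuous_on_subset[OF cV sub(1)]
          continuous_on_compose2[OF cV _ sub(2)])
    then have "open (ball x \<delta> \<inter> (\<lambda>y. V (y + h *\<^sub>R d) - V y) -` {h * (a + e)<..})"
      by (rule continuous_open_preimage) auto
    moreover have "y \<in> ball x \<delta> \<inter> (\<lambda>y. V (y + h *\<^sub>R d) - V y) -` {h * (a + e)<..}"
      using y bad by auto
    ultimately have "\<not> negligible (ball x \<delta> \<inter> (\<lambda>y. V (y + h *\<^sub>R d) - V y) -` {h * (a + e)<..})"
      by (metis empty_iff open_not_negligible)
    moreover have "negligible (ball x \<delta> \<inter> (\<lambda>y. V (y + h *\<^sub>R d) - V y) -` {h * (a + e)<..})"
    proof -
      obtain N where N: "N \<in> null_sets lborel"
        "{y. \<not> (AE s in lborel. \<exists>g. (V has_derivative (\<lambda>h. g \<bullet> h)) (at (y + s *\<^sub>R d)))} \<subseteq> N"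
        using ae by (auto simp: eventually_ae_filter)
      have "negligible N" using N(1) by (simp add: negligible_iff_null_sets null_sets_completionI)
      then show ?thesis
        by (rule negligible_subset) (use good h N(2) in \<open>fastforce simp: not_le[symmetric]\<close>)
    qed
    ultimately show False by blast
  qed
  with \<delta>(1) show thesis by (rule that)
qed

text \<open>Constancy of the pairing supplies upper bounds for increments along \<open>d\<close> and
  along \<open>- d\<close> with opposite slopes, hence a two-sided directional derivative
  \<open>a\<close>. Replacing the curve by its tangent costs only
  \<open>o(\<bar>s - t\<bar>)\<close>, by the local Lipschitz bound.\<close>

lemma clarke_chain_rule:
  fixes V :: "'a::euclidean_space \<Rightarrow> real"
  assumes V: "locally_lipschitz V" and \<phi>: "(\<phi> has_vector_derivative d) (at t)"
    and a: "\<And>p. p \<in> clarke_grad V (\<phi> t) \<Longrightarrow> p \<bullet> d = a"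
  shows "((\<lambda>s. V (\<phi> s)) has_real_derivative a) (at t)"
proof -
  have dir: "\<exists>\<delta>>0. \<forall>s. \<bar>s\<bar> < \<delta> \<longrightarrow> \<bar>V (\<phi> t + s *\<^sub>R d) - V (\<phi> t) - s * a\<bar> \<le> e * \<bar>s\<bar>" if e: "0 < e" for e
  proof -
    have a1: "p \<bullet> d \<le> a" and a2: "p \<bullet> (- d) \<le> - a" if "p \<in> clarke_grad V (\<phi> t)" for p
      using a[OF that] by simp_all
    obtain \<delta>1 where \<delta>1: "\<delta>1 > 0" "\<And>y h. y \<in> ball (\<phi> t) \<delta>1 \<Longrightarrow> 0 < h \<Longrightarrow> h < \<delta>1 \<Longrightarrow> V (y + h *\<^sub>R d) - V y \<le> h * (a + e)"
      using clarke_directional_increment[OF V a1 e] by blast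
    obtain \<delta>2 where \<delta>2: "\<delta>2 > 0" "\<And>y h. y \<in> ball (\<phi> t) \<delta>2 \<Longrightarrow> 0 < h \<Longrightarrow> h < \<delta>2 \<Longrightarrow> V (y + h *\<^sub>R (- d)) - V y \<le> h * (- a + e)"
      using clarke_directional_increment[OF V a2 e] by blast
    define \<delta> where "\<delta> = min \<delta>1 \<delta>2 / (1 + norm d)"
    have pos: "1 + norm d > 0" using norm_ge_zero[of d] by linarith
    have \<delta>0: "\<delta> > 0" using \<delta>1(1) \<delta>2(1) pos by (simp add: \<delta>_def)
    moreover have "\<delta> * (1 + norm d) = min \<delta>1 \<delta>2" using pos by (simp add: \<delta>_def)
    then have "\<delta> + \<delta> * norm d = min \<delta>1 \<delta>2" by (simp add: distrib_left)
    moreover have "\<delta> * norm d \<ge> 0" using \<delta>0 by simp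
    ultimately have \<delta>: "\<delta> > 0" "\<delta> \<le> \<delta>1" "\<delta> \<le> \<delta>2" "\<delta> * norm d < min \<delta>1 \<delta>2"
      by linarith+
    have "\<bar>V (\<phi> t + s *\<^sub>R d) - V (\<phi> t) - s * a\<bar> \<le> e * \<bar>s\<bar>" if s: "\<bar>s\<bar> < \<delta>" for s
    proof -
      have "norm (s *\<^sub>R d) \<le> \<delta> * norm d" using s by (auto intro!: mult_right_mono)
      then have mem: "\<phi> t + s *\<^sub>R d \<in> ball (\<phi> t) \<delta>1" "\<phi> t + s *\<^sub>R d \<in> ball (\<phi> t) \<delta>2"
        using \<delta>(4) by (auto simp: dist_norm)
      consider "s = 0" | "s > 0" | "s < 0" by linarith
      then show ?thesis
      proof cases
        case 2
        have "V (\<phi> t + s *\<^sub>R d) - V (\<phi> t) \<le> s * (a + e)"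
          using \<delta>1(2)[of "\<phi> t" s] \<delta>1(1) \<delta> s 2 by simp
        \<comment> \<open>The lower bound comes from walking back from the end point; this is why
          the increment estimate is needed at all base points near \<open>\<phi> t\<close>.\<close>
        moreover have "V (\<phi> t + s *\<^sub>R d + s *\<^sub>R (- d)) - V (\<phi> t + s *\<^sub>R d) \<le> s * (- a + e)"
          using \<delta>2(2)[OF mem(2), of s] \<delta> s 2 by simp
        ultimately show ?thesis using 2 by (simp add: algebra_simps abs_le_iff)
      next
        case 3
        have "V (\<phi> t + (- s) *\<^sub>R (- d)) - V (\<phi> t) \<le> (- s) * (- a + e)"
          using \<delta>2(2)[of "\<phi> t" "- s"] \<delta>2(1) \<delta> s 3 by simp
        moreover have "V (\<phi> t + s *\<^sub>R d + (- s) *\<^sub>R d) - V (\<phi> t + s *\<^sub>R d) \<le> (- s) * (a + e)"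
          using \<delta>1(2)[OF mem(1), of "- s"] \<delta> s 3 by simp
        ultimately show ?thesis using 3 by (simp add: algebra_simps abs_le_iff)
      qed simp
    qed
    with \<delta>(1) show ?thesis by blast
  qed
  obtain r L where r: "r > 0" "L-lipschitz_on (ball (\<phi> t) r) V"
    using locally_lipschitzE[OF V] by blast
  have L0: "0 \<le> L" by (rule lipschitz_on_nonneg[OF r(2)])
  have \<phi>': "\<exists>\<delta>>0. \<forall>s. \<bar>s - t\<bar> < \<delta> \<longrightarrow> norm (\<phi> s - \<phi> t - (s - t) *\<^sub>R d) \<le> e * \<bar>s - t\<bar>" if "0 < e" for e
    using \<phi> that unfolding has_vector_derivative_def has_derivative_at_alt by simp
  have cont: "isCont \<phi> t"
    using \<phi> has_derivative_continuous has_vector_derivative_def by blast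
  show ?thesis
    unfolding has_field_derivative_def has_derivative_at_alt
  proof (intro conjI allI impI)
    show "bounded_linear ((*) a)" by (rule bounded_linear_mult_right)
    fix e :: real assume e: "0 < e"
    have e1: "0 < e / 2" "0 < e / (2 * (L + 1))" using e L0 by auto
    obtain \<delta>1 where \<delta>1: "\<delta>1 > 0" "\<And>s. \<bar>s\<bar> < \<delta>1 \<Longrightarrow> \<bar>V (\<phi> t + s *\<^sub>R d) - V (\<phi> t) - s * a\<bar> \<le> e / 2 * \<bar>s\<bar>"
      using dir[OF e1(1)] by blast
    obtain \<delta>2 where \<delta>2: "\<delta>2 > 0" "\<And>s. \<bar>s - t\<bar> < \<delta>2 \<Longrightarrow> norm (\<phi> s - \<phi> t - (s - t) *\<^sub>R d) \<le> e / (2 * (L + 1)) * \<bar>s - t\<bar>"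
      using \<phi>'[OF e1(2)] by blast
    obtain \<delta>3 where \<delta>3: "\<delta>3 > 0" "\<And>s. \<bar>s - t\<bar> < \<delta>3 \<Longrightarrow> dist (\<phi> s) (\<phi> t) < r"
      using cont r(1) unfolding continuous_at_eps_delta dist_real_def by meson
    define \<delta>4 where "\<delta>4 = r / (1 + norm d)"
    have pos: "1 + norm d > 0" using norm_ge_zero[of d] by linarith
    have \<delta>4: "\<delta>4 > 0" "\<delta>4 * norm d < r" using r(1) pos by (auto simp: \<delta>4_def field_simps)
    show "\<exists>\<delta>>0. \<forall>s. norm (s - t) < \<delta> \<longrightarrow> norm (V (\<phi> s) - V (\<phi> t) - a * (s - t)) \<le> e * norm (s - t)"
    proof (intro exI[of _ "min (min \<delta>1 \<delta>2) (min \<delta>3 \<delta>4)"] conjI allI impI)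
      fix s assume s: "norm (s - t) < min (min \<delta>1 \<delta>2) (min \<delta>3 \<delta>4)"
      have "norm ((s - t) *\<^sub>R d) \<le> \<delta>4 * norm d" using s by (auto intro!: mult_right_mono)
      then have mem: "\<phi> t + (s - t) *\<^sub>R d \<in> ball (\<phi> t) r" using \<delta>4(2) by (auto simp: dist_norm)
      have mem2: "\<phi> s \<in> ball (\<phi> t) r" using \<delta>3(2)[of s] s by (auto simp: dist_commute)
      have "\<bar>V (\<phi> s) - V (\<phi> t + (s - t) *\<^sub>R d)\<bar> \<le> L * norm (\<phi> s - \<phi> t - (s - t) *\<^sub>R d)"
        using lipschitz_onD[OF r(2) mem2 mem] by (simp add: dist_norm algebra_simps)
      also have "\<dots> \<le> L * (e / (2 * (L + 1)) * \<bar>s - t\<bar>)"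
        using \<delta>2(2)[of s] s L0 by (intro mult_left_mono) auto
      also have "\<dots> \<le> e / 2 * \<bar>s - t\<bar>"
      proof -
        have "L * (e / (2 * (L + 1))) \<le> e / 2" using L0 e by (simp add: field_simps)
        then have "L * (e / (2 * (L + 1))) * \<bar>s - t\<bar> \<le> e / 2 * \<bar>s - t\<bar>"
          by (rule mult_right_mono) simp
        then show ?thesis by (simp only: mult.assoc)
      qed
      finally have "\<bar>V (\<phi> s) - V (\<phi> t + (s - t) *\<^sub>R d)\<bar> \<le> e / 2 * \<bar>s - t\<bar>" .
      moreover have "\<bar>V (\<phi> t + (s - t) *\<^sub>R d) - V (\<phi> t) - (s - t) * a\<bar> \<le> e / 2 * \<bar>s - t\<bar>"
        using \<delta>1(2)[of "s - t"] s by auto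
      ultimately have "\<bar>V (\<phi> s) - V (\<phi> t) - a * (s - t)\<bar> \<le> e / 2 * \<bar>s - t\<bar> + e / 2 * \<bar>s - t\<bar>"
        unfolding mult.commute[of a] by linarith
      then show "norm (V (\<phi> s) - V (\<phi> t) - a * (s - t)) \<le> e * norm (s - t)" by simp
    qed (use \<delta>1 \<delta>2 \<delta>3 \<delta>4 in auto)
  qed
qed

section \<open>Caratheodory differential inclusions\<close>

text \<open>Upper semicontinuity keeps the nearest points of nearby values close to \<open>G u\<close>, lower
  semicontinuity keeps their norms from jumping up; together with the obtuse-angle property of
  the nearest point in \<open>G u\<close> this forces convergence.\<close>

lemma continuous_minimal_norm_selection:
  fixes G :: "'b::metric_space \<Rightarrow> 'a::euclidean_space set"
  assumes G: "\<And>u. G u \<noteq> {} \<and> compact (G u) \<and> convex (G u)" and cont: "cont_map G"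
  shows "continuous_on UNIV (\<lambda>u. closest_point (G u) 0)"
  unfolding continuous_on_iff
proof (intro ballI allI impI)
  fix u :: 'b and e :: real assume e: "0 < e"
  define s where "s u = closest_point (G u) 0" for u
  have cl: "closed (G u)" "G u \<noteq> {}" "convex (G u)" for u using G compact_imp_closed by auto
  have sG: "s u \<in> G u" for u unfolding s_def by (rule closest_point_in_set[OF cl(1,2)])
  have smin: "norm (s u) \<le> norm y" if "y \<in> G u" for u y
    using closest_point_le[OF cl(1) that, of 0] by (simp add: s_def dist_norm)
  define p where "p = s u"
  define \<eta> where "\<eta> = min 1 (min (e / 2) (e\<^sup>2 / (32 * (norm p + 1))))"
  have n1: "norm p + 1 > 0" using norm_ge_zero[of p] by linarith
  have "\<eta> \<le> min (e / 2) (e\<^sup>2 / (32 * (norm p + 1)))" unfolding \<eta>_def by (rule min.cobounded2)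
  also have "\<dots> \<le> e / 2" by (rule min.cobounded1)
  finally have "\<eta> \<le> e / 2" .
  moreover have "0 < \<eta>" "\<eta> \<le> 1" using e n1 by (auto simp: \<eta>_def)
  ultimately have \<eta>: "0 < \<eta>" "\<eta> \<le> 1" "\<eta> \<le> e / 2" by auto
  have "\<eta> \<le> e\<^sup>2 / (32 * (norm p + 1))" by (simp add: \<eta>_def)
  then have \<eta>4: "4 * \<eta> * (norm p + 1) \<le> e\<^sup>2 / 8" using n1 by (simp add: field_simps)
  define W where "W = (\<Union>q\<in>G u. ball q \<eta>)"
  have "open W" "G u \<subseteq> W" using \<eta>(1) by (auto simp: W_def)
  then obtain d1 where d1: "d1 > 0" "\<And>u'. dist u' u < d1 \<Longrightarrow> G u' \<subseteq> W"
    using cont unfolding cont_map_def usc_at_def by metis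
  have "open (ball p \<eta>)" "G u \<inter> ball p \<eta> \<noteq> {}" using sG[of u] \<eta>(1) by (auto simp: p_def)
  then obtain d2 where d2: "d2 > 0" "\<And>u'. dist u' u < d2 \<Longrightarrow> G u' \<inter> ball p \<eta> \<noteq> {}"
    using cont unfolding cont_map_def lsc_at_def by metis
  have "dist (s u') (s u) < e" if u': "dist u' u < min d1 d2" for u'
  proof -
    obtain q where q: "q \<in> G u" "dist q (s u') < \<eta>"
      using d1(2)[of u'] u' sG[of u'] by (auto simp: W_def)
    obtain y where y: "y \<in> G u'" "dist p y < \<eta>" using d2(2)[of u'] u' by auto
    have "norm y \<le> norm p + \<eta>" using y(2) norm_triangle_ineq2[of y p] by (simp add: dist_norm norm_minus_commute)
    then have "norm (s u') \<le> norm p + \<eta>" using smin[OF y(1)] by simp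
    moreover have "norm q \<le> norm (s u') + \<eta>" using q(2) norm_triangle_ineq2[of q "s u'"] by (simp add: dist_norm)
    ultimately have nq: "norm q \<le> norm p + 2 * \<eta>" by simp
    have "p \<bullet> q \<ge> p \<bullet> p"
      using closest_point_dot[OF cl(3,1) q(1), of 0] by (simp add: p_def s_def inner_diff_right)
    then have "(norm (q - p))\<^sup>2 \<le> (norm q)\<^sup>2 - (norm p)\<^sup>2"
      by (simp add: power2_norm_eq_inner inner_diff_left inner_diff_right inner_commute)
    also have "\<dots> \<le> (norm p + 2 * \<eta>)\<^sup>2 - (norm p)\<^sup>2"
      using nq by (simp add: power_mono)
    also have "\<dots> = 4 * \<eta> * (norm p + \<eta>)" by (simp add: power2_eq_square algebra_simps)
    also have "\<dots> \<le> 4 * \<eta> * (norm p + 1)" using \<eta> by (intro mult_left_mono) auto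
    also have "\<dots> < (e / 2)\<^sup>2"
    proof -
      have "(e / 2)\<^sup>2 = e\<^sup>2 / 4" by (simp add: power2_eq_square)
      moreover have "0 < e\<^sup>2" using e by simp
      ultimately show ?thesis using \<eta>4 by linarith
    qed
    finally have "norm (q - p) < e / 2" by (rule power_less_imp_less_base) (use e in simp)
    then have "dist q p < e / 2" by (simp add: dist_norm)
    then show ?thesis
      using dist_triangle[of "s u'" p q] q(2) \<eta>(3) by (simp add: p_def dist_commute)
  qed
  then show "\<exists>d>0. \<forall>u'\<in>UNIV. dist u' u < d \<longrightarrow> dist (closest_point (G u') 0) (closest_point (G u) 0) < e"
    using d1(1) d2(1) by (intro exI[of _ "min d1 d2"]) (auto simp: s_def)
qed

lemma bounded_measurable_integrable_on:
  fixes f :: "real \<Rightarrow> 'a::euclidean_space"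
  assumes "f \<in> borel_measurable lebesgue" "\<And>t. norm (f t) \<le> M"
  shows "f integrable_on {c..d}"
proof (rule measurable_bounded_by_integrable_imp_integrable)
  show "f \<in> borel_measurable (lebesgue_on {c..d})" using assms(1) by (rule measurable_restrict_space1)
  show "(\<lambda>_. M) integrable_on {c..d}" by (rule integrable_const_ivl)
qed (use assms(2) in auto)

lemma lipschitz_AE_vector_derivative:
  fixes f :: "real \<Rightarrow> 'a::euclidean_space"
  assumes L: "L-lipschitz_on {a..b} f"
  shows "AE t in lborel. a < t \<and> t < b \<longrightarrow> (\<exists>d. (f has_vector_derivative d) (at t))"
proof (cases "a \<le> b")
  case ab: True
  define c where "c t = max a (min b t)" for t :: real
  have "AE t in lborel. (\<lambda>t. f (c t) \<bullet> i) differentiable (at t)" if "i \<in> Basis" for i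
  proof (rule lipschitz_AE_differentiable, rule lipschitz_onI)
    fix s t :: real
    have "dist (f (c s) \<bullet> i) (f (c t) \<bullet> i) \<le> dist (f (c s)) (f (c t))"
      using Basis_le_norm[OF that, of "f (c s) - f (c t)"] by (simp add: dist_norm inner_diff_left)
    also have "\<dots> \<le> L * dist (c s) (c t)" using ab by (intro lipschitz_onD[OF L]) (auto simp: c_def)
    also have "\<dots> \<le> L * dist s t"
      using lipschitz_on_nonneg[OF L] by (intro mult_left_mono) (auto simp: c_def dist_real_def)
    finally show "dist (f (c s) \<bullet> i) (f (c t) \<bullet> i) \<le> L * dist s t" .
  qed (rule lipschitz_on_nonneg[OF L])
  then have "AE t in lborel. \<forall>i\<in>Basis. (\<lambda>t. f (c t) \<bullet> i) differentiable (at t)"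
    by (subst AE_ball_countable) (auto intro: countable_finite)
  then show ?thesis
  proof (eventually_elim, intro impI)
    fix t assume d: "\<forall>i\<in>Basis. (\<lambda>t. f (c t) \<bullet> i) differentiable (at t)" and t: "a < t \<and> t < b"
    then obtain D where D: "\<And>i. i \<in> Basis \<Longrightarrow> ((\<lambda>t. f (c t) \<bullet> i) has_real_derivative D i) (at t)"
      unfolding real_differentiable_def by metis
    have "((\<lambda>t. f (c t)) has_vector_derivative (\<Sum>i\<in>Basis. D i *\<^sub>R i)) (at t)"
      unfolding has_vector_derivative_def
      by (subst has_derivative_componentwise_within)
         (use D in \<open>auto simp: has_field_derivative_def mult_commute_abs\<close>)
    moreover have "f s = f (c s)" if "s \<in> {a<..<b}" for s using that by (simp add: c_def)
    ultimately have "(f has_vector_derivative (\<Sum>i\<in>Basis. D i *\<^sub>R i)) (at t)"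
      using t has_vector_derivative_transform_within_open[of "\<lambda>t. f (c t)" _ t "{a<..<b}" f] by auto
    then show "\<exists>d. (f has_vector_derivative d) (at t)" by blast
  qed
qed auto

text \<open>On each step the state argument stays at the node where the step began, so the velocity
  is a continuous selection composed with \<open>u\<close> and hence measurable. The point
  \<open>w\<close> is that node, and \<open>M * h\<close> bounds the distance travelled since
  then.\<close>

lemma euler_approximation:
  fixes H :: "'a::euclidean_space \<Rightarrow> 'b::euclidean_space \<Rightarrow> 'a set" and u :: "real \<Rightarrow> 'b"
  assumes vals: "\<And>x v. H x v \<noteq> {} \<and> compact (H x v) \<and> convex (H x v)"
    and cont: "\<And>x. cont_map (H x)"
    and u: "u \<in> borel_measurable lebesgue"
    and M: "\<And>x t f. f \<in> H x (u t) \<Longrightarrow> norm f \<le> M"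
    and h: "0 < h"
  obtains \<phi> x where "\<phi> \<in> borel_measurable lebesgue" "\<And>t. norm (\<phi> t) \<le> M"
    "\<And>t. a \<le> t \<Longrightarrow> \<exists>w. dist w (x t) \<le> M * h \<and> \<phi> t \<in> H w (u t)"
    "\<And>t. a \<le> t \<Longrightarrow> x t = y0 + integral {a..t} \<phi>"
proof -
  define sel where "sel x t = closest_point (H x (u t)) 0" for x t
  have selH: "sel x t \<in> H x (u t)" for x t
    unfolding sel_def using vals[of x "u t"] by (intro closest_point_in_set compact_imp_closed) auto
  have meas: "sel x \<in> borel_measurable lebesgue" for x
    unfolding sel_def
    by (rule borel_measurable_continuous_on[OF continuous_minimal_norm_selection[OF vals cont] u])
  define z where "z = rec_nat y0 (\<lambda>i zi. zi + integral {a + real i * h..a + real (Suc i) * h} (sel zi))"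
  have z0: "z 0 = y0" and zS: "z (Suc i) = z i + integral {a + real i * h..a + real (Suc i) * h} (sel (z i))" for i
    by (simp_all add: z_def)
  define idx where "idx t = nat \<lfloor>(t - a) / h\<rfloor>" for t
  define \<phi> where "\<phi> t = sel (z (idx t)) t" for t
  have \<phi>m: "\<phi> \<in> borel_measurable lebesgue"
    unfolding \<phi>_def
  proof (rule measurable_compose_countable)
    show "sel (z i) \<in> borel_measurable lebesgue" for i by (rule meas)
    have "idx \<in> measurable lborel (count_space UNIV)" unfolding idx_def by measurable
    then show "idx \<in> measurable lebesgue (count_space UNIV)" by (rule measurable_completion)
  qed
  have \<phi>M: "norm (\<phi> t) \<le> M" for t unfolding \<phi>_def by (rule M[OF selH])
  note \<phi>int = bounded_measurable_integrable_on[OF \<phi>m \<phi>M]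
  define x where "x t = y0 + integral {a..t} \<phi>" for t
  have inc: "x t = x s + integral {s..t} \<phi>" if "a \<le> s" "s \<le> t" for s t
    using Henstock_Kurzweil_Integration.integral_combine[OF that \<phi>int] by (simp add: x_def add.assoc)
  have xz: "x (a + real i * h) = z i" for i
  proof (induction i)
    case 0
    then show ?case by (simp add: x_def z0)
  next
    case (Suc i)
    have le: "a \<le> a + real i * h" "a + real i * h \<le> a + real (Suc i) * h" using h by (auto simp: algebra_simps)
    have "integral {a + real i * h..a + real (Suc i) * h} \<phi> = integral {a + real i * h..a + real (Suc i) * h} (sel (z i))"
    \<comment> \<open>The right end point is excepted because there \<open>idx\<close> already
      counts the next step.\<close>
    proof (rule integral_spike[of "{a + real (Suc i) * h}"])
      fix t assume t: "t \<in> {a + real i * h..a + real (Suc i) * h} - {a + real (Suc i) * h}"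
      then have "real i \<le> (t - a) / h" "(t - a) / h < real i + 1" using h by (auto simp: field_simps)
      then have "\<lfloor>(t - a) / h\<rfloor> = int i" by (simp add: floor_eq_iff)
      then show "sel (z i) t = \<phi> t" by (simp add: \<phi>_def idx_def)
    qed simp
    then show ?case using inc[OF le] Suc zS by simp
  qed
  have close: "\<exists>w. dist w (x t) \<le> M * h \<and> \<phi> t \<in> H w (u t)" if t: "a \<le> t" for t
  proof (intro exI conjI)
    show "\<phi> t \<in> H (z (idx t)) (u t)" unfolding \<phi>_def by (rule selH)
    define s where "s = a + real (idx t) * h"
    have "0 \<le> (t - a) / h" using t h by simp
    then have "real (idx t) \<le> (t - a) / h" "(t - a) / h < real (idx t) + 1" unfolding idx_def by linarith+
    then have s: "a \<le> s" "s \<le> t" "t - s \<le> h" using h by (auto simp: s_def field_simps)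
    have "norm (integral {s..t} \<phi>) \<le> M * (t - s)"
      using has_integral_bound_real[OF order_trans[OF norm_ge_zero \<phi>M] finite.emptyI integrable_integral[OF \<phi>int], of s t] \<phi>M s(2)
      by simp
    also have "\<dots> \<le> M * h" using s order_trans[OF norm_ge_zero \<phi>M] by (intro mult_left_mono) auto
    finally show "dist (z (idx t)) (x t) \<le> M * h"
      using inc[OF s(1,2)] xz[of "idx t"] by (simp add: s_def dist_norm)
  qed
  show thesis by (rule that[OF \<phi>m \<phi>M close x_def])
qed

text \<open>The limit of Euler polygons is tested against countably many directions: along each of them
  the increment of the limit is at most the integral of the tail suprema of the approximate
  velocities, so Lebesgue differentiation bounds the velocity of the limit. This replaces
  weak compactness in \<open>L\<^sup>1\<close> and Mazur's lemma.\<close>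

theorem caratheodory_inclusion_exists:
  fixes H :: "'a::euclidean_space \<Rightarrow> 'b::euclidean_space \<Rightarrow> 'a set" and u :: "real \<Rightarrow> 'b"
  assumes vals: "\<And>x v. H x v \<noteq> {} \<and> compact (H x v) \<and> convex (H x v)"
    and usc: "\<And>v. usc_map (\<lambda>x. H x v)"
    and cont: "\<And>x. cont_map (H x)"
    and u: "u \<in> borel_measurable lebesgue"
    and M: "\<And>x t f. f \<in> H x (u t) \<Longrightarrow> norm f \<le> M"
    and ab: "a \<le> b"
  obtains y where "M-lipschitz_on {a..b} y" "y a = y0"
    "AE t in lborel. a < t \<and> t < b \<longrightarrow> (\<exists>d. (y has_vector_derivative d) (at t) \<and> d \<in> H (y t) (u t))"
proof -
  have M0: "0 \<le> M" using vals[of 0 "u 0"] M by (metis all_not_in_conv norm_ge_zero order_trans)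
  have "\<exists>\<phi> x. \<phi> \<in> borel_measurable lebesgue \<and> (\<forall>t. norm (\<phi> t) \<le> M) \<and>
      (\<forall>t\<ge>a. \<exists>w. dist w (x t) \<le> M * inverse (real (Suc n)) \<and> \<phi> t \<in> H w (u t)) \<and>
      (\<forall>t\<ge>a. x t = y0 + integral {a..t} \<phi>)" for n
  proof -
    have h: "0 < inverse (real (Suc n))" by simp
    show ?thesis
      by (rule euler_approximation[where H=H and h="inverse (real (Suc n))" and a=a and ?y0.0=y0, OF vals cont u _ h])
        (use M in blast)+
  qed
  then obtain \<phi> x where \<phi>m: "\<And>n. \<phi> n \<in> borel_measurable lebesgue" and \<phi>M: "\<And>n t. norm (\<phi> n t) \<le> M"
    and \<phi>H: "\<And>n t. a \<le> t \<Longrightarrow> \<exists>w. dist w (x n t) \<le> M * inverse (real (Suc n)) \<and> \<phi> n t \<in> H w (u t)"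
    and x: "\<And>n t. a \<le> t \<Longrightarrow> x n t = y0 + integral {a..t} (\<phi> n)"
    by metis
  note \<phi>int = bounded_measurable_integrable_on[OF \<phi>m \<phi>M]
  have inc: "x n t - x n s = integral {s..t} (\<phi> n)" if "a \<le> s" "s \<le> t" for n s t
    using Henstock_Kurzweil_Integration.integral_combine[OF that \<phi>int, of n] that by (simp add: x algebra_simps)
  have xlip: "M-lipschitz_on {a..b} (x n)" for n
  proof (rule lipschitz_on_leI)
    fix s t assume st: "s \<in> {a..b}" "t \<in> {a..b}" "s \<le> t"
    have "norm (integral {s..t} (\<phi> n)) \<le> M * (t - s)"
      using has_integral_bound_real[OF M0 finite.emptyI integrable_integral[OF \<phi>int[of n]], of s t] \<phi>M st(3) by simp
    then show "dist (x n s) (x n t) \<le> M * dist s t"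
      using inc[of s t n] st by (simp add: dist_norm norm_minus_commute[of "x n s"])
  qed (rule M0)
  have xa: "x n a = y0" for n by (simp add: x)
  obtain y k where "continuous_on {a..b} y" and k: "strict_mono (k :: nat \<Rightarrow> nat)"
    and unif: "\<And>e. 0 < e \<Longrightarrow> \<exists>N. \<forall>n t. n \<ge> N \<and> t \<in> {a..b} \<longrightarrow> norm (x (k n) t - y t) < e"
  proof (rule Arzela_Ascoli[of "{a..b}" x "norm y0 + M * (b - a)"])
    show "norm (x n t) \<le> norm y0 + M * (b - a)" if t: "t \<in> {a..b}" for n t
    proof -
      have "dist (x n t) (x n a) \<le> M * dist t a" using t ab by (intro lipschitz_onD[OF xlip]) auto
      also have "\<dots> \<le> M * (b - a)" using t M0 by (intro mult_left_mono) (auto simp: dist_real_def)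
      finally show ?thesis using norm_triangle_ineq2[of "x n t" y0] by (simp add: xa dist_norm)
    qed
    show "\<exists>d>0. \<forall>n s. s \<in> {a..b} \<and> norm (t - s) < d \<longrightarrow> norm (x n t - x n s) < e"
      if t: "t \<in> {a..b}" and e: "0 < e" for t e
    proof (intro exI[of _ "e / (M + 1)"] conjI allI impI)
      fix n s assume s: "s \<in> {a..b} \<and> norm (t - s) < e / (M + 1)"
      have "norm (x n t - x n s) \<le> M * norm (t - s)"
        using lipschitz_onD[OF xlip t, of s n] s by (simp add: dist_norm)
      also have "\<dots> \<le> M * (e / (M + 1))" using s M0 by (intro mult_left_mono) auto
      also have "\<dots> < e" using e M0 by (simp add: field_simps)
      finally show "norm (x n t - x n s) < e" .
    qed (use e M0 in auto)
  qed auto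
  have lim: "(\<lambda>n. x (k n) t) \<longlonglongrightarrow> y t" if "t \<in> {a..b}" for t
    unfolding LIMSEQ_iff using unif that by blast
  have ylip: "M-lipschitz_on {a..b} y"
  proof (rule lipschitz_onI)
    fix s t assume st: "s \<in> {a..b}" "t \<in> {a..b}"
    show "dist (y s) (y t) \<le> M * dist s t"
    proof (rule LIMSEQ_le_const2)
      show "(\<lambda>n. dist (x (k n) s) (x (k n) t)) \<longlonglongrightarrow> dist (y s) (y t)" by (intro tendsto_dist lim st)
      show "\<exists>N. \<forall>n\<ge>N. dist (x (k n) s) (x (k n) t) \<le> M * dist s t" using lipschitz_onD[OF xlip] st by blast
    qed
  qed (rule M0)
  have ya: "y a = y0"
    using lim[of a] ab LIMSEQ_unique[OF _ tendsto_const] by (simp add: xa)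
  \<comment> \<open>A bounded measurable majorant of all late velocities in direction
    \<open>p\<close>, independent of the index, so it survives the passage to the limit that the
    velocities themselves need not survive.\<close>
  define S where "S p m t = (SUP j\<in>{m..}. p \<bullet> \<phi> (k j) t)" for p :: 'a and m :: nat and t :: real
  have pb: "\<bar>p \<bullet> \<phi> n t\<bar> \<le> norm p * M" for p n t
    using Cauchy_Schwarz_ineq2[of p "\<phi> n t"] \<phi>M[of n t] by (meson mult_left_mono norm_ge_zero order_trans)
  have bdd: "bdd_above ((\<lambda>j. p \<bullet> \<phi> (k j) t) ` {m..})" for p m t
    using pb by (intro bdd_aboveI2[of _ _ "norm p * M"]) (simp add: abs_le_iff)
  have le_S: "p \<bullet> \<phi> (k j) t \<le> S p m t" if "m \<le> j" for p m j t
    unfolding S_def using that by (intro cSUP_upper bdd) auto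
  have S_le: "S p m t \<le> c" if "\<And>j. m \<le> j \<Longrightarrow> p \<bullet> \<phi> (k j) t \<le> c" for p m t c
    unfolding S_def using that by (intro cSUP_least) auto
  have Sm: "S p m \<in> borel_measurable lebesgue" for p m
    unfolding S_def using bdd \<phi>m by (intro borel_measurable_cSUP) auto
  have Sb: "norm (S p m t) \<le> norm p * M" for p m t
  proof -
    have "S p m t \<le> norm p * M" using pb by (intro S_le) (simp add: abs_le_iff)
    moreover have "- (norm p * M) \<le> S p m t" using le_S[of m m p t] pb[of p "k m" t] by (simp add: abs_le_iff)
    ultimately show ?thesis by (simp add: abs_le_iff)
  qed
  note Sint = bounded_measurable_integrable_on[OF Sm Sb]
  have incS: "p \<bullet> (y t - y s) \<le> integral {s..t} (S p m)" if st: "a \<le> s" "s \<le> t" "t \<le> b" for p m s t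
  proof (rule LIMSEQ_le_const2)
    show "(\<lambda>j. p \<bullet> (x (k j) t - x (k j) s)) \<longlonglongrightarrow> p \<bullet> (y t - y s)"
      using st by (intro tendsto_intros lim) auto
    have "p \<bullet> (x (k j) t - x (k j) s) \<le> integral {s..t} (S p m)" if "m \<le> j" for j
    proof -
      have "((\<lambda>r. p \<bullet> \<phi> (k j) r) has_integral p \<bullet> integral {s..t} (\<phi> (k j))) {s..t}"
        using has_integral_linear[OF integrable_integral[OF \<phi>int] bounded_linear_inner_right[of p]] by (simp add: o_def)
      then have "p \<bullet> integral {s..t} (\<phi> (k j)) \<le> integral {s..t} (S p m)"
        by (rule has_integral_le[OF _ integrable_integral[OF Sint]]) (use le_S[OF that] in auto)
      then show ?thesis using inc[OF st(1,2)] by simp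
    qed
    then show "\<exists>N. \<forall>j\<ge>N. p \<bullet> (x (k j) t - x (k j) s) \<le> integral {s..t} (S p m)" by blast
  qed
  \<comment> \<open>Countability gives one null set of times for all test directions and all
    tails.\<close>
  obtain Q :: "'a set" where Q: "countable Q" "\<And>U. open U \<Longrightarrow> U \<noteq> {} \<Longrightarrow> \<exists>d\<in>Q. d \<in> U"
    using countable_dense_setE by blast
  have avg: "AE t in lborel. \<forall>p\<in>Q. \<forall>m. ((\<lambda>h. integral {t..t+h} (S p m) / h) \<longlongrightarrow> S p m t) (at_right 0)"
    by (subst AE_ball_countable[OF Q(1)], intro ballI, subst AE_all_countable, intro allI AE_right_average Sint)
  have "AE t in lborel. a < t \<and> t < b \<longrightarrow> (\<exists>d. (y has_vector_derivative d) (at t) \<and> d \<in> H (y t) (u t))"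
    using avg lipschitz_AE_vector_derivative[OF ylip]
  proof (eventually_elim, intro impI)
    fix t assume A: "\<forall>p\<in>Q. \<forall>m. ((\<lambda>h. integral {t..t+h} (S p m) / h) \<longlongrightarrow> S p m t) (at_right 0)"
      and B: "a < t \<and> t < b \<longrightarrow> (\<exists>d. (y has_vector_derivative d) (at t))" and t: "a < t \<and> t < b"
    obtain d where d: "(y has_vector_derivative d) (at t)" using B t by blast
    have quot: "((\<lambda>h. (y (t + h) - y t) /\<^sub>R h) \<longlongrightarrow> d) (at_right 0)"
    proof -
      have "((\<lambda>h. norm (y (t + h) - y t - h *\<^sub>R d) / norm h) \<longlongrightarrow> 0) (at 0)"
        using d by (simp add: has_vector_derivative_def has_derivative_at)
      then have "((\<lambda>h. norm (y (t + h) - y t - h *\<^sub>R d) / norm h) \<longlongrightarrow> 0) (at_right 0)"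
        by (rule filterlim_mono[OF _ order_refl at_le]) simp
      then have "((\<lambda>h. norm ((y (t + h) - y t) /\<^sub>R h - d)) \<longlongrightarrow> 0) (at_right 0)"
      proof (rule Lim_transform_eventually)
        have "norm (y (t + h) - y t - h *\<^sub>R d) / norm h = norm ((y (t + h) - y t) /\<^sub>R h - d)" if "0 < h" for h
        proof -
          have "(y (t + h) - y t) /\<^sub>R h - d = (y (t + h) - y t - h *\<^sub>R d) /\<^sub>R h"
            using that by (simp add: scaleR_diff_right)
          then show ?thesis by (simp add: divide_inverse mult.commute)
        qed
        then show "\<forall>\<^sub>F h in at_right 0. norm (y (t + h) - y t - h *\<^sub>R d) / norm h = norm ((y (t + h) - y t) /\<^sub>R h - d)"
          unfolding eventually_at_right_field by (intro exI[of _ 1]) auto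
      qed
      then show ?thesis by (rule Lim_null[THEN iffD2, OF tendsto_norm_zero_cancel])
    qed
    have pd: "p \<bullet> d \<le> S p m t" if p: "p \<in> Q" for p m
    proof (rule tendsto_le)
      show "((\<lambda>h. integral {t..t+h} (S p m) / h) \<longlongrightarrow> S p m t) (at_right 0)" using A p by blast
      show "((\<lambda>h. p \<bullet> ((y (t + h) - y t) /\<^sub>R h)) \<longlongrightarrow> p \<bullet> d) (at_right 0)" by (intro tendsto_intros quot)
      show "\<forall>\<^sub>F h in at_right 0. p \<bullet> ((y (t + h) - y t) /\<^sub>R h) \<le> integral {t..t+h} (S p m) / h"
        unfolding eventually_at_right_field
      proof (intro exI[of _ "b - t"] conjI allI impI)
        fix h assume h: "0 < h" "h < b - t"
        then show "p \<bullet> ((y (t + h) - y t) /\<^sub>R h) \<le> integral {t..t+h} (S p m) / h"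
          using incS[of t "t + h" p m] t by (simp add: divide_inverse mult.commute)
      qed (use t in auto)
    qed simp
    have "d \<in> H (y t) (u t)"
    proof (rule ccontr)
      assume "d \<notin> H (y t) (u t)"
      then obtain q c where qc: "q \<bullet> d < c" "\<And>f. f \<in> H (y t) (u t) \<Longrightarrow> c < q \<bullet> f"
        using separating_hyperplane_closed_point[of "H (y t) (u t)" d] vals[of "y t" "u t"] compact_imp_closed by metis
      \<comment> \<open>\<open>pd\<close> bounds \<open>d\<close> from above while the separation
        puts \<open>d\<close> on the lower side, so the test direction \<open>p\<close> approximates
        \<open>- q\<close>. The gap is divided among the errors at \<open>d\<close>
        (\<open>norm d\<close>), at the members of the value set (\<open>M\<close>), and a strict
        slack (1).\<close>
      define e where "e = (c - q \<bullet> d) / (norm d + M + 1)"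
      have n: "norm d + M + 1 > 0" using M0 norm_ge_zero[of d] by linarith
      have e: "e > 0" using qc(1) n by (simp add: e_def)
      have "e * (norm d + M + 1) = c - q \<bullet> d" using n by (simp add: e_def)
      then have eq: "e * norm d + e * M + e = c - q \<bullet> d" by (simp add: distrib_left)
      obtain p where p: "p \<in> Q" "norm (p + q) < e"
        using Q(2)[of "ball (- q) e"] e by (force simp: dist_norm norm_minus_commute)
      define C where "C = - c + e * M"
      have dC: "C < p \<bullet> d"
      proof -
        have "\<bar>(p + q) \<bullet> d\<bar> \<le> e * norm d"
          using Cauchy_Schwarz_ineq2[of "p + q" d] p(2) by (meson less_imp_le mult_right_mono norm_ge_zero order_trans)
        then show ?thesis using eq e by (simp add: C_def inner_add_left abs_le_iff)
      qed
      have "H (y t) (u t) \<subseteq> {f. p \<bullet> f < C}"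
      proof
        fix f assume f: "f \<in> H (y t) (u t)"
        have "\<bar>(p + q) \<bullet> f\<bar> \<le> e * M"
          using Cauchy_Schwarz_ineq2[of "p + q" f] p(2) M[OF f] e
          by (meson less_imp_le mult_mono norm_ge_zero order_trans)
        then show "f \<in> {f. p \<bullet> f < C}" using qc(2)[OF f] by (simp add: C_def inner_add_left abs_le_iff)
      qed
      moreover have "open {f. p \<bullet> f < C}" by (rule open_halfspace_lt)
      ultimately obtain r where r: "r > 0" "\<And>w. dist w (y t) < r \<Longrightarrow> H w (u t) \<subseteq> {f. p \<bullet> f < C}"
        using usc[of "u t"] unfolding usc_map_def usc_at_def by metis
      obtain N1 where "\<forall>n s. n \<ge> N1 \<and> s \<in> {a..b} \<longrightarrow> norm (x (k n) s - y s) < r / 2"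
        using unif[OF half_gt_zero[OF r(1)]] by blast
      then have N1: "norm (x (k j) t - y t) < r / 2" if "j \<ge> N1" for j using that t by auto
      have "(\<lambda>n. M * inverse (real (Suc n))) \<longlonglongrightarrow> M * 0" by (intro tendsto_intros LIMSEQ_inverse_real_of_nat)
      then have "\<forall>\<^sub>F n in sequentially. M * inverse (real (Suc n)) < r / 2"
        using r(1) by (intro order_tendstoD(2)[of _ 0]) auto
      then obtain N2 where N2: "\<And>n. n \<ge> N2 \<Longrightarrow> M * inverse (real (Suc n)) < r / 2"
        by (auto simp: eventually_sequentially)
      have "S p (max N1 N2) t \<le> C"
      proof (rule S_le)
        fix j assume j: "max N1 N2 \<le> j"
        obtain w where w: "dist w (x (k j) t) \<le> M * inverse (real (Suc (k j)))" "\<phi> (k j) t \<in> H w (u t)"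
          using \<phi>H[of t "k j"] t by auto
        have "N2 \<le> k j" using j seq_suble[OF k, of j] by simp
        then have "dist w (x (k j) t) < r / 2" using w(1) N2 by (meson le_less_trans)
        moreover have "dist (x (k j) t) (y t) < r / 2" using N1[of j] j by (simp add: dist_norm)
        ultimately have "dist w (y t) < r" using dist_triangle_half_l dist_commute by metis
        then show "p \<bullet> \<phi> (k j) t \<le> C" using r(2) w(2) by force
      qed
      then show False using pd[OF p(1), of "max N1 N2"] dC by simp
    qed
    with d show "\<exists>d. (y has_vector_derivative d) (at t) \<and> d \<in> H (y t) (u t)" by blast
  qed
  with ylip ya show thesis by (rule that)
qed

section \<open>Comparison functions\<close>

lemma class_K_inf_inverse:
  assumes "class_K_inf \<alpha>"
  obtains \<beta> where "class_K \<beta>" "\<And>s. 0 \<le> s \<Longrightarrow> \<beta> (\<alpha> s) = s" "\<And>v. 0 \<le> v \<Longrightarrow> \<alpha> (\<beta> v) = v" "\<And>v. 0 \<le> v \<Longrightarrow> 0 \<le> \<beta> v"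
proof -
  have cont: "continuous_on {0..} \<alpha>" and mono: "strict_mono_on {0..} \<alpha>" and zero: "\<alpha> 0 = 0"
    and top: "filterlim \<alpha> at_top at_top"
    using assms by (auto simp: class_K_inf_def class_K_def)
  have less: "\<alpha> s < \<alpha> t \<longleftrightarrow> s < t" if "0 \<le> s" "0 \<le> t" for s t
    using strict_mono_on_less[OF mono] that by simp
  have surj: "\<exists>s\<ge>0. \<alpha> s = v" if v: "0 \<le> v" for v
  proof -
    have "\<forall>\<^sub>F s in at_top. v \<le> \<alpha> s \<and> 0 \<le> s"
      using filterlim_at_top[THEN iffD1, OF top] eventually_ge_at_top by (intro eventually_conj) auto
    then obtain s where "v \<le> \<alpha> s" "0 \<le> s" by (auto dest: eventually_happens)
    then show ?thesis
      using IVT'[of \<alpha> 0 v s] zero v continuous_on_subset[OF cont] by auto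
  qed
  define \<beta> where "\<beta> v = (SOME s. 0 \<le> s \<and> \<alpha> s = v)" for v
  have \<beta>: "0 \<le> \<beta> v" "\<alpha> (\<beta> v) = v" if "0 \<le> v" for v
    using someI_ex[of "\<lambda>s. 0 \<le> s \<and> \<alpha> s = v"] surj[OF that] by (auto simp: \<beta>_def)
  have \<alpha>0: "0 \<le> \<alpha> s" if "0 \<le> s" for s
    using less[of 0 s] zero that by (cases "s = 0") auto
  have inv: "\<beta> (\<alpha> s) = s" if "0 \<le> s" for s
    using \<beta>[OF \<alpha>0[OF that]] less[of s "\<beta> (\<alpha> s)"] less[of "\<beta> (\<alpha> s)" s] that by force
  have bless: "\<beta> v < \<beta> w \<longleftrightarrow> v < w" if "0 \<le> v" "0 \<le> w" for v w
    using less[OF \<beta>(1)[OF that(1)] \<beta>(1)[OF that(2)]] \<beta>(2) that by simp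
  have "continuous_on {0..} \<beta>"
    unfolding continuous_on_iff
  proof (intro ballI allI impI)
    fix v e :: real assume v: "v \<in> {0..}" and e: "0 < e"
    define s where "s = \<beta> v"
    have s: "0 \<le> s" "\<alpha> s = v" using \<beta>[of v] v by (auto simp: s_def)
    \<comment> \<open>If \<open>s - e\<close> is negative, the lower estimate is automatic from
      \<open>0 \<le> \<beta> w\<close>; any value below \<open>v\<close> will do, here
      \<open>- 1\<close>.\<close>
    define l where "l = (if e \<le> s then \<alpha> (s - e) else - 1)"
    have l: "l < v" using less[of "s - e" s] s e v by (auto simp: l_def)
    have u: "v < \<alpha> (s + e)" using less[of s "s + e"] s e by simp
    show "\<exists>d>0. \<forall>w\<in>{0..}. dist w v < d \<longrightarrow> dist (\<beta> w) (\<beta> v) < e"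
    proof (intro exI[of _ "min (v - l) (\<alpha> (s + e) - v)"] conjI ballI impI)
      fix w assume w: "w \<in> {0..}" "dist w v < min (v - l) (\<alpha> (s + e) - v)"
      then have lw: "l < w" "w < \<alpha> (s + e)" by (auto simp: dist_real_def)
      have "\<beta> w < s + e"
        using bless[of w "\<alpha> (s + e)"] w lw inv[of "s + e"] s e \<alpha>0[of "s + e"] by simp
      moreover have "s - e < \<beta> w"
      proof (cases "e \<le> s")
        case True
        then show ?thesis using bless[of "\<alpha> (s - e)" w] w lw inv[of "s - e"] \<alpha>0[of "s - e"] by (simp add: l_def)
      next
        case False
        then show ?thesis using \<beta>(1)[of w] w by simp
      qed
      ultimately show "dist (\<beta> w) (\<beta> v) < e" by (simp add: dist_real_def s_def[symmetric] abs_less_iff)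
    qed (use l u in simp)
  qed
  moreover have "strict_mono_on {0..} \<beta>" using bless by (auto simp: strict_mono_on_def)
  ultimately have "class_K \<beta>" using inv[of 0] zero by (simp add: class_K_def)
  then show thesis by (rule that[OF _ inv \<beta>(2) \<beta>(1)])
qed

section \<open>Order properties and composition of comparison functions\<close>

lemma class_K_nonneg: "class_K \<alpha> \<Longrightarrow> 0 \<le> s \<Longrightarrow> 0 \<le> \<alpha> s"
  unfolding class_K_def by (metis atLeast_iff order.refl strict_mono_on_leD)

lemma class_K_le_iff: "class_K \<alpha> \<Longrightarrow> 0 \<le> s \<Longrightarrow> 0 \<le> t \<Longrightarrow> \<alpha> s \<le> \<alpha> t \<longleftrightarrow> s \<le> t"
  unfolding class_K_def by (metis atLeast_iff linorder_not_le strict_mono_onD strict_mono_on_leD)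

lemma class_K_compose:
  assumes a: "class_K a" and b: "class_K b"
  shows "class_K (\<lambda>s. a (b s))"
  unfolding class_K_def
proof (intro conjI)
  show "continuous_on {0..} (\<lambda>s. a (b s))"
    using a b class_K_nonneg[OF b]
    by (intro continuous_on_compose2[of "{0..}" a "{0..}" b]) (auto simp: class_K_def)
  show "strict_mono_on {0..} (\<lambda>s. a (b s))"
    using a b class_K_nonneg[OF b] by (auto simp: class_K_def strict_mono_on_def)
qed (use a b in \<open>auto simp: class_K_def\<close>)

lemma class_KL_compose:
  assumes \<beta>: "class_KL \<beta>" and a: "class_K a" and b: "class_K b"
  shows "class_KL (\<lambda>s t. a (\<beta> (b s) t))"
  unfolding class_KL_def
proof (intro conjI allI impI)
  have K: "class_K (\<lambda>s. \<beta> s t)" if "0 \<le> t" for t using \<beta> that by (auto simp: class_KL_def)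
  have \<beta>0: "0 \<le> \<beta> s t" if "0 \<le> s" "0 \<le> t" for s t using class_K_nonneg[OF K] that by simp
  have b0: "0 \<le> b s" if "0 \<le> s" for s using class_K_nonneg[OF b] that .
  have ca: "continuous_on {0..} a" and cb: "continuous_on {0..} b" using a b by (auto simp: class_K_def)
  show "continuous_on ({0..} \<times> {0..}) (\<lambda>(s, t). a (\<beta> (b s) t))"
  proof -
    have "continuous_on ({0..} \<times> {0..}) (\<lambda>z. (case (b (fst z), snd z) of (s, t) \<Rightarrow> \<beta> s t))"
    proof (rule continuous_on_compose2[where g="\<lambda>(s, t). \<beta> s t"])
      show "continuous_on ({0..} \<times> {0..}) (\<lambda>(s, t). \<beta> s t)" using \<beta> by (simp add: class_KL_def)
      have f: "continuous_on ({0..} \<times> {0..}) (\<lambda>z :: real \<times> real. fst z)" by (intro continuous_intros)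
      have bf: "continuous_on ({0..} \<times> {0..}) (\<lambda>z :: real \<times> real. b (fst z))"
        by (rule continuous_on_compose2[OF cb f]) auto
      show "continuous_on ({0..} \<times> {0..}) (\<lambda>z :: real \<times> real. (b (fst z), snd z))"
        by (intro continuous_on_Pair bf continuous_on_snd continuous_on_id)
      show "(\<lambda>z. (b (fst z), snd z)) ` ({0..} \<times> {0..}) \<subseteq> {0..} \<times> {0..}" by (auto intro!: b0)
    qed
    then have c: "continuous_on ({0..} \<times> {0..}) (\<lambda>z. \<beta> (b (fst z)) (snd z))" by simp
    have "continuous_on ({0..} \<times> {0..}) (\<lambda>z. a (\<beta> (b (fst z)) (snd z)))"
      by (rule continuous_on_compose2[OF ca c]) (auto intro!: b0 \<beta>0)
    then show ?thesis by (simp add: case_prod_unfold)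
  qed
  fix t :: real assume t: "0 \<le> t"
  show "class_K (\<lambda>s. a (\<beta> (b s) t))" by (rule class_K_compose[OF a class_K_compose[OF K[OF t] b]])
next
  fix s t1 t2 :: real assume s: "0 \<le> s" and t: "0 \<le> t1" "t1 \<le> t2"
  have K: "class_K (\<lambda>s. \<beta> s t)" if "0 \<le> t" for t using \<beta> that by (auto simp: class_KL_def)
  have "\<beta> (b s) t2 \<le> \<beta> (b s) t1" using \<beta> s t class_K_nonneg[OF b s] by (auto simp: class_KL_def)
  then show "a (\<beta> (b s) t2) \<le> a (\<beta> (b s) t1)"
    using class_K_le_iff[OF a] class_K_nonneg[OF K] class_K_nonneg[OF b s] t by simp
next
  fix s :: real assume s: "0 \<le> s"
  have K: "class_K (\<lambda>s. \<beta> s t)" if "0 \<le> t" for t using \<beta> that by (auto simp: class_KL_def)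
  have lim: "((\<lambda>t. \<beta> (b s) t) \<longlongrightarrow> 0) at_top" using \<beta> class_K_nonneg[OF b s] by (auto simp: class_KL_def)
  have "\<forall>\<^sub>F t in at_top. \<beta> (b s) t \<in> {0..}"
    using eventually_ge_at_top[of 0]
    by eventually_elim (use class_K_nonneg[OF K] class_K_nonneg[OF b s] in auto)
  then have "((\<lambda>t. a (\<beta> (b s) t)) \<longlongrightarrow> a 0) at_top"
    using continuous_on_tendsto_compose[of "{0..}" a "\<lambda>t. \<beta> (b s) t" 0 at_top] a lim
    by (auto simp: class_K_def)
  then show "((\<lambda>t. a (\<beta> (b s) t)) \<longlongrightarrow> 0) at_top" using a by (simp add: class_K_def)
qed

text \<open>The lower bound 1 on the derivative makes \<open>K\<close> unbounded in both directions,
  hence onto, and its inverse 1-Lipschitz.\<close>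

lemma continuous_ge_1_antiderivative:
  fixes g :: "real \<Rightarrow> real"
  assumes g: "continuous_on UNIV g" and ge: "\<And>z. 1 \<le> g z"
  obtains K J where "\<And>z. (K has_real_derivative g z) (at z)" "\<And>z. J (K z) = z" "\<And>w. K (J w) = w"
    "strict_mono K" "strict_mono J" "continuous_on UNIV J"
proof -
  define K where "K u = (LBINT y=ereal 0..ereal u. g y)" for u :: real
  have der: "(K has_real_derivative g z) (at z)" for z
  proof -
    define n where "n = \<bar>z\<bar> + 1"
    have "(K has_vector_derivative g z) (at z within {-n..n})"
      unfolding K_def
      by (rule interval_integral_FTC2) (auto simp: n_def intro: continuous_on_subset[OF g])
    moreover have "z \<in> interior {-n..n}" unfolding n_def interior_atLeastAtMost_real by auto
    ultimately show ?thesis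
      unfolding has_real_derivative_iff_has_vector_derivative by (metis at_within_interior)
  qed
  have grow: "y - x \<le> K y - K x" if "x \<le> y" for x y
  proof -
    have "K x - x \<le> K y - y"
      by (rule DERIV_nonneg_imp_nondecreasing[OF that])
         (use ge in \<open>force intro!: derivative_eq_intros der exI\<close>)
    then show ?thesis by simp
  qed
  have sm: "strict_mono K" using grow by (intro strict_monoI) (smt (verit))
  have cK: "continuous_on UNIV K" using der by (meson DERIV_isCont continuous_at_imp_continuous_on)
  have surj: "\<exists>z. K z = w" for w
  proof -
    define a where "a = - \<bar>w - K 0\<bar>" define b where "b = \<bar>w - K 0\<bar>"
    have "K a \<le> w" "w \<le> K b" using grow[of a 0] grow[of 0 b] unfolding a_def b_def by linarith+
    then show ?thesis
      using IVT'[of K a w b] continuous_on_subset[OF cK] by (force simp: a_def b_def)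
  qed
  define J where "J = inv K"
  have KJ: "K (J w) = w" for w unfolding J_def using surj[of w] by (metis f_inv_into_f rangeI)
  have JK: "J (K z) = z" for z unfolding J_def using sm by (simp add: strict_mono_imp_inj_on)
  have smJ: "strict_mono J" by (rule strict_monoI) (metis KJ sm strict_mono_less)
  have lipJ: "1-lipschitz_on UNIV J"
  proof (rule lipschitz_onI)
    have "\<bar>J x - J y\<bar> \<le> \<bar>x - y\<bar>" for x y
      using grow[of "J x" "J y"] grow[of "J y" "J x"] KJ by (cases "J x \<le> J y") auto
    then show "dist (J x) (J y) \<le> 1 * dist x y" for x y by (simp add: dist_real_def)
  qed simp
  show thesis
    by (rule that[OF der JK KJ sm smJ lipschitz_on_continuous_on[OF lipJ]]) 
qed

text \<open>Here \<open>\<beta> s t\<close> is the value at time \<open>t\<close> of the solution of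
  \<open>v' = - r v\<close> starting at \<open>s\<close>. With \<open>z = ln v\<close> the equation
  reads \<open>z' = - 1 / g z\<close>, and \<open>r v \<le> v\<close> says exactly that
  \<open>g \<ge> 1\<close>. So the flow exists for all times, stays positive, and is a translation
  in the coordinate \<open>K\<close>.\<close>

lemma KL_comparison_function:
  fixes r :: "real \<Rightarrow> real"
  assumes cont: "continuous_on {0<..} r" and r: "\<And>v. 0 < v \<Longrightarrow> 0 < r v" "\<And>v. 0 < v \<Longrightarrow> r v \<le> v"
  obtains G \<beta> where "\<And>v. 0 < v \<Longrightarrow> (G has_real_derivative 1 / r v) (at v)" "class_KL \<beta>"
    "\<And>v s t. 0 < v \<Longrightarrow> 0 < s \<Longrightarrow> G v \<le> G s - t \<Longrightarrow> v \<le> \<beta> s t"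
proof -
  define g where "g z = exp z / r (exp z)" for z
  have cg: "continuous_on UNIV g"
    unfolding g_def using r(1)
    by (intro continuous_intros continuous_on_compose2[OF cont]) (auto simp: less_imp_neq[symmetric])
  have ge: "1 \<le> g z" for z using r[of "exp z"] by (simp add: g_def)
  obtain K J where K: "\<And>z. (K has_real_derivative g z) (at z)" "\<And>z. J (K z) = z" "\<And>w. K (J w) = w"
    "strict_mono K" "strict_mono J" "continuous_on UNIV J"
    using continuous_ge_1_antiderivative[OF cg ge] by metis
  define G where "G v = K (ln v)" for v
  \<comment> \<open>The logarithmic coordinate does not reach \<open>s = 0\<close>; the value 0
    there continues the flow by its equilibrium.\<close>
  define \<beta> where "\<beta> s t = (if s \<le> 0 then 0 else exp (J (K (ln s) - t)))" for s t
  have Jle: "J x \<le> J y \<longleftrightarrow> x \<le> y" and Jless: "J x < J y \<longleftrightarrow> x < y" for x y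
    using K(5) by (auto simp: strict_mono_less_eq strict_mono_less)
  have Kless: "K x < K y \<longleftrightarrow> x < y" for x y using K(4) by (simp add: strict_mono_less)
  have G: "(G has_real_derivative 1 / r v) (at v)" if v: "0 < v" for v
  proof -
    have "((\<lambda>v. K (ln v)) has_real_derivative g (ln v) * (1 / v)) (at v)"
      using v by (intro DERIV_chain2[OF K(1)] derivative_eq_intros) auto
    then show ?thesis using v by (simp add: G_def[abs_def] g_def)
  qed
  have \<beta>0: "0 \<le> \<beta> s t" for s t by (simp add: \<beta>_def)
  have \<beta>le: "\<beta> s t \<le> s" if "0 \<le> s" "0 \<le> t" for s t
  proof (cases "s = 0")
    case False
    then have "exp (J (K (ln s) - t)) \<le> exp (J (K (ln s)))" using that Jle by simp
    then show ?thesis using False that by (simp add: \<beta>_def K(2))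
  qed (simp add: \<beta>_def)
  have cK: "continuous_on UNIV K" using K(1) by (meson DERIV_isCont continuous_at_imp_continuous_on)
  have c: "continuous_on ({0..} \<times> {0..}) (\<lambda>(s, t). \<beta> s t)"
    unfolding continuous_on_eq_continuous_within
  proof
    fix z :: "real \<times> real" assume z: "z \<in> {0..} \<times> {0..}"
    show "continuous (at z within {0..} \<times> {0..}) (\<lambda>(s, t). \<beta> s t)"
    proof (cases "fst z > 0")
      case True
      have "continuous_on ({0<..} \<times> UNIV) (\<lambda>z. exp (J (K (ln (fst z)) - snd z)))"
        by (intro continuous_intros continuous_on_compose2[OF K(6)] continuous_on_compose2[OF cK]) auto
      then have "continuous_on ({0<..} \<times> UNIV) (\<lambda>(s, t). \<beta> s t)"
        by (rule continuous_on_eq) (auto simp: \<beta>_def)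
      moreover have "open ({0<..} \<times> (UNIV :: real set) :: (real \<times> real) set)" by (intro open_Times) auto
      ultimately have "isCont (\<lambda>(s, t). \<beta> s t) z"
        using True by (cases z) (simp add: continuous_on_eq_continuous_at)
      then show ?thesis by (rule continuous_at_imp_continuous_within)
    next
      case False
      then have z0: "fst z = 0" using z by (auto simp: mem_Times_iff)
      have "((\<lambda>z. fst z) \<longlongrightarrow> fst z) (at z within {0..} \<times> {0..})" by (intro tendsto_intros)
      \<comment> \<open>At \<open>s = 0\<close> joint continuity follows by squeezing with
        \<open>\<beta> s t \<le> s\<close>.\<close>
      then have "((\<lambda>(s, t). \<beta> s t) \<longlongrightarrow> 0) (at z within {0..} \<times> {0..})"
        unfolding z0
        by (rule Lim_null_comparison[rotated])
           (auto simp: eventually_at_filter \<beta>0 \<beta>le intro!: always_eventually)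
      moreover have "(\<lambda>(s, t). \<beta> s t) z = 0" using z0 by (simp add: \<beta>_def case_prod_unfold)
      ultimately show ?thesis by (simp add: continuous_within)
    qed
  qed
  have "class_KL \<beta>"
    unfolding class_KL_def
  proof (intro conjI allI impI c)
    fix t :: real assume t: "0 \<le> t"
    show "class_K (\<lambda>s. \<beta> s t)"
      unfolding class_K_def
    proof (intro conjI)
      have "continuous_on {0..} (\<lambda>s. (case (s, t) of (s, t) \<Rightarrow> \<beta> s t))"
        by (rule continuous_on_compose2[OF c]) (use t in \<open>auto intro!: continuous_intros\<close>)
      then show "continuous_on {0..} (\<lambda>s. \<beta> s t)" by simp
      show "strict_mono_on {0..} (\<lambda>s. \<beta> s t)"
        by (auto simp: strict_mono_on_def \<beta>_def Jless Kless)
    qed (simp add: \<beta>_def)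
  next
    fix s t1 t2 :: real assume "0 \<le> t1" "t1 \<le> t2"
    then show "\<beta> s t2 \<le> \<beta> s t1" by (simp add: \<beta>_def Jle)
  next
    fix s :: real
    show "((\<lambda>t. \<beta> s t) \<longlongrightarrow> 0) at_top"
    proof (cases "s \<le> 0")
      case False
      have "filterlim (\<lambda>t. J (K (ln s) - t)) at_bot at_top"
        unfolding filterlim_at_bot
      proof
        fix Z
        show "\<forall>\<^sub>F t in at_top. J (K (ln s) - t) \<le> Z"
          using eventually_ge_at_top[of "K (ln s) - K Z"]
          by eventually_elim (metis Jle K(2) diff_le_eq add.commute)
      qed
      then show ?thesis using False by (simp add: \<beta>_def filterlim_compose[OF exp_at_bot])
    qed (simp add: \<beta>_def)
  qed
  moreover have "v \<le> \<beta> s t" if "0 < v" "0 < s" "G v \<le> G s - t" for v s t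
  proof -
    have "ln v \<le> J (K (ln s) - t)" using that(3) K(2) Jle by (metis G_def)
    then have "exp (ln v) \<le> exp (J (K (ln s) - t))" by simp
    then show ?thesis using that by (simp add: \<beta>_def)
  qed
  ultimately show thesis by (intro that[of G \<beta>] G)
qed

text \<open>The infimal convolution of \<open>\<rho> \<circ> norm\<close> with the distance between levels of \<open>V\<close> is a
  1-Lipschitz decay rate in terms of the value of \<open>V\<close> alone.\<close>

lemma level_decay_rate:
  fixes V :: "'a::euclidean_space \<Rightarrow> real"
  assumes lo: "class_K_inf \<alpha>lo" and hi: "class_K_inf \<alpha>hi" and rho: "class_PD \<rho>"
    and V: "\<And>x. \<alpha>lo (norm x) \<le> V x \<and> V x \<le> \<alpha>hi (norm x)"
  obtains r where "continuous_on UNIV r" "\<And>v. 0 < v \<Longrightarrow> 0 < r v" "\<And>v. 0 < v \<Longrightarrow> r v \<le> v"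
    "\<And>x. r (V x) \<le> \<rho> (norm x)"
proof -
  have \<rho>0: "0 \<le> \<rho> s" if "0 \<le> s" for s
    using rho that by (cases "s = 0") (auto simp: class_PD_def less_imp_le)
  have bdd: "bdd_below (range (\<lambda>y. \<rho> (norm y) + \<bar>v - V y\<bar>))" for v
    by (rule bdd_belowI2[of _ 0]) (simp add: \<rho>0)
  define r where "r v = (INF y. \<rho> (norm y) + \<bar>v - V y\<bar>)" for v
  have le: "r v \<le> \<rho> (norm y) + \<bar>v - V y\<bar>" for v y
    unfolding r_def by (rule cINF_lower[OF bdd]) simp
  have "1-lipschitz_on UNIV r"
  proof (rule lipschitz_onI)
    have tri: "r v \<le> r w + \<bar>v - w\<bar>" for v w
    proof -
      have "r v - \<bar>v - w\<bar> \<le> r w"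
        unfolding r_def[of w]
      proof (rule cINF_greatest)
        show "r v - \<bar>v - w\<bar> \<le> \<rho> (norm y) + \<bar>w - V y\<bar>" for y using le[of v y] by linarith
      qed simp
      then show ?thesis by linarith
    qed
    have "\<bar>r v - r w\<bar> \<le> \<bar>v - w\<bar>" for v w
      using tri[of v w] tri[of w v] by (simp add: abs_le_iff abs_minus_commute)
    then show "dist (r v) (r w) \<le> 1 * dist v w" for v w by (simp add: dist_real_def)
  qed simp
  then have c: "continuous_on UNIV r" by (rule lipschitz_on_continuous_on)
  have V0: "V 0 = 0" using V[of 0] lo hi by (auto simp: class_K_inf_def class_K_def)
  \<comment> \<open>The competitor \<open>y = 0\<close>, where \<open>\<rho>\<close> and
    \<open>V\<close> both vanish, gives the cap.\<close>
  have up: "r v \<le> v" if "0 < v" for v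
    using le[of v 0] V0 rho that by (simp add: class_PD_def)
  \<comment> \<open>Three zones for the competitor \<open>y\<close>: near the origin
    \<open>V y\<close> is at most \<open>v / 2\<close>, far out it is at least
    \<open>3 * v / 2\<close>, so in both the level distance is at least \<open>v / 2\<close>. On the
    annulus between, \<open>\<rho>\<close> has a positive minimum. The outer radius
    \<open>max q R\<close> keeps the annulus nonempty.\<close>
  have pos: "0 < r v" if v: "0 < v" for v
  proof -
    have "\<forall>\<^sub>F s in at_top. 3 * v / 2 \<le> \<alpha>lo s"
      using lo unfolding class_K_inf_def filterlim_at_top by blast
    then have "\<forall>\<^sub>F s in at_top. 3 * v / 2 \<le> \<alpha>lo s \<and> 0 \<le> s"
      using eventually_ge_at_top by (rule eventually_conj)
    then obtain R where R: "3 * v / 2 \<le> \<alpha>lo R" "0 \<le> R" by (auto dest: eventually_happens)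
    have mlo: "mono_on {0..} \<alpha>lo" and mhi: "mono_on {0..} \<alpha>hi"
      using lo hi by (auto simp: class_K_inf_def class_K_def strict_mono_on_imp_mono_on)
    have "continuous_on {0..} \<alpha>hi" "\<alpha>hi 0 = 0" using hi by (auto simp: class_K_inf_def class_K_def)
    then obtain d where d: "d > 0" "\<And>s. 0 \<le> s \<Longrightarrow> s < d \<Longrightarrow> \<bar>\<alpha>hi s\<bar> < v / 2"
      using v unfolding continuous_on_iff by (metis atLeast_iff diff_zero dist_real_def half_gt_zero order_refl abs_of_nonneg)
    define q where "q = d / 2"
    have q: "q > 0" "\<alpha>hi q < v / 2" using d(1) d(2)[of q] by (auto simp: q_def)
    have "compact {q..max q R}" "{q..max q R} \<noteq> {}" by auto
    moreover have "continuous_on {q..max q R} \<rho>"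
      using rho q by (auto simp: class_PD_def intro: continuous_on_subset)
    ultimately obtain m where m: "m \<in> {q..max q R}" "\<And>s. s \<in> {q..max q R} \<Longrightarrow> \<rho> m \<le> \<rho> s"
      using continuous_attains_inf by metis
    have m0: "\<rho> m > 0" using rho m(1) q by (auto simp: class_PD_def)
    have "min (\<rho> m) (v / 2) \<le> r v"
      unfolding r_def
    proof (rule cINF_greatest)
      fix y :: 'a
      consider "norm y \<le> q" | "norm y \<in> {q..max q R}" | "R \<le> norm y" by fastforce
      then show "min (\<rho> m) (v / 2) \<le> \<rho> (norm y) + \<bar>v - V y\<bar>"
      proof cases
        case 1
        then have "V y \<le> \<alpha>hi q" using V[of y] mono_onD[OF mhi, of "norm y" q] q(1) by auto
        then show ?thesis using q \<rho>0[of "norm y"] by auto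
      next
        case 2
        then have "\<rho> m \<le> \<rho> (norm y)" by (rule m(2))
        then show ?thesis by linarith
      next
        case 3
        then have "\<alpha>lo R \<le> V y" using V[of y] R mono_onD[OF mlo, of R "norm y"] by auto
        then show ?thesis using R \<rho>0[of "norm y"] by auto
      qed
    qed simp
    then show ?thesis using m0 v by linarith
  qed
  have low: "r (V x) \<le> \<rho> (norm x)" for x using le[of "V x" x] by simp
  show thesis by (intro that[of r] c pos up low)
qed

text \<open>Being above \<open>c\<close> at the end forces \<open>W\<close> to be above
  \<open>c\<close> throughout, because above \<open>c\<close> it can only decrease. Then
  \<open>G (W t) + t\<close> is absolutely continuous with nonpositive derivative almost
  everywhere.\<close>

lemma decay_above_threshold:
  fixes W r G :: "real \<Rightarrow> real"
  assumes W: "abs_cont_on 0 T W" and T: "0 \<le> T" and c: "0 \<le> c"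
    and r: "continuous_on UNIV r" "\<And>v. 0 < v \<Longrightarrow> 0 < r v"
    and G: "\<And>v. 0 < v \<Longrightarrow> (G has_real_derivative 1 / r v) (at v)"
    and der: "AE t in lborel. 0 < t \<and> t < T \<and> c < W t \<longrightarrow>
      (\<exists>w. (W has_real_derivative w) (at t) \<and> w \<le> - r (W t))"
    and above: "c < W T"
  shows "0 < W 0 \<and> G (W T) \<le> G (W 0) - T"
proof -
  have contW: "continuous_on {0..T} W" by (rule abs_cont_on_imp_continuous_on[OF W])
  have gt: "c < W s" if s: "s \<in> {0..T}" for s
  proof (rule ccontr)
    assume "\<not> c < W s"
    \<comment> \<open>The last time \<open>b\<close> at or below the threshold exists by
      compactness; from there on \<open>W\<close> cannot increase, so it cannot end above
      \<open>c\<close>.\<close>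
    define A where "A = {0..T} \<inter> W -` {..c}"
    have "closed A" unfolding A_def by (rule continuous_closed_preimage[OF contW]) auto
    have A: "A \<noteq> {}" "compact A"
      using s \<open>\<not> c < W s\<close> \<open>closed A\<close> unfolding compact_eq_bounded_closed
      by (auto simp: A_def intro: bounded_subset[OF bounded_closed_interval])
    then obtain b where b: "b \<in> A" "\<And>t. t \<in> A \<Longrightarrow> t \<le> b" using compact_attains_sup by metis
    have bT: "0 \<le> b" "b \<le> T" "W b \<le> c" using b(1) by (auto simp: A_def)
    have "W T \<le> W b"
    proof (rule abs_cont_on_nonincreasing[where f=W and a=b and b=T])
      show "abs_cont_on b T W" by (rule abs_cont_on_subinterval[OF W]) (use bT in auto)
      show "AE t in lborel. b < t \<and> t < T \<longrightarrow> (\<exists>w\<le>0. (W has_real_derivative w) (at t))"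
        using der
      proof (eventually_elim, intro impI)
        fix t assume h: "0 < t \<and> t < T \<and> c < W t \<longrightarrow> (\<exists>w. (W has_real_derivative w) (at t) \<and> w \<le> - r (W t))"
          and t: "b < t \<and> t < T"
        have "c < W t" using b(2)[of t] t bT by (force simp: A_def not_le[symmetric])
        then have "0 < r (W t)" using c r(2) by simp
        moreover obtain w where "(W has_real_derivative w) (at t)" "w \<le> - r (W t)"
          using h t bT \<open>c < W t\<close> by auto
        ultimately show "\<exists>w\<le>0. (W has_real_derivative w) (at t)" by (intro exI[of _ w]) auto
      qed
    qed (rule bT)
    then show False using bT above by simp
  qed
  obtain m where m: "m \<in> {0..T}" "\<And>t. t \<in> {0..T} \<Longrightarrow> W m \<le> W t"
    using continuous_attains_inf[OF _ _ contW] T by auto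
  obtain M where M: "M \<in> {0..T}" "\<And>t. t \<in> {0..T} \<Longrightarrow> W t \<le> W M"
    using continuous_attains_sup[OF _ _ contW] T by auto
  have Wm: "0 < W m" using gt[OF m(1)] c by simp
  \<comment> \<open>\<open>G\<close> may be singular at 0, but the range of \<open>W\<close> is a
    compact interval of positive numbers; there \<open>G\<close> is Lipschitz and the composition
    stays absolutely continuous.\<close>
  have "continuous_on {W m..W M} (\<lambda>v. 1 / r v)"
    using Wm r(2)
    by (intro continuous_intros continuous_on_subset[OF r(1)]) (auto dest!: less_le_trans[OF Wm] simp: order.strict_iff_order)
  then have "bounded ((\<lambda>v. 1 / r v) ` {W m..W M})"
    by (intro compact_imp_bounded compact_continuous_image) auto
  then obtain B where B: "\<And>v. v \<in> {W m..W M} \<Longrightarrow> norm (1 / r v) \<le> B" unfolding bounded_iff by blast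
  have "W m \<in> {W m..W M}" using M(2)[OF m(1)] by simp
  from B[OF this] have B0: "0 \<le> B" by (rule order_trans[OF norm_ge_zero])
  have "B-lipschitz_on {W m..W M} G"
  proof (rule lipschitz_onI)
    fix x y assume "x \<in> {W m..W M}" "y \<in> {W m..W M}"
    then show "dist (G x) (G y) \<le> B * dist x y"
      unfolding dist_norm
      by (intro field_differentiable_bound[of "{W m..W M}" G "\<lambda>v. 1 / r v" B])
         (use Wm G B in \<open>auto intro: has_field_derivative_at_within\<close>)
  qed (rule B0)
  then have "abs_cont_on 0 T (\<lambda>t. G (W t))"
    by (rule abs_cont_on_lipschitz_compose[OF W]) (use m M in auto)
  then have ac: "abs_cont_on 0 T (\<lambda>t. G (W t) + t)"
    by (intro abs_cont_on_add abs_cont_on_ident)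
  have "G (W T) + T \<le> G (W 0) + 0"
  proof (rule abs_cont_on_nonincreasing[where f="\<lambda>t. G (W t) + t" and a=0 and b=T, OF ac T])
    show "AE t in lborel. 0 < t \<and> t < T \<longrightarrow> (\<exists>d\<le>0. ((\<lambda>t. G (W t) + t) has_real_derivative d) (at t))"
      using der
    proof (eventually_elim, intro impI)
      fix t assume h: "0 < t \<and> t < T \<and> c < W t \<longrightarrow> (\<exists>w. (W has_real_derivative w) (at t) \<and> w \<le> - r (W t))"
        and t: "0 < t \<and> t < T"
      have Wt: "c < W t" using gt t by simp
      then obtain w where w: "(W has_real_derivative w) (at t)" "w \<le> - r (W t)" using h t by blast
      have W0: "0 < W t" using Wt c by simp
      have "((\<lambda>t. G (W t) + t) has_real_derivative 1 / r (W t) * w + 1) (at t)"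
        by (intro DERIV_add DERIV_chain2[OF G[OF W0] w(1)] DERIV_ident)
      moreover have "1 / r (W t) * w + 1 \<le> 0" using w(2) r(2)[OF W0] by (simp add: field_simps)
      ultimately show "\<exists>d\<le>0. ((\<lambda>t. G (W t) + t) has_real_derivative d) (at t)" by blast
    qed
  qed
  moreover have "0 < W 0" using gt[of 0] T c by simp
  ultimately show ?thesis by simp
qed

section \<open>Trajectories and input-to-state stability\<close>

lemma AE_lebesgue_on_iff:
  "S \<in> sets lebesgue \<Longrightarrow> (AE t in lebesgue_on S. P t) \<longleftrightarrow> (AE t in lborel. t \<in> S \<longrightarrow> P t)"
  for S :: "real set"
  by (simp add: AE_restrict_space_iff AE_completion_iff)

text \<open>The form of a solution in which all estimates are stated: absolute continuity up to the
  end point, but a two-sided derivative only in the open interval, so that restrictions and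
  concatenations qualify.\<close>

definition trajectory ::
    "('a::euclidean_space \<Rightarrow> 'b \<Rightarrow> 'a set) \<Rightarrow> (real \<Rightarrow> 'b) \<Rightarrow> real \<Rightarrow> (real \<Rightarrow> 'a) \<Rightarrow> bool" where
  "trajectory F u S x \<longleftrightarrow> abs_cont_on 0 S x \<and>
     (AE t in lborel. 0 < t \<and> t < S \<longrightarrow> (\<exists>d. (x has_vector_derivative d) (at t) \<and> d \<in> F (x t) (u t)))"

lemma is_solution_alt:
  "is_solution F u x0 T x \<longleftrightarrow> 0 < T \<and> x 0 = x0 \<and> loc_abs_cont T x \<and>
     (AE t in lborel. 0 < t \<and> ereal t < T \<longrightarrow> (\<exists>d. (x has_vector_derivative d) (at t) \<and> d \<in> F (x t) (u t)))"
proof -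
  have "{t. 0 \<le> t \<and> ereal t < T} \<in> sets borel" by measurable
  then have S: "{t. 0 \<le> t \<and> ereal t < T} \<in> sets lebesgue" by simp
  have "(AE t in lborel. t \<in> {t. 0 \<le> t \<and> ereal t < T} \<longrightarrow> P t) \<longleftrightarrow> (AE t in lborel. 0 < t \<and> ereal t < T \<longrightarrow> P t)" for P
  proof
    assume "AE t in lborel. 0 < t \<and> ereal t < T \<longrightarrow> P t"
    then show "AE t in lborel. t \<in> {t. 0 \<le> t \<and> ereal t < T} \<longrightarrow> P t"
      using AE_lborel_singleton[of 0] by eventually_elim auto
  qed (auto elim!: eventually_mono)
  then show ?thesis by (simp only: is_solution_def AE_lebesgue_on_iff[OF S])
qed

section \<open>Passage between solutions and arcs on compact intervals\<close>

lemma is_solution_imp_trajectory: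
  assumes "is_solution F u x0 T x" "0 \<le> S" "ereal S < T"
  shows "trajectory F u S x"
  unfolding trajectory_def
proof
  show "abs_cont_on 0 S x" using assms by (simp add: is_solution_alt loc_abs_cont_def)
  have lt: "ereal t < T" if "t < S" for t using less_trans[OF _ assms(3), of "ereal t"] that by simp
  have "AE t in lborel. 0 < t \<and> ereal t < T \<longrightarrow> (\<exists>d. (x has_vector_derivative d) (at t) \<and> d \<in> F (x t) (u t))"
    using assms(1) by (simp add: is_solution_alt)
  then show "AE t in lborel. 0 < t \<and> t < S \<longrightarrow> (\<exists>d. (x has_vector_derivative d) (at t) \<and> d \<in> F (x t) (u t))"
    by eventually_elim (simp add: lt)
qed

lemma trajectory_cong:
  assumes x: "trajectory F u S x" and xy: "\<And>t. 0 \<le> t \<Longrightarrow> t \<le> S \<Longrightarrow> x t = y t"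
  shows "trajectory F u S y"
  unfolding trajectory_def
proof
  show "abs_cont_on 0 S y" using x xy by (auto simp: trajectory_def intro: abs_cont_on_cong)
  show "AE t in lborel. 0 < t \<and> t < S \<longrightarrow> (\<exists>d. (y has_vector_derivative d) (at t) \<and> d \<in> F (y t) (u t))"
    using conjunct2[OF x[unfolded trajectory_def]]
  proof (eventually_elim, intro impI)
    fix t assume "0 < t \<and> t < S \<longrightarrow> (\<exists>d. (x has_vector_derivative d) (at t) \<and> d \<in> F (x t) (u t))"
      and t: "0 < t \<and> t < S"
    then obtain d where d: "(x has_vector_derivative d) (at t)" "d \<in> F (x t) (u t)" by blast
    have "(y has_vector_derivative d) (at t)"
      by (rule has_vector_derivative_transform_within_open[OF d(1), of "{0<..<S}"]) (use t xy in auto)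
    with d(2) xy[of t] t show "\<exists>d. (y has_vector_derivative d) (at t) \<and> d \<in> F (y t) (u t)" by auto
  qed
qed

text \<open>Every compact interval brings its own null set; intervals with rational end points
  already cover \<open>[0,T)\<close> and need only countably many.\<close>

lemma is_solution_if_trajectories:
  assumes T: "0 < T" and x: "\<And>S. 0 \<le> S \<Longrightarrow> ereal S < T \<Longrightarrow> trajectory F u S x"
  shows "is_solution F u (x 0) T x"
  unfolding is_solution_alt
proof (intro conjI)
  show "loc_abs_cont T x" using x by (auto simp: loc_abs_cont_def trajectory_def)
  have "AE t in lborel. \<forall>i::rat. 0 < t \<and> t < of_rat i \<and> ereal (of_rat i) < T \<longrightarrow>
      (\<exists>d. (x has_vector_derivative d) (at t) \<and> d \<in> F (x t) (u t))"
  proof (subst AE_all_countable, intro allI)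
    fix i :: rat
    show "AE t in lborel. 0 < t \<and> t < of_rat i \<and> ereal (of_rat i) < T \<longrightarrow>
      (\<exists>d. (x has_vector_derivative d) (at t) \<and> d \<in> F (x t) (u t))"
    proof (cases "0 \<le> (of_rat i :: real) \<and> ereal (of_rat i) < T")
      case True
      then have "trajectory F u (of_rat i) x" by (intro x) auto
      then show ?thesis unfolding trajectory_def by (auto elim!: eventually_mono)
    next
      case False
      show ?thesis
      proof (intro AE_I2 impI)
        fix t :: real assume t: "0 < t \<and> t < of_rat i \<and> ereal (of_rat i) < T"
        then have "(0::real) \<le> of_rat i" by linarith
        with t False show "\<exists>d. (x has_vector_derivative d) (at t) \<and> d \<in> F (x t) (u t)" by blast
      qed
    qed
  qed
  then show "AE t in lborel. 0 < t \<and> ereal t < T \<longrightarrow> (\<exists>d. (x has_vector_derivative d) (at t) \<and> d \<in> F (x t) (u t))"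
  proof (eventually_elim, intro impI)
    fix t assume A: "\<forall>i::rat. 0 < t \<and> t < of_rat i \<and> ereal (of_rat i) < T \<longrightarrow>
      (\<exists>d. (x has_vector_derivative d) (at t) \<and> d \<in> F (x t) (u t))" and t: "0 < t \<and> ereal t < T"
    obtain z where z: "ereal t < ereal z" "ereal z < T" using t ereal_dense2[of "ereal t" T] by auto
    then obtain i where "t < of_rat i" "of_rat i < z" using of_rat_dense[of t z] by auto
    moreover from this have "ereal (of_rat i) < T" using z(2) by (meson ereal_less_eq(3) less_imp_le le_less_trans)
    ultimately show "\<exists>d. (x has_vector_derivative d) (at t) \<and> d \<in> F (x t) (u t)" using A t by blast
  qed
qed (use T in auto)

text \<open>Scalarization: with \<open>p\<close> the direction of the displacement between two
  times, \<open>p \<bullet> x r - M * r\<close> is absolutely continuous and nonincreasing.\<close>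

lemma trajectory_lipschitz:
  fixes x :: "real \<Rightarrow> 'a::euclidean_space"
  assumes x: "trajectory F u S x" and M: "0 \<le> M"
    and bd: "AE t in lborel. 0 < t \<and> t < S \<longrightarrow> (\<forall>d\<in>F (x t) (u t). norm d \<le> M)"
  shows "M-lipschitz_on {0..S} x"
proof (rule lipschitz_on_leI)
  fix s t assume st: "s \<in> {0..S}" "t \<in> {0..S}" "s \<le> t"
  define p where "p = sgn (x t - x s)"
  have p1: "norm p \<le> 1" by (simp add: p_def norm_sgn)
  have "p \<bullet> x t + - M * t \<le> p \<bullet> x s + - M * s"
  proof (rule abs_cont_on_nonincreasing[where f="\<lambda>r. p \<bullet> x r + - M * r"])
    have ac: "abs_cont_on s t x" using x st unfolding trajectory_def by (auto intro: abs_cont_on_subinterval)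
    have "1-lipschitz_on UNIV (\<lambda>z. p \<bullet> z)"
    proof (rule lipschitz_onI)
      show "dist (p \<bullet> y) (p \<bullet> z) \<le> 1 * dist y z" for y z
        using Cauchy_Schwarz_ineq2[of p "y - z"] mult_right_mono[OF p1 norm_ge_zero[of "y - z"]]
        by (simp add: dist_norm inner_diff_right)
    qed simp
    then have "abs_cont_on s t (\<lambda>r. p \<bullet> x r)" by (rule abs_cont_on_lipschitz_compose[OF ac]) simp
    moreover have "abs_cont_on s t (\<lambda>r. - M * r)"
      by (rule lipschitz_imp_abs_cont_on[of M], rule lipschitz_onI)
         (use M in \<open>auto simp: dist_real_def abs_mult abs_minus_commute simp flip: right_diff_distrib\<close>)
    ultimately show "abs_cont_on s t (\<lambda>r. p \<bullet> x r + - M * r)" by (rule abs_cont_on_add)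
    show "AE r in lborel. s < r \<and> r < t \<longrightarrow> (\<exists>d\<le>0. ((\<lambda>r. p \<bullet> x r + - M * r) has_real_derivative d) (at r))"
      using conjunct2[OF x[unfolded trajectory_def]] bd
    proof (eventually_elim, intro impI)
      fix r assume A: "0 < r \<and> r < S \<longrightarrow> (\<exists>d. (x has_vector_derivative d) (at r) \<and> d \<in> F (x r) (u r))"
        and B: "0 < r \<and> r < S \<longrightarrow> (\<forall>d\<in>F (x r) (u r). norm d \<le> M)" and r: "s < r \<and> r < t"
      obtain d where d: "(x has_vector_derivative d) (at r)" "norm d \<le> M" using A B r st by auto
      have "((\<lambda>r. p \<bullet> x r) has_vector_derivative p \<bullet> d) (at r)"
        by (rule bounded_linear.has_vector_derivative[OF bounded_linear_inner_right d(1)])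
      then have "((\<lambda>r. p \<bullet> x r + - M * r) has_real_derivative p \<bullet> d + - M) (at r)"
        unfolding has_real_derivative_iff_has_vector_derivative[symmetric]
        by (auto intro!: derivative_eq_intros)
      moreover have "p \<bullet> d \<le> M"
        using Cauchy_Schwarz_ineq2[of p d] mult_right_mono[OF p1 norm_ge_zero[of d]] d(2) by simp
      ultimately show "\<exists>d\<le>0. ((\<lambda>r. p \<bullet> x r + - M * r) has_real_derivative d) (at r)"
        by (intro exI[of _ "p \<bullet> d + - M"]) auto
    qed
  qed (rule st)
  moreover have "p \<bullet> (x t - x s) = norm (x t - x s)"
    unfolding p_def sgn_div_norm inner_scaleR_left dot_square_norm power2_eq_square
    by (cases "x t = x s") simp_all
  ultimately show "dist (x s) (x t) \<le> M * dist s t"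
    using st by (simp add: dist_norm norm_minus_commute inner_diff_right right_diff_distrib)
qed (rule M)

lemma locally_bounded_map_on_cballs:
  fixes F :: "'a::euclidean_space \<Rightarrow> 'b::euclidean_space \<Rightarrow> 'c::real_normed_vector set"
  assumes "locally_bounded_map F"
  obtains M where "0 \<le> M" "\<And>x v f. norm x \<le> R \<Longrightarrow> norm v \<le> U \<Longrightarrow> f \<in> F x v \<Longrightarrow> norm f \<le> M"
proof -
  have "\<forall>z. \<exists>r>0. \<exists>M. \<forall>y v. dist y (fst z) < r \<longrightarrow> dist v (snd z) < r \<longrightarrow> (\<forall>f\<in>F y v. norm f \<le> M)"
    using assms unfolding locally_bounded_map_def by blast
  then obtain r M where rM: "\<And>z. r z > 0" "\<And>z y v f. dist y (fst z) < r z \<Longrightarrow> dist v (snd z) < r z \<Longrightarrow> f \<in> F y v \<Longrightarrow> norm f \<le> M z"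
    by metis
  let ?K = "cball 0 R \<times> cball 0 U :: ('a \<times> 'b) set"
  let ?B = "\<lambda>z :: 'a \<times> 'b. ball (fst z) (r z) \<times> ball (snd z) (r z)"
  have "compact ?K" by (intro compact_Times compact_cball)
  moreover have "open (?B z)" for z by (intro open_Times open_ball)
  moreover have "?K \<subseteq> (\<Union>z\<in>UNIV. ?B z)"
  proof
    fix z show "z \<in> (\<Union>z\<in>UNIV. ?B z)" using rM(1)[of z] by (intro UN_I[of z]) (auto simp: mem_Times_iff)
  qed
  ultimately obtain C where C: "finite C" "?K \<subseteq> (\<Union>z\<in>C. ?B z)"
    by (rule compactE_image)
  define N where "N = (\<Sum>z\<in>C. \<bar>M z\<bar>)"
  have "norm f \<le> N" if "norm x \<le> R" "norm v \<le> U" "f \<in> F x v" for x v f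
  proof -
    have "(x, v) \<in> ?K" using that by simp
    then obtain z where z: "z \<in> C" "(x, v) \<in> ?B z" using C(2) by blast
    then have "norm f \<le> M z" using that(3) by (intro rM(2)[of x z v]) (auto simp: dist_commute)
    also have "\<dots> \<le> \<bar>M z\<bar>" by simp
    also have "\<dots> \<le> N" unfolding N_def by (rule member_le_sum[OF z(1)]) (use C in auto)
    finally show ?thesis .
  qed
  moreover have "0 \<le> N" by (simp add: N_def sum_nonneg)
  ultimately show thesis using that by blast
qed

text \<open>That the infimum of the essential bounds is itself an essential bound requires a
  countable union of null sets, one for each excess \<open>1 / Suc n\<close>.\<close>

lemma ess_sup_norm_props:
  assumes u: "admissible_input u" and T: "0 \<le> T"
  shows "0 \<le> ess_sup_norm u T" "AE t in lborel. 0 \<le> t \<and> t \<le> T \<longrightarrow> norm (u t) \<le> ess_sup_norm u T"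
proof -
  define A where "A = {M. 0 \<le> M \<and> (AE \<tau> in lebesgue_on {0..T}. norm (u \<tau>) \<le> M)}"
  obtain M where "AE \<tau> in lebesgue_on {0..T}. norm (u \<tau>) \<le> M" using u T by (auto simp: admissible_input_def)
  then have "max M 0 \<in> A" unfolding A_def by (intro CollectI conjI) (auto elim!: eventually_mono)
  then have A: "A \<noteq> {}" by blast
  have I: "ess_sup_norm u T = Inf A" by (simp add: ess_sup_norm_def A_def)
  show "0 \<le> ess_sup_norm u T" unfolding I using A(1) by (rule cInf_greatest) (auto simp: A_def)
  have "AE t in lborel. \<forall>n::nat. 0 \<le> t \<and> t \<le> T \<longrightarrow> norm (u t) < Inf A + inverse (real (Suc n))"
  proof (subst AE_all_countable, intro allI)
    fix n :: nat
    have "Inf A < Inf A + inverse (real (Suc n))" by simp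
    then obtain M where M: "M \<in> A" "M < Inf A + inverse (real (Suc n))"
      using cInf_lessD[OF A(1)] by blast
    from M(1) have "AE t in lborel. t \<in> {0..T} \<longrightarrow> norm (u t) \<le> M"
      by (subst AE_lebesgue_on_iff[symmetric]) (auto simp: A_def)
    then show "AE t in lborel. 0 \<le> t \<and> t \<le> T \<longrightarrow> norm (u t) < Inf A + inverse (real (Suc n))"
      by eventually_elim (use M(2) in auto)
  qed
  then show "AE t in lborel. 0 \<le> t \<and> t \<le> T \<longrightarrow> norm (u t) \<le> ess_sup_norm u T"
  proof (eventually_elim, intro impI)
    fix t assume a: "\<forall>n::nat. 0 \<le> t \<and> t \<le> T \<longrightarrow> norm (u t) < Inf A + inverse (real (Suc n))" and t: "0 \<le> t \<and> t \<le> T"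
    show "norm (u t) \<le> ess_sup_norm u T"
      unfolding I
    proof (rule field_le_epsilon)
      fix e :: real assume "0 < e"
      then obtain n where "inverse (real (Suc n)) < e" using reals_Archimedean by blast
      then show "norm (u t) \<le> Inf A + e" using a t by (meson add_strict_left_mono less_imp_le less_trans)
    qed
  qed
qed

text \<open>Nonpathology and the inclusion each supply a derivative at almost every time. Uniqueness
  of derivatives identifies them, so the vector that pairs constantly with the Clarke gradient is
  also a value of \<open>F\<close>.\<close>

lemma trajectory_lyapunov_derivative:
  fixes F :: "'a::euclidean_space \<Rightarrow> 'b::euclidean_space \<Rightarrow> 'a set"
  assumes V_np: "nonpathological V" and x: "trajectory F u S x" and S: "0 \<le> S"
  shows "AE t in lborel. 0 < t \<and> t < S \<longrightarrow>
    (\<exists>a\<in>lie_gen_deriv F V (x t) (u t). ((\<lambda>s. V (x s)) has_real_derivative a) (at t))"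
proof -
  define \<phi> where "\<phi> t = x (max 0 (min S t))" for t
  have "loc_abs_cont \<infinity> \<phi>"
    using abs_cont_on_clamp[OF _ S, of x] x unfolding \<phi>_def loc_abs_cont_def trajectory_def by blast
  then have "AE t in lebesgue_on {0..}. \<exists>d a. (\<phi> has_vector_derivative d) (at t) \<and> (\<forall>v\<in>clarke_grad V (\<phi> t). v \<bullet> d = a)"
    using V_np by (simp add: nonpathological_def)
  then have "AE t in lborel. t \<in> {0..} \<longrightarrow>
      (\<exists>d a. (\<phi> has_vector_derivative d) (at t) \<and> (\<forall>v\<in>clarke_grad V (\<phi> t). v \<bullet> d = a))"
    by (subst (asm) AE_lebesgue_on_iff) auto
  then show ?thesis
    using conjunct2[OF x[unfolded trajectory_def]]
  proof (eventually_elim, intro impI)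
    fix t assume A: "t \<in> {0..} \<longrightarrow> (\<exists>d a. (\<phi> has_vector_derivative d) (at t) \<and> (\<forall>v\<in>clarke_grad V (\<phi> t). v \<bullet> d = a))"
      and B: "0 < t \<and> t < S \<longrightarrow> (\<exists>d. (x has_vector_derivative d) (at t) \<and> d \<in> F (x t) (u t))"
      and t: "0 < t \<and> t < S"
    obtain d a where d: "(\<phi> has_vector_derivative d) (at t)" "\<And>v. v \<in> clarke_grad V (\<phi> t) \<Longrightarrow> v \<bullet> d = a"
      using A t by auto
    obtain d' where d': "(x has_vector_derivative d') (at t)" "d' \<in> F (x t) (u t)" using B t by blast
    have eq: "\<phi> t = x t" using t by (simp add: \<phi>_def)
    have dx: "(x has_vector_derivative d) (at t)"
      by (rule has_vector_derivative_transform_within_open[OF d(1), of "{0<..<S}"]) (use t in \<open>auto simp: \<phi>_def\<close>)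
    have "d = d'" by (rule vector_derivative_unique_at[OF dx d'(1)])
    then have "a \<in> lie_gen_deriv F V (x t) (u t)"
      using d(2) d'(2) by (auto simp: lie_gen_deriv_def eq)
    moreover have "((\<lambda>s. V (x s)) has_real_derivative a) (at t)"
      using V_np d(2) by (intro clarke_chain_rule[OF _ dx]) (auto simp: nonpathological_def eq)
    ultimately show "\<exists>a\<in>lie_gen_deriv F V (x t) (u t). ((\<lambda>s. V (x s)) has_real_derivative a) (at t)" by blast
  qed
qed

text \<open>Either \<open>V\<close> ends below \<open>\<gamma> U\<close>, which gives the gain term,
  or the decay estimate holds on the whole interval and gives the \<open>\<beta>\<close> term; the
  inverse of \<open>\<alpha>lo\<close> converts both into bounds on the norm. Allowing any essential
  bound \<open>U\<close> lets one bound serve all shorter intervals during continuation.\<close>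

lemma lyapunov_iss_estimate:
  fixes F :: "'a::euclidean_space \<Rightarrow> 'b::euclidean_space \<Rightarrow> 'a set"
  assumes V_np: "nonpathological V"
    and alpha_lo: "class_K_inf \<alpha>lo" and alpha_hi: "class_K_inf \<alpha>hi"
    and rho: "class_PD \<rho>" and gamma: "class_K \<gamma>"
    and sandwich: "\<And>x. \<alpha>lo (norm x) \<le> V x \<and> V x \<le> \<alpha>hi (norm x)"
    and decrease: "\<And>x u. V x > \<gamma> (norm u) \<Longrightarrow> (\<forall>a\<in>lie_gen_deriv F V x u. a \<le> - \<rho> (norm x))"
  obtains \<beta> \<kappa> where "class_KL \<beta>" "class_K \<kappa>"
    "\<And>x u S U. trajectory F u S x \<Longrightarrow> 0 \<le> S \<Longrightarrow> 0 \<le> U \<Longrightarrow>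
      (AE t in lborel. 0 \<le> t \<and> t \<le> S \<longrightarrow> norm (u t) \<le> U) \<Longrightarrow> norm (x S) \<le> \<beta> (norm (x 0)) S + \<kappa> U"
proof -
  have V_lip: "locally_lipschitz V" using V_np by (simp add: nonpathological_def)
  have Klo: "class_K \<alpha>lo" and Khi: "class_K \<alpha>hi" using alpha_lo alpha_hi by (auto simp: class_K_inf_def)
  obtain r where r: "continuous_on UNIV r" "\<And>v. 0 < v \<Longrightarrow> 0 < r v" "\<And>v. 0 < v \<Longrightarrow> r v \<le> v" "\<And>x. r (V x) \<le> \<rho> (norm x)"
    using level_decay_rate[OF alpha_lo alpha_hi rho sandwich] by blast
  have "continuous_on {0<..} r" by (rule continuous_on_subset[OF r(1)]) simp
  then obtain G \<beta> where G: "\<And>v. 0 < v \<Longrightarrow> (G has_real_derivative 1 / r v) (at v)" and KL: "class_KL \<beta>"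
    and cmp: "\<And>v s t. 0 < v \<Longrightarrow> 0 < s \<Longrightarrow> G v \<le> G s - t \<Longrightarrow> v \<le> \<beta> s t"
    using KL_comparison_function[OF _ r(2,3)] by metis
  obtain ilo where ilo: "class_K ilo" "\<And>s. 0 \<le> s \<Longrightarrow> ilo (\<alpha>lo s) = s"
    using class_K_inf_inverse[OF alpha_lo] by metis
  have V0: "0 \<le> V x" for x using sandwich[of x] class_K_nonneg[OF Klo, of "norm x"] by simp
  have norm_le: "norm x \<le> ilo v" if "V x \<le> v" for x v
  proof -
    have "\<alpha>lo (norm x) \<le> v" using sandwich[of x] that by simp
    moreover have "0 \<le> \<alpha>lo (norm x)" by (rule class_K_nonneg[OF Klo]) simp
    ultimately have "ilo (\<alpha>lo (norm x)) \<le> ilo v" by (simp add: class_K_le_iff[OF ilo(1)])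
    then show ?thesis by (simp add: ilo(2))
  qed
  have \<beta>K: "class_K (\<lambda>s. \<beta> s t)" if "0 \<le> t" for t using KL that by (simp add: class_KL_def)
  have "norm (x S) \<le> ilo (\<beta> (\<alpha>hi (norm (x 0))) S) + ilo (\<gamma> U)"
    if x: "trajectory F u S x" and S: "0 \<le> S" and U: "0 \<le> U"
      and u: "AE t in lborel. 0 \<le> t \<and> t \<le> S \<longrightarrow> norm (u t) \<le> U" for x u S U
  proof -
    define W where "W t = V (x t)" for t
    have ac: "abs_cont_on 0 S x" using x by (simp add: trajectory_def)
    have "compact (x ` {0..S})" by (intro compact_continuous_image abs_cont_on_imp_continuous_on ac) simp
    then obtain R where "x ` {0..S} \<subseteq> cball 0 R"
      using compact_imp_bounded bounded_subset_cball by (metis bounded_iff mem_cball_0 subsetI)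
    moreover obtain L where "L-lipschitz_on (cball 0 R) V" by (rule locally_lipschitz_on_cball[OF V_lip])
    ultimately have W: "abs_cont_on 0 S W" unfolding W_def by (intro abs_cont_on_lipschitz_compose[OF ac])
    have \<gamma>0: "0 \<le> \<gamma> U" by (rule class_K_nonneg[OF gamma U])
    have der: "AE t in lborel. 0 < t \<and> t < S \<and> \<gamma> U < W t \<longrightarrow> (\<exists>w. (W has_real_derivative w) (at t) \<and> w \<le> - r (W t))"
      using trajectory_lyapunov_derivative[OF V_np x S] u
    proof (eventually_elim, intro impI)
      fix t assume A: "0 < t \<and> t < S \<longrightarrow> (\<exists>a\<in>lie_gen_deriv F V (x t) (u t). ((\<lambda>s. V (x s)) has_real_derivative a) (at t))"
        and B: "0 \<le> t \<and> t \<le> S \<longrightarrow> norm (u t) \<le> U" and t: "0 < t \<and> t < S \<and> \<gamma> U < W t"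
      obtain a where a: "a \<in> lie_gen_deriv F V (x t) (u t)" "((\<lambda>s. V (x s)) has_real_derivative a) (at t)"
        using A t by blast
      \<comment> \<open>Monotonicity of \<open>\<gamma>\<close> replaces the threshold that varies
        with the input by one constant threshold.\<close>
      have "\<gamma> (norm (u t)) \<le> \<gamma> U" using B t U by (simp add: class_K_le_iff[OF gamma])
      then have "a \<le> - \<rho> (norm (x t))" using decrease[of "u t" "x t"] a(1) t by (auto simp: W_def)
      then have "a \<le> - r (W t)" using r(4)[of "x t"] by (simp add: W_def)
      then show "\<exists>w. (W has_real_derivative w) (at t) \<and> w \<le> - r (W t)"
        using a(2) by (auto simp: W_def[abs_def])
    qed
    have hi0: "0 \<le> \<alpha>hi (norm (x 0))" by (rule class_K_nonneg[OF Khi]) simp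
    have nn: "0 \<le> ilo (\<beta> (\<alpha>hi (norm (x 0))) S)" "0 \<le> ilo (\<gamma> U)"
      using class_K_nonneg[OF \<beta>K[OF S] hi0] \<gamma>0 by (auto intro: class_K_nonneg[OF ilo(1)])
    show ?thesis
    proof (cases "\<gamma> U < W S")
      case False
      then show ?thesis using norm_le[of "x S" "\<gamma> U"] nn by (simp add: W_def)
    next
      case True
      have "0 < W 0 \<and> G (W S) \<le> G (W 0) - S"
        by (rule decay_above_threshold[OF W S \<gamma>0 r(1,2) G der True])
      then have "W S \<le> \<beta> (W 0) S" using True \<gamma>0 by (intro cmp) auto
      also have "\<dots> \<le> \<beta> (\<alpha>hi (norm (x 0))) S"
        using sandwich[of "x 0"] V0 hi0 by (simp add: class_K_le_iff[OF \<beta>K[OF S]] W_def)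
      finally show ?thesis using norm_le[of "x S"] nn unfolding W_def by (meson add_increasing2 order_trans)
    qed
  qed
  then show thesis
    using class_KL_compose[OF KL ilo(1) Khi] class_K_compose[OF ilo(1) gamma] that by blast
qed

text \<open>Existence is applied to the map frozen outside a ball which the a priori estimate
  keeps the solution from leaving.\<close>

lemma extend_solution:
  fixes F :: "'a::euclidean_space \<Rightarrow> 'b::euclidean_space \<Rightarrow> 'a set"
  assumes F_values: "\<And>x u. F x u \<noteq> {} \<and> compact (F x u) \<and> convex (F x u)"
    and F_locbdd: "locally_bounded_map F"
    and F_usc: "\<And>u. usc_map (\<lambda>x. F x u)"
    and F_cont: "\<And>x. cont_map (\<lambda>u. F x u)"
    and u: "admissible_input u"
    and apriori: "\<And>x S. trajectory F u S x \<Longrightarrow> 0 \<le> S \<Longrightarrow> S \<le> T2 \<Longrightarrow> x 0 = x0 \<Longrightarrow> norm (x S) \<le> R"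
    and x: "is_solution F u x0 (ereal T) x" and T: "T \<le> T2"
  obtains y where "is_solution F u x0 (ereal T2) y" "\<And>t. 0 \<le> t \<Longrightarrow> t < T \<Longrightarrow> y t = x t"
proof -
  have T0: "0 < T" and x0: "x 0 = x0" using x by (auto simp: is_solution_def)
  define U where "U = ess_sup_norm u T2"
  have U: "0 \<le> U" "AE t in lborel. 0 \<le> t \<and> t \<le> T2 \<longrightarrow> norm (u t) \<le> U"
    using ess_sup_norm_props[OF u, of T2] T T0 by (auto simp: U_def)
  have traj: "trajectory F u S x" if "0 \<le> S" "S < T" for S
    using is_solution_imp_trajectory[OF x that(1)] that(2) by simp
  have xR: "norm (x t) \<le> R" if "0 \<le> t" "t < T" for t
    using apriori[OF traj[OF that]] that T x0 by simp
  have R0: "0 \<le> R" using xR[of 0] T0 norm_ge_zero order_trans by blast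
  obtain M where M: "0 \<le> M" "\<And>x v f. norm x \<le> R + 1 \<Longrightarrow> norm v \<le> U \<Longrightarrow> f \<in> F x v \<Longrightarrow> norm f \<le> M"
    by (rule locally_bounded_map_on_cballs[OF F_locbdd, of "R + 1" U]) blast
  have lipS: "M-lipschitz_on {0..S} x" if "0 \<le> S" "S < T" for S
  proof (rule trajectory_lipschitz[OF traj[OF that] M(1)])
    show "AE t in lborel. 0 < t \<and> t < S \<longrightarrow> (\<forall>d\<in>F (x t) (u t). norm d \<le> M)"
      using U(2)
    proof (eventually_elim, intro impI ballI)
      fix t d assume B: "0 \<le> t \<and> t \<le> T2 \<longrightarrow> norm (u t) \<le> U" and t: "0 < t \<and> t < S" and d: "d \<in> F (x t) (u t)"
      show "norm d \<le> M" using B t d that T xR[of t] by (intro M(2)[of "x t" "u t"]) auto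
    qed
  qed
  have "M-lipschitz_on {0..<T} x"
  proof (rule lipschitz_onI)
    show "dist (x s) (x t) \<le> M * dist s t" if "s \<in> {0..<T}" "t \<in> {0..<T}" for s t
      using that by (intro lipschitz_onD[OF lipS[of "max s t"]]) auto
  qed (rule M)
  \<comment> \<open>The Lipschitz bound provides the limit at \<open>T\<close>, from which the
    continuation starts.\<close>
  then obtain g where g: "M-lipschitz_on {0..T} g" "\<And>t. t \<in> {0..<T} \<Longrightarrow> g t = x t"
    using lipschitz_extend_closure[of M "{0..<T}" x] T0 by auto
  have gR: "norm (g t) \<le> R" if "t \<in> {0..T}" for t
  proof -
    have "continuous_on (closure {0..<T}) g" using lipschitz_on_continuous_on[OF g(1)] T0 by simp
    then show ?thesis
      by (rule continuous_on_closure_norm_le) (use g(2) xR that T0 in auto)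
  qed
  define P where "P = closest_point (cball (0::'a) (R + 1))"
  have P: "norm (P y) \<le> R + 1" for y
    using closest_point_in_set[of "cball (0::'a) (R + 1)" y] R0 by (simp add: P_def)
  have P_id: "P y = y" if "norm y \<le> R + 1" for y unfolding P_def using that by (intro closest_point_self) simp
  have P_lip: "dist (P y) (P z) \<le> dist y z" for y z
    unfolding P_def using R0 by (intro closest_point_lipschitz) auto
  \<comment> \<open>The existence theorem requires the velocity bound at every time; values of
    \<open>u\<close> above \<open>U\<close> or outside \<open>[0,T2]\<close> are replaced by 0,
    which on \<open>[0,T2]\<close> changes a null set only.\<close>
  define w where "w t = (if t \<in> {0..T2} \<and> norm (u t) \<le> U then u t else 0)" for t
  have wU: "norm (w t) \<le> U" for t using U(1) by (simp add: w_def)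
  have w_meas: "w \<in> borel_measurable lebesgue"
  proof -
    have "u \<in> borel_measurable (lebesgue_on {0..})" using u by (simp add: admissible_input_def)
    then have v: "(\<lambda>t. indicator {0..} t *\<^sub>R u t) \<in> borel_measurable lebesgue"
      by (subst (asm) borel_measurable_restrict_space_iff) auto
    define v where "v t = indicator {0..} t *\<^sub>R u t" for t
    have [measurable]: "v \<in> borel_measurable lebesgue" using v by (simp add: v_def[abs_def])
    have [measurable]: "(\<lambda>t::real. t) \<in> borel_measurable lebesgue" by (rule measurable_completion) simp
    have "w = (\<lambda>t. if t \<in> {0..T2} \<and> norm (v t) \<le> U then v t else 0)"
      by (auto simp: w_def v_def fun_eq_iff)
    also have "\<dots> \<in> borel_measurable lebesgue" by measurable
    finally show ?thesis .
  qed
  have usc_P: "usc_map (\<lambda>x. F (P x) v)" for v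
    unfolding usc_map_def usc_at_def
  proof (intro allI impI)
    fix y and W :: "'a set" assume "open W \<and> F (P y) v \<subseteq> W"
    then obtain \<delta> where "\<delta> > 0" "\<forall>z. dist z (P y) < \<delta> \<longrightarrow> F z v \<subseteq> W"
      using F_usc[of v] unfolding usc_map_def usc_at_def by blast
    then show "\<exists>\<delta>>0. \<forall>z. dist z y < \<delta> \<longrightarrow> F (P z) v \<subseteq> W"
      using P_lip by (meson le_less_trans)
  qed
  obtain y where y: "M-lipschitz_on {T..T2} y" "y T = g T"
    "AE t in lborel. T < t \<and> t < T2 \<longrightarrow> (\<exists>d. (y has_vector_derivative d) (at t) \<and> d \<in> F (P (y t)) (w t))"
    using caratheodory_inclusion_exists[of "\<lambda>x. F (P x)" w M T T2 "g T", OF F_values usc_P F_cont w_meas _ T] M(2)[OF P wU]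
    by blast
  define z where "z t = (if t \<le> T then g t else y t)" for t
  have z_lip: "M-lipschitz_on {0..T2} z"
    unfolding z_def[abs_def] by (rule lipschitz_on_concat[OF g(1) y(1)]) (simp add: y(2))
  have z_der: "AE t in lborel. 0 < t \<and> t < T2 \<longrightarrow> (\<exists>d. (z has_vector_derivative d) (at t) \<and> d \<in> F (P (z t)) (u t))"
  proof -
    have "AE t in lborel. 0 < t \<and> ereal t < ereal T \<longrightarrow> (\<exists>d. (x has_vector_derivative d) (at t) \<and> d \<in> F (x t) (u t))"
      using x by (simp add: is_solution_alt)
    then show ?thesis
      using y(3) U(2) AE_lborel_singleton[of T]
    proof (eventually_elim, intro impI)
      fix t assume A: "0 < t \<and> ereal t < ereal T \<longrightarrow> (\<exists>d. (x has_vector_derivative d) (at t) \<and> d \<in> F (x t) (u t))"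
        and B: "T < t \<and> t < T2 \<longrightarrow> (\<exists>d. (y has_vector_derivative d) (at t) \<and> d \<in> F (P (y t)) (w t))"
        and C: "0 \<le> t \<and> t \<le> T2 \<longrightarrow> norm (u t) \<le> U" and tT: "t \<noteq> T" and t: "0 < t \<and> t < T2"
      show "\<exists>d. (z has_vector_derivative d) (at t) \<and> d \<in> F (P (z t)) (u t)"
      proof (cases "t < T")
        case True
        then obtain d where d: "(x has_vector_derivative d) (at t)" "d \<in> F (x t) (u t)" using A t by auto
        have "(z has_vector_derivative d) (at t)"
          by (rule has_vector_derivative_transform_within_open[OF d(1), of "{0<..<T}"])
             (use t True g(2) in \<open>auto simp: z_def\<close>)
        moreover have "P (z t) = x t"
          using True t g(2)[of t] xR[of t] by (simp add: z_def P_id)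
        ultimately show ?thesis using d(2) by auto
      next
        case False
        then have tT': "T < t" using tT by simp
        then obtain d where d: "(y has_vector_derivative d) (at t)" "d \<in> F (P (y t)) (w t)" using B t by auto
        have "(z has_vector_derivative d) (at t)"
          by (rule has_vector_derivative_transform_within_open[OF d(1), of "{T<..}"])
             (use tT' in \<open>auto simp: z_def\<close>)
        moreover have "w t = u t" using C t by (simp add: w_def)
        ultimately show ?thesis using d(2) tT' by (auto simp: z_def)
      qed
    qed
  qed
  have z_traj: "trajectory F u S z" if S: "S \<le> T2" and in_ball: "\<And>t. 0 < t \<Longrightarrow> t < S \<Longrightarrow> norm (z t) \<le> R + 1" for S
    unfolding trajectory_def
  proof
    show "abs_cont_on 0 S z"
      by (rule lipschitz_imp_abs_cont_on[OF lipschitz_on_subset[OF z_lip]]) (use S in auto)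
    show "AE t in lborel. 0 < t \<and> t < S \<longrightarrow> (\<exists>d. (z has_vector_derivative d) (at t) \<and> d \<in> F (z t) (u t))"
      using z_der
    proof (eventually_elim, intro impI)
      fix t assume A: "0 < t \<and> t < T2 \<longrightarrow> (\<exists>d. (z has_vector_derivative d) (at t) \<and> d \<in> F (P (z t)) (u t))"
        and t: "0 < t \<and> t < S"
      have "P (z t) = z t" using in_ball t by (simp add: P_id)
      then show "\<exists>d. (z has_vector_derivative d) (at t) \<and> d \<in> F (z t) (u t)" using A t S by auto
    qed
  qed
  have z0: "z 0 = x0" using T0 g(2)[of 0] x0 by (simp add: z_def)
  have z_cont: "continuous_on {0..T2} z" by (rule lipschitz_on_continuous_on[OF z_lip])
  have z_ball: "norm (z t) \<le> R + 1" if t: "t \<in> {0..T2}" for t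
  proof (rule ccontr)
    assume bad: "\<not> norm (z t) \<le> R + 1"
    \<comment> \<open>At the first time \<open>b\<close> with norm at least \<open>R + 1\<close> the
      arc has so far solved the original inclusion, so the a priori estimate bounds it by
      \<open>R\<close> at \<open>b\<close>.\<close>
    define A where "A = {0..T2} \<inter> (\<lambda>t. norm (z t)) -` {R + 1..}"
    have "closed A" unfolding A_def
      by (intro continuous_closed_preimage continuous_on_norm z_cont) auto
    then have "compact A" unfolding compact_eq_bounded_closed
      by (auto simp: A_def intro: bounded_subset[OF bounded_closed_interval])
    moreover have "A \<noteq> {}" using bad t by (auto simp: A_def)
    ultimately obtain b where b: "b \<in> A" "\<And>s. s \<in> A \<Longrightarrow> b \<le> s" using compact_attains_inf by metis
    have bT: "0 \<le> b" "b \<le> T2" "R + 1 \<le> norm (z b)" using b(1) by (auto simp: A_def)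
    have "norm (z s) \<le> R + 1" if "0 < s" "s < b" for s
      using b(2)[of s] that bT by (force simp: A_def)
    then have "trajectory F u b z" using bT by (intro z_traj) auto
    then have "norm (z b) \<le> R" using apriori bT z0 by blast
    then show False using bT by simp
  qed
  have "is_solution F u (z 0) (ereal T2) z"
    by (rule is_solution_if_trajectories) (use T T0 z_ball in \<open>auto intro!: z_traj\<close>)
  then show thesis using that[of z] z0 g(2) by (auto simp: z_def)
qed

text \<open>Extensions are available over finite intervals only and need not be unique, so they are
  chosen successively, each agreeing with its predecessor, and then glued.\<close>

lemma extend_solution_global:
  fixes F :: "'a::euclidean_space \<Rightarrow> 'b::euclidean_space \<Rightarrow> 'a set"
  assumes x: "is_solution F u x0 (ereal T) x"
    and ext: "\<And>T T2 x. T \<le> T2 \<Longrightarrow> is_solution F u x0 (ereal T) x \<Longrightarrow>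
      \<exists>y. is_solution F u x0 (ereal T2) y \<and> (\<forall>t. 0 \<le> t \<and> t < T \<longrightarrow> y t = x t)"
  obtains y where "is_solution F u x0 \<infinity> y" "\<And>t. 0 \<le> t \<Longrightarrow> t < T \<Longrightarrow> y t = x t"
proof -
  have T0: "0 < T" using x by (simp add: is_solution_def)
  have "\<exists>Y. \<forall>n. (is_solution F u x0 (ereal (T + real n)) (Y n) \<and> (n = 0 \<longrightarrow> Y n = x)) \<and>
      (\<forall>t. 0 \<le> t \<and> t < T + real n \<longrightarrow> Y (Suc n) t = Y n t)"
  proof (rule dependent_nat_choice)
    show "\<exists>y. is_solution F u x0 (ereal (T + real 0)) y \<and> (0 = 0 \<longrightarrow> y = x)" using x by auto
    show "\<exists>z. (is_solution F u x0 (ereal (T + real (Suc n))) z \<and> (Suc n = 0 \<longrightarrow> z = x)) \<and>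
        (\<forall>t. 0 \<le> t \<and> t < T + real n \<longrightarrow> z t = y t)"
      if "is_solution F u x0 (ereal (T + real n)) y \<and> (n = 0 \<longrightarrow> y = x)" for y n
      using ext[of "T + real n" "T + real (Suc n)" y] that by auto
  qed
  then obtain Y where Y: "\<And>n. is_solution F u x0 (ereal (T + real n)) (Y n)" "Y 0 = x"
    and step: "\<And>n t. 0 \<le> t \<Longrightarrow> t < T + real n \<Longrightarrow> Y (Suc n) t = Y n t" by blast
  have agree: "Y (n + k) t = Y n t" if "0 \<le> t" "t < T + real n" for n k t
    by (induction k) (use that step in auto)
  \<comment> \<open>The index \<open>nat \<lceil>t\<rceil>\<close> is large enough because
    \<open>T > 0\<close> gives \<open>t < T + real (nat \<lceil>t\<rceil>)\<close>.\<close>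
  define y where "y t = Y (nat \<lceil>t\<rceil>) t" for t
  have yY: "y t = Y n t" if t: "0 \<le> t" "t < T + real n" for n t
  proof -
    have c: "t < T + real (nat \<lceil>t\<rceil>)" using T0 by linarith
    define m where "m = nat \<lceil>t\<rceil>"
    have "Y m t = Y n t"
    proof (cases "n \<le> m")
      case True
      then show ?thesis using agree[OF t, of "m - n"] by simp
    next
      case False
      then show ?thesis using agree[OF t(1) c, of "n - m"] by (simp add: m_def[symmetric])
    qed
    then show ?thesis by (simp add: y_def m_def)
  qed
  have "trajectory F u S y" if S: "0 \<le> S" for S
  proof (rule trajectory_cong)
    have c: "S < T + real (nat \<lceil>S\<rceil>)" using T0 by linarith
    then show "trajectory F u S (Y (nat \<lceil>S\<rceil>))" by (intro is_solution_imp_trajectory[OF Y(1) S]) simp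
    show "Y (nat \<lceil>S\<rceil>) t = y t" if "0 \<le> t" "t \<le> S" for t
      using yY[of t "nat \<lceil>S\<rceil>"] that c by simp
  qed
  then have "is_solution F u (y 0) \<infinity> y" by (intro is_solution_if_trajectories) auto
  moreover have "y 0 = x0" using yY[of 0 0] T0 Y x by (simp add: is_solution_def)
  ultimately show thesis using that[of y] yY[of _ 0] Y(2) by simp
qed

theorem theorem1:
  fixes F :: "'a::euclidean_space \<Rightarrow> 'b::euclidean_space \<Rightarrow> 'a set"
    and V :: "'a \<Rightarrow> real"
  assumes F_values: "\<And>x u. F x u \<noteq> {} \<and> compact (F x u) \<and> convex (F x u)"
    and F_locbdd: "locally_bounded_map F"
    and F_usc: "\<And>u. usc_map (\<lambda>x. F x u)"
    and F_cont: "\<And>x. cont_map (\<lambda>u. F x u)"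
    and F_origin: "F 0 0 = {0}"
    and V_lip: "locally_lipschitz V"
    and V_np: "nonpathological V"
    and alpha_lo: "class_K_inf \<alpha>lo" and alpha_hi: "class_K_inf \<alpha>hi"
    and rho: "class_PD \<rho>" and gamma: "class_K \<gamma>"
    and sandwich: "\<And>x. \<alpha>lo (norm x) \<le> V x \<and> V x \<le> \<alpha>hi (norm x)"
    and decrease: "\<And>x u. V x > \<gamma> (norm u) \<Longrightarrow>
                      (\<forall>a\<in>lie_gen_deriv F V x u. a \<le> - \<rho> (norm x))"
  shows "ISS F"
proof -
  obtain \<beta> \<kappa> where KL: "class_KL \<beta>" and K: "class_K \<kappa>"
    and est: "\<And>x u S U. trajectory F u S x \<Longrightarrow> 0 \<le> S \<Longrightarrow> 0 \<le> U \<Longrightarrow>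
      (AE t in lborel. 0 \<le> t \<and> t \<le> S \<longrightarrow> norm (u t) \<le> U) \<Longrightarrow> norm (x S) \<le> \<beta> (norm (x 0)) S + \<kappa> U"
    using lyapunov_iss_estimate[OF V_np alpha_lo alpha_hi rho gamma sandwich decrease] by blast
  have ext: "\<exists>y. is_solution F u x0 (ereal T2) y \<and> (\<forall>t. 0 \<le> t \<and> t < T \<longrightarrow> y t = x t)"
    if u: "admissible_input u" and T: "T \<le> T2" and x: "is_solution F u x0 (ereal T) x" for u x0 T T2 x
  proof -
    have T2: "0 \<le> T2" using x T by (simp add: is_solution_def)
    \<comment> \<open>A bound uniform in \<open>S\<close>: the decay is evaluated at time 0 and the
      input bound is taken over all of \<open>[0,T2]\<close>.\<close>
    have "norm (y S) \<le> \<beta> (norm x0) 0 + \<kappa> (ess_sup_norm u T2)"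
      if y: "trajectory F u S y" "y 0 = x0" and S: "0 \<le> S" "S \<le> T2" for y S
    proof -
      have "AE t in lborel. 0 \<le> t \<and> t \<le> S \<longrightarrow> norm (u t) \<le> ess_sup_norm u T2"
        using ess_sup_norm_props(2)[OF u T2] by eventually_elim (use S in auto)
      from est[OF y(1) S(1) ess_sup_norm_props(1)[OF u T2] this]
      have "norm (y S) \<le> \<beta> (norm x0) S + \<kappa> (ess_sup_norm u T2)" by (simp add: y(2))
      moreover have "\<beta> (norm x0) S \<le> \<beta> (norm x0) 0" using KL S by (simp add: class_KL_def)
      ultimately show ?thesis by simp
    qed
    then show ?thesis
      using extend_solution[OF F_values F_locbdd F_usc F_cont u _ x T] by metis
  qed
  show ?thesis
    unfolding ISS_def
  proof (rule exI[of _ \<beta>], rule exI[of _ \<kappa>], intro conjI allI impI KL K)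
    fix x0 u T x assume u: "admissible_input u" and x: "is_solution F u x0 T x"
    show "\<exists>y. is_solution F u x0 \<infinity> y \<and> (\<forall>t. 0 \<le> t \<and> ereal t < T \<longrightarrow> y t = x t)"
    proof (cases T)
      case (real r)
      then have xr: "is_solution F u x0 (ereal r) x" using x by simp
      obtain y where "is_solution F u x0 \<infinity> y" "\<And>t. 0 \<le> t \<Longrightarrow> t < r \<Longrightarrow> y t = x t"
        using extend_solution_global[OF xr ext[OF u]] by blast
      then show ?thesis using real by auto
    next
      case PInf
      then show ?thesis using x by auto
    next
      case MInf
      then show ?thesis using x by (simp add: is_solution_def)
    qed
  next
    fix x0 u x and t :: real
    assume u: "admissible_input u" and x: "is_solution F u x0 \<infinity> x" and t: "0 \<le> t"
    have "trajectory F u t x" by (rule is_solution_imp_trajectory[OF x t]) simp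
    from est[OF this t ess_sup_norm_props[OF u t]] x
    show "norm (x t) \<le> \<beta> (norm x0) t + \<kappa> (ess_sup_norm u t)" by (simp add: is_solution_def)
  qed
qed

end
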